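(* (i) Let $g$ be a smooth Riemannian metric of positive curvature on $S^2$. Then there exists $\rho_0>0$ such that for every $\rho$ with $0<\rho<\rho_0$ there is a constant $C(g,\rho)>0$ such that every admissible isometric embedding $X:(S^2,g)\to (S^{2,1}_\rho,\overline g)$ satisfies $$|A|^2\le C(g,\rho)$$ at every point of $S^2$. (ii) Let $n\ge 2$, let $\rho>0$, and let $g$ be a smooth Riemannian metric on $S^n$ whose scalar curvature $R$ satisfies $$\rho^{-2}n(n-2)<R<\rho^{-2}n(n-1)$$ everywhere on $S^n$. Then there is a constant $C(n,g,\rho)$, depending only on $n$, $g$ and $\rho$, such that every admissible isometric embedding $X:(S^n,g)\to(S^{n,1}_\rho,\overline g)$ satisfies $$|A|^2\le C(n,g,\rho)$$ at every point of $S^n$.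
   Context: $\mathbb{R}^{n+1,1}$ is $(n+2)$-dimensional Minkowski space with standard orthogonal basis $E_0,E_1,\dots,E_{n+1}$, where $\langle E_0,E_0\rangle=-1$ and $\langle E_i,E_i\rangle=1$ for $i\ge1$. For $\rho>0$, scaled de Sitter space is $S^{n,1}_\rho=\{x\in\mathbb{R}^{n+1,1}:\langle x,x\rangle=\rho^2\}$ with the induced Lorentzian metric $\overline g$; it has dimension $n+1$. An isometric embedding $X:(S^n,g)\to(S^{n,1}_\rho,\overline g)$ is a smooth embedding of the manifold $S^n$ with $X^*\overline g=g$; since $g$ is Riemannian, it is spacelike. Here $\nu$ denotes the downward pointing timelike unit normal of $X$ in $S^{n,1}_\rho$ (so $\langle\nu,\nu\rangle=-1$, and downward pointing means $\langle\nu,E_0\rangle>0$). The second fundamental form $A$ is defined by $\overline\nabla_XY=\nabla_XY-A(X,Y)\nu$ for tangent fields $X,Y$, where $\overline\nabla$ and $\nabla$ are the Levi-Civita connections of $\overline g$ and $g$; equivalently $A(X,Y)=-\langle\overline\nabla_Y\nu,X\rangle$. $|A|^2$ is the squared norm of $A$ with respect to $g$. The principal curvatures $\vec\lambda=(\lambda_1,\dots,\lambda_n)$ are the eigenvalues of $A$ with respect to $g$. Let $P_2(\lambda)=\sum_{i<j}\lambda_i\lambda_j$, and let $\Gamma_2$ be the connected component of $\{\lambda\in\mathbb{R}^n:P_2(\lambda)>0\}$ containing the positive cone $\{\lambda_i>0\ \forall i\}$. The embedding is called admissible if $\vec\lambda\in\Gamma_2$ at every point. The scalar curvature $R$ is normalized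 so that a round $n$-sphere of radius $r$ has $R=n(n-1)/r^2$. *)

theory Defs
  imports "HOL-Analysis.Analysis"
begin

primrec Ck_on :: "nat \<Rightarrow> 'a::real_normed_vector set \<Rightarrow> ('a \<Rightarrow> 'b::real_normed_vector) \<Rightarrow> bool" where
  "Ck_on 0 U f \<longleftrightarrow> continuous_on U f"
| "Ck_on (Suc k) U f \<longleftrightarrow>
     (\<forall>x\<in>U. f differentiable (at x)) \<and> (\<forall>v. Ck_on k U (\<lambda>x. frechet_derivative f (at x) v))"

text \<open>
  A map on an embedded submanifold \<open>M\<close> is smooth iff it extends locally to a smooth map on an
  open subset of the ambient space. Only the values on \<open>M\<close> matter, here and in all definitions
  below.
\<close>

definition smooth_map_on :: "'a::euclidean_space set \<Rightarrow> ('a \<Rightarrow> 'b::euclidean_space) \<Rightarrow> bool" where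
  "smooth_map_on M f \<longleftrightarrow>
     (\<forall>p\<in>M. \<exists>U F. open U \<and> p \<in> U \<and> (\<forall>k. Ck_on k U F) \<and> (\<forall>x\<in>U \<inter> M. F x = f x))"

definition tangent_space :: "'a::euclidean_space set \<Rightarrow> 'a \<Rightarrow> 'a set" where
  "tangent_space M p =
     {v. \<exists>c :: real \<Rightarrow> 'a. range c \<subseteq> M \<and> c 0 = p \<and> (c has_vector_derivative v) (at 0)}"

text \<open>
  The derivative within \<open>M\<close> is determined only on the tangent space; it is only ever applied to
  tangent vectors.
\<close>

definition tderiv ::
  "'a::euclidean_space set \<Rightarrow> ('a \<Rightarrow> 'b::euclidean_space) \<Rightarrow> 'a \<Rightarrow> 'a \<Rightarrow> 'b" where
  "tderiv M f p v = frechet_derivative f (at p within M) v"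

definition fields_along ::
  "'a::euclidean_space set \<Rightarrow> 'b::euclidean_space set \<Rightarrow> ('a \<Rightarrow> 'b) \<Rightarrow> ('a \<Rightarrow> 'b) set" where
  "fields_along M N X = {Y. smooth_map_on M Y \<and> (\<forall>p\<in>M. Y p \<in> tangent_space N (X p))}"

definition vector_fields :: "'a::euclidean_space set \<Rightarrow> ('a \<Rightarrow> 'a) set" where
  "vector_fields M = fields_along M M (\<lambda>p. p)"

definition ext_field :: "'a::euclidean_space set \<Rightarrow> 'a \<Rightarrow> 'a \<Rightarrow> ('a \<Rightarrow> 'a)" where
  "ext_field M p v = (SOME V. V \<in> vector_fields M \<and> V p = v)"

definition lie_bracket ::
  "'a::euclidean_space set \<Rightarrow> ('a \<Rightarrow> 'a) \<Rightarrow> ('a \<Rightarrow> 'a) \<Rightarrow> ('a \<Rightarrow> 'a)" where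
  "lie_bracket M V W p = tderiv M W p (V p) - tderiv M V p (W p)"

type_synonym 'a form2 = "'a \<Rightarrow> 'a \<Rightarrow> 'a \<Rightarrow> real"

definition riemannian_metric :: "'a::euclidean_space set \<Rightarrow> 'a form2 \<Rightarrow> bool" where
  "riemannian_metric M g \<longleftrightarrow>
     (\<forall>p\<in>M. \<forall>u\<in>tangent_space M p. \<forall>v\<in>tangent_space M p. \<forall>w\<in>tangent_space M p. \<forall>a b.
        g p u v = g p v u \<and>
        g p (a *\<^sub>R u + b *\<^sub>R v) w = a * g p u w + b * g p v w \<and>
        (u \<noteq> 0 \<longrightarrow> g p u u > 0)) \<and>
     (\<forall>V\<in>vector_fields M. \<forall>W\<in>vector_fields M. smooth_map_on M (\<lambda>p. g p (V p) (W p)))"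

text \<open>Connections in the pullback of the tangent bundle of \<open>N\<close> along a map \<open>X\<close> from \<open>M\<close> to \<open>N\<close>.\<close>

definition connection_along ::
  "'a::euclidean_space set \<Rightarrow> 'b::euclidean_space set \<Rightarrow> ('a \<Rightarrow> 'b)
     \<Rightarrow> (('a \<Rightarrow> 'a) \<Rightarrow> ('a \<Rightarrow> 'b) \<Rightarrow> ('a \<Rightarrow> 'b)) \<Rightarrow> bool" where
  "connection_along M N X D \<longleftrightarrow>
     (\<forall>V\<in>vector_fields M. \<forall>Y\<in>fields_along M N X. D V Y \<in> fields_along M N X) \<and>
     (\<forall>V\<in>vector_fields M. \<forall>W\<in>vector_fields M. \<forall>Y\<in>fields_along M N X.
        \<forall>f. smooth_map_on M f \<longrightarrow>
          (\<forall>p\<in>M. D (\<lambda>q. f q *\<^sub>R V q + W q) Y p = f p *\<^sub>R D V Y p + D W Y p)) \<and>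
     (\<forall>V\<in>vector_fields M. \<forall>Y\<in>fields_along M N X. \<forall>Z\<in>fields_along M N X.
        \<forall>p\<in>M. D V (\<lambda>q. Y q + Z q) p = D V Y p + D V Z p) \<and>
     (\<forall>V\<in>vector_fields M. \<forall>Y\<in>fields_along M N X. \<forall>f. smooth_map_on M f \<longrightarrow>
        (\<forall>p\<in>M. D V (\<lambda>q. f q *\<^sub>R Y q) p = tderiv M f p (V p) *\<^sub>R Y p + f p *\<^sub>R D V Y p))"

definition is_levi_civita ::
  "'a::euclidean_space set \<Rightarrow> 'a form2 \<Rightarrow> (('a \<Rightarrow> 'a) \<Rightarrow> ('a \<Rightarrow> 'a) \<Rightarrow> ('a \<Rightarrow> 'a)) \<Rightarrow> bool" where
  "is_levi_civita M g D \<longleftrightarrow>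
     connection_along M M (\<lambda>p. p) D \<and>
     (\<forall>V\<in>vector_fields M. \<forall>W\<in>vector_fields M. \<forall>p\<in>M.
        D V W p - D W V p = lie_bracket M V W p) \<and>
     (\<forall>U\<in>vector_fields M. \<forall>V\<in>vector_fields M. \<forall>W\<in>vector_fields M. \<forall>p\<in>M.
        tderiv M (\<lambda>q. g q (V q) (W q)) p (U p) = g p (D U V p) (W p) + g p (V p) (D U W p))"

text \<open>\<open>D\<close> is unique as an operator on smooth vector fields restricted to \<open>M\<close>.\<close>

definition levi_civita ::
  "'a::euclidean_space set \<Rightarrow> 'a form2 \<Rightarrow> ('a \<Rightarrow> 'a) \<Rightarrow> ('a \<Rightarrow> 'a) \<Rightarrow> ('a \<Rightarrow> 'a)" where
  "levi_civita M g = (SOME D. is_levi_civita M g D)"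

definition curvature_op ::
  "'a::euclidean_space set \<Rightarrow> 'a form2 \<Rightarrow> ('a \<Rightarrow> 'a) \<Rightarrow> ('a \<Rightarrow> 'a) \<Rightarrow> ('a \<Rightarrow> 'a) \<Rightarrow> ('a \<Rightarrow> 'a)" where
  "curvature_op M g U V W p =
     levi_civita M g U (levi_civita M g V W) p
   - levi_civita M g V (levi_civita M g U W) p
   - levi_civita M g (lie_bracket M U V) W p"

text \<open>By tensoriality the choice of the extensions is irrelevant.\<close>

definition riemann :: "'a::euclidean_space set \<Rightarrow> 'a form2 \<Rightarrow> 'a \<Rightarrow> 'a \<Rightarrow> 'a \<Rightarrow> 'a \<Rightarrow> 'a" where
  "riemann M g p u v w =
     curvature_op M g (ext_field M p u) (ext_field M p v) (ext_field M p w) p"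

definition sectional_curvature ::
  "'a::euclidean_space set \<Rightarrow> 'a form2 \<Rightarrow> 'a \<Rightarrow> 'a \<Rightarrow> 'a \<Rightarrow> real" where
  "sectional_curvature M g p u v =
     g p (riemann M g p u v v) u / (g p u u * g p v v - (g p u v)\<^sup>2)"

definition positive_curvature :: "'a::euclidean_space set \<Rightarrow> 'a form2 \<Rightarrow> bool" where
  "positive_curvature M g \<longleftrightarrow>
     (\<forall>p\<in>M. \<forall>u\<in>tangent_space M p. \<forall>v\<in>tangent_space M p.
        u \<noteq> v \<and> independent {u, v} \<longrightarrow> sectional_curvature M g p u v > 0)"

definition orthonormal_frame :: "'a::euclidean_space set \<Rightarrow> 'a form2 \<Rightarrow> 'a \<Rightarrow> 'a set \<Rightarrow> bool" where
  "orthonormal_frame M g p B \<longleftrightarrow>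
     finite B \<and> span B = tangent_space M p \<and>
     (\<forall>e\<in>B. \<forall>f\<in>B. g p e f = (if e = f then 1 else 0))"

text \<open>The two traces below do not depend on the orthonormal frame.\<close>

definition scalar_curvature :: "'a::euclidean_space set \<Rightarrow> 'a form2 \<Rightarrow> 'a \<Rightarrow> real" where
  "scalar_curvature M g p =
     (let B = (SOME B. orthonormal_frame M g p B)
      in \<Sum>e\<in>B. \<Sum>f\<in>B. g p (riemann M g p e f f) e)"

definition norm_squared :: "'a::euclidean_space set \<Rightarrow> 'a form2 \<Rightarrow> 'a form2 \<Rightarrow> 'a \<Rightarrow> real" where
  "norm_squared M g A p =
     (let B = (SOME B. orthonormal_frame M g p B) in \<Sum>e\<in>B. \<Sum>f\<in>B. (A p e f)\<^sup>2)"

text \<open>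
  With \<open>n = CARD('n)\<close>, the first type is \<open>n + 1\<close>-dimensional Euclidean space and the second is
  \<open>n + 2\<close>-dimensional Minkowski space, whose last coordinate is the timelike one.
\<close>

type_synonym 'n euc = "(real ^ 'n) \<times> real"
type_synonym 'n minkowski = "'n euc \<times> real"

definition Sn :: "('n::finite) euc set" where
  "Sn = sphere 0 1"

definition mink :: "('n::finite) minkowski \<Rightarrow> 'n minkowski \<Rightarrow> real" where
  "mink x y = fst x \<bullet> fst y - snd x * snd y"

definition E0 :: "('n::finite) minkowski" where
  "E0 = (0, 1)"

definition de_sitter :: "real \<Rightarrow> ('n::finite) minkowski set" where
  "de_sitter \<rho> = {x. mink x x = \<rho>\<^sup>2}"

definition de_sitter_metric :: "('n::finite) minkowski form2" where
  "de_sitter_metric x u v = mink u v"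

definition smooth_embedding ::
  "'a::euclidean_space set \<Rightarrow> 'b::euclidean_space set \<Rightarrow> ('a \<Rightarrow> 'b) \<Rightarrow> bool" where
  "smooth_embedding M N X \<longleftrightarrow>
     smooth_map_on M X \<and> X ` M \<subseteq> N \<and>
     (\<forall>p\<in>M. inj_on (tderiv M X p) (tangent_space M p)) \<and>
     (\<exists>Y. homeomorphism M (X ` M) X Y)"

definition isometric_embedding ::
  "('n::finite) euc form2 \<Rightarrow> real \<Rightarrow> ('n euc \<Rightarrow> 'n minkowski) \<Rightarrow> bool" where
  "isometric_embedding g \<rho> X \<longleftrightarrow>
     smooth_embedding Sn (de_sitter \<rho>) X \<and>
     (\<forall>p\<in>Sn. \<forall>u\<in>tangent_space Sn p. \<forall>v\<in>tangent_space Sn p.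
        de_sitter_metric (X p) (tderiv Sn X p u) (tderiv Sn X p v) = g p u v)"

definition unit_normal :: "real \<Rightarrow> (('n::finite) euc \<Rightarrow> 'n minkowski) \<Rightarrow> 'n euc \<Rightarrow> 'n minkowski" where
  "unit_normal \<rho> X p =
     (THE \<nu>. \<nu> \<in> tangent_space (de_sitter \<rho>) (X p) \<and>
             (\<forall>v\<in>tangent_space Sn p. de_sitter_metric (X p) \<nu> (tderiv Sn X p v) = 0) \<and>
             de_sitter_metric (X p) \<nu> \<nu> = -1 \<and>
             mink \<nu> E0 > 0)"

text \<open>
  The connection along \<open>X\<close> induced by the Levi-Civita connection of \<open>h\<close>. It gives a meaning to
  covariant derivatives in \<open>N\<close> of fields that are defined only along \<open>X\<close>, without extending
  them to \<open>N\<close>.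
\<close>

definition is_pullback_connection ::
  "'a::euclidean_space set \<Rightarrow> 'b::euclidean_space set \<Rightarrow> 'b form2 \<Rightarrow> ('a \<Rightarrow> 'b)
     \<Rightarrow> (('a \<Rightarrow> 'a) \<Rightarrow> ('a \<Rightarrow> 'b) \<Rightarrow> ('a \<Rightarrow> 'b)) \<Rightarrow> bool" where
  "is_pullback_connection M N h X D \<longleftrightarrow>
     connection_along M N X D \<and>
     (\<forall>V\<in>vector_fields M. \<forall>Z\<in>vector_fields N. \<forall>p\<in>M.
        D V (\<lambda>q. Z (X q)) p = levi_civita N h (ext_field N (X p) (tderiv M X p (V p))) Z (X p))"

definition pullback_connection ::
  "'a::euclidean_space set \<Rightarrow> 'b::euclidean_space set \<Rightarrow> 'b form2 \<Rightarrow> ('a \<Rightarrow> 'b)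
     \<Rightarrow> ('a \<Rightarrow> 'a) \<Rightarrow> ('a \<Rightarrow> 'b) \<Rightarrow> ('a \<Rightarrow> 'b)" where
  "pullback_connection M N h X = (SOME D. is_pullback_connection M N h X D)"

text \<open>
  The Gauss formula with the sign convention \<open>\<nabla>'\<^sub>V W = \<nabla>\<^sub>V W - A(V, W) \<nu>\<close>, where \<open>\<nabla>'\<close> belongs to
  de Sitter space.
\<close>

definition second_fundamental_form ::
  "('n::finite) euc form2 \<Rightarrow> real \<Rightarrow> ('n euc \<Rightarrow> 'n minkowski) \<Rightarrow> 'n euc form2" where
  "second_fundamental_form g \<rho> X p u v =
     (let V = ext_field Sn p u; W = ext_field Sn p v in
      THE a. pullback_connection Sn (de_sitter \<rho>) de_sitter_metric X V (\<lambda>q. tderiv Sn X q (W q)) p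
             = tderiv Sn X p (levi_civita Sn g V W p) - a *\<^sub>R unit_normal \<rho> X p)"

definition principal_curvatures ::
  "('n::finite) euc form2 \<Rightarrow> real \<Rightarrow> ('n euc \<Rightarrow> 'n minkowski) \<Rightarrow> 'n euc \<Rightarrow> real ^ 'n \<Rightarrow> bool" where
  "principal_curvatures g \<rho> X p k \<longleftrightarrow>
     (\<exists>e :: 'n \<Rightarrow> 'n euc. inj e \<and> orthonormal_frame Sn g p (range e) \<and>
        (\<forall>i. \<forall>v\<in>tangent_space Sn p.
           second_fundamental_form g \<rho> X p (e i) v = k $ i * g p (e i) v))"

definition P2 :: "real ^ 'n::finite \<Rightarrow> real" where
  "P2 k = (\<Sum>S | S \<subseteq> UNIV \<and> card S = 2. \<Prod>i\<in>S. k $ i)"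

definition Gamma2 :: "(real ^ 'n::finite) set" where
  "Gamma2 = (THE C. C \<in> components {k. P2 k > 0} \<and> {k. \<forall>i. k $ i > 0} \<subseteq> C)"

text \<open>The principal curvatures are determined up to their order, and \<open>Gamma2\<close> is symmetric.\<close>

definition admissible ::
  "('n::finite) euc form2 \<Rightarrow> real \<Rightarrow> ('n euc \<Rightarrow> 'n minkowski) \<Rightarrow> bool" where
  "admissible g \<rho> X \<longleftrightarrow> (\<forall>p\<in>Sn. \<exists>k. principal_curvatures g \<rho> X p k \<and> k \<in> Gamma2)"

end

theory Submission
  imports Defs
begin

text \<open>
  By the Gauss equation, \<open>\<psi> = H\<^sup>2 - |A|\<^sup>2 = n (n - 1) / \<rho>\<^sup>2 - R\<close> depends on \<open>g\<close> only, so a bound for the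
  mean curvature \<open>H\<close> at its maximum suffices. There, in coordinates that are normal to first order
  and adapted to the principal directions, two differentiations of \<open>\<psi> = H\<^sup>2 - |A|\<^sup>2\<close> together with
  Simons' commutation of the derivatives of \<open>A\<close> give
  \<open>\<Sum>\<^sub>l (H - k\<^sub>l) H\<^sub>l\<^sub>l \<ge> \<Delta>\<psi> / 2 + \<Sum>\<^sub>i\<^sub>j (k\<^sub>i - k\<^sub>j)\<^sup>2 (1 / \<rho>\<^sup>2 - k\<^sub>i k\<^sub>j) / 2\<close>.
  The left-hand side is nonpositive because admissibility gives \<open>H \<ge> |k\<^sub>l|\<close>, and the last sum is at
  least \<open>|A|\<^sup>2 ((n - 1) / \<rho>\<^sup>2 - \<psi> / 2) - \<psi> / \<rho>\<^sup>2\<close>. Both hypotheses force \<open>\<psi> < 2 (n - 1) / \<rho>\<^sup>2\<close>: in part (i)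
  \<open>\<psi> = 2 (1 / \<rho>\<^sup>2 - K)\<close> with \<open>K > 0\<close>, for every \<open>\<rho>\<close>, and in part (ii) \<open>\<psi> < n / \<rho>\<^sup>2\<close>. The bounds on \<open>\<psi>\<close>, \<open>\<Delta>\<psi>\<close> and \<open>g\<close>
  that are needed uniformly come from compactness, applied to one fixed admissible embedding.
\<close>

text \<open>The constant may involve \<open>g\<close> only, whereas \<open>H\<close>,
  \<open>A\<close> and the frame at the maximum belong to the embedding at hand. The estimate sees
  that embedding through three things: \<open>psi\<close>, which the scalar curvature fixes; the
  Christoffel symbols, which agree for all isometric embeddings because the Levi-Civita connection
  is unique; and a \<open>g\<close>-orthonormal frame, whose Euclidean length is bounded in terms of
  \<open>g\<close>. The reference embedding makes these data accessible: \<open>g\<close> is merely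
  a form on tangent vectors, but it becomes \<open>mink\<close> of differentials of a smooth map,
  which can be differentiated. Gradient terms are harmless: differentiating H^2 - |A|^2 twice leaves
  -|dH|^2 + |dA|^2 on the right-hand side with the signs - for psi moved over, so the first part
  vanishes at the maximum of \<open>H\<close> and the second helps. Since Minkowski space is flat,
  the commutation of derivatives of \<open>A\<close> reduces to symmetry of ordinary partial
  derivatives of the position vector. The notions involved pick connections, frames, extensions and
  normals by \<open>SOME\<close> or \<open>THE\<close>; each has to be identified with an explicit
  formula before anything can be computed.\<close>

section \<open>Calculus of iterated directional derivatives on open sets\<close>

abbreviation dird :: "('a::real_normed_vector \<Rightarrow> 'b::real_normed_vector) \<Rightarrow> 'a \<Rightarrow> 'a \<Rightarrow> 'b" where
  "dird f v x \<equiv> frechet_derivative f (at x) v"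

definition smooth_on :: "'a::real_normed_vector set \<Rightarrow> ('a \<Rightarrow> 'b::real_normed_vector) \<Rightarrow> bool" where
  "smooth_on U f \<longleftrightarrow> (\<forall>k. Ck_on k U f)"

lemma Ck_on_continuous: "Ck_on k U f \<Longrightarrow> continuous_on U f"
  by (cases k) (auto intro!: continuous_at_imp_continuous_on differentiable_imp_continuous_within)

lemma Ck_on_SucD: "Ck_on (Suc k) U f \<Longrightarrow> Ck_on k U f"
proof (induction k arbitrary: f)
  case 0
  then show ?case using Ck_on_continuous[OF 0] by simp
next
  case (Suc k)
  then show ?case by (simp del: Ck_on.simps(1))
qed

lemma Ck_on_subset: "Ck_on k U f \<Longrightarrow> V \<subseteq> U \<Longrightarrow> Ck_on k V f"
  by (induction k arbitrary: f) (auto intro: continuous_on_subset)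

lemma dird_eqI: "(f has_derivative f') (at x) \<Longrightarrow> dird f v x = f' v"
  by (metis frechet_derivative_at)

lemma dird_cong_open:
  assumes "open U" "x \<in> U" "\<And>y. y \<in> U \<Longrightarrow> f y = g y" "g differentiable (at x)"
  shows "f differentiable (at x)" "dird f v x = dird g v x"
proof -
  have "(f has_derivative frechet_derivative g (at x)) (at x)"
    using assms frechet_derivative_works has_derivative_transform_within_open
    by (metis (no_types, lifting))
  then show "f differentiable (at x)" "dird f v x = dird g v x"
    by (auto simp: differentiable_def dird_eqI)
qed

text \<open>On an open set a derivative at a point sees only nearby values in the set, so agreement
  passes to every order of differentiation.\<close>

lemma Ck_on_cong:
  assumes "open U" "\<And>y. y \<in> U \<Longrightarrow> f y = g y" "Ck_on k U g"
  shows "Ck_on k U f"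
  using assms(2,3)
proof (induction k arbitrary: f g)
  case 0
  then show ?case using continuous_on_cong by (metis Ck_on.simps(1))
next
  case (Suc k)
  have d: "f differentiable (at x)" "\<And>v. dird f v x = dird g v x" if "x \<in> U" for x
    using dird_cong_open[OF assms(1) that, of f g] Suc.prems that by auto
  show ?case
    using Suc.IH[of "dird f v" "dird g v" for v] d Suc.prems by auto
qed

lemma smooth_onD:
  assumes "smooth_on U f"
  shows "x \<in> U \<Longrightarrow> f differentiable (at x)" "smooth_on U (dird f v)"
    "continuous_on U f"
proof -
  have 1: "Ck_on k U f" for k using assms by (simp add: smooth_on_def)
  show "x \<in> U \<Longrightarrow> f differentiable (at x)" "smooth_on U (dird f v)"
    using 1[of "Suc k" for k] by (auto simp: smooth_on_def)
  show "continuous_on U f" using 1[of 0] by simp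
qed

lemma smooth_on_subset: "smooth_on U f \<Longrightarrow> V \<subseteq> U \<Longrightarrow> smooth_on V f"
  unfolding smooth_on_def by (auto intro: Ck_on_subset)

lemma smooth_on_cong: "smooth_on U g \<Longrightarrow> open U \<Longrightarrow> (\<And>y. y \<in> U \<Longrightarrow> f y = g y) \<Longrightarrow> smooth_on U f"
  unfolding smooth_on_def using Ck_on_cong[of U f g] by simp

lemma smooth_has_derivative:
  "smooth_on U f \<Longrightarrow> x \<in> U \<Longrightarrow> (f has_derivative (\<lambda>v. dird f v x)) (at x)"
  using smooth_onD(1) frechet_derivative_works by blast

lemma dird_linear: "f differentiable (at x) \<Longrightarrow> linear (\<lambda>v. dird f v x)"
  using linear_frechet_derivative by fastforce

lemma dird_has_derivative:
  "f differentiable (at x) \<Longrightarrow> (f has_derivative (\<lambda>v. dird f v x)) (at x)"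
  using frechet_derivative_works by blast

lemma Ck_on_const: "Ck_on k U (\<lambda>x. c)"
  by (induction k arbitrary: c) auto

lemma Ck_on_linear:
  assumes "bounded_linear f"
  shows "Ck_on k U f"
proof (cases k)
  case 0
  then show ?thesis using assms by (simp add: linear_continuous_on)
next
  case (Suc j)
  have "dird f v x = f v" for v x
    using bounded_linear_imp_has_derivative[OF assms] by (rule dird_eqI)
  then show ?thesis
    using Suc bounded_linear_imp_differentiable[OF assms] by (auto simp: Ck_on_const)
qed

lemma Ck_on_add:
  assumes "open U" "Ck_on k U f" "Ck_on k U g"
  shows "Ck_on k U (\<lambda>x. f x + g x)"
  using assms(2,3)
proof (induction k arbitrary: f g)
  case 0
  then show ?case by (auto intro: continuous_on_add)
next
  case (Suc k)
  have d: "dird (\<lambda>x. f x + g x) v x = dird f v x + dird g v x" if "x \<in> U" for v x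
    using Suc.prems that by (intro dird_eqI has_derivative_add dird_has_derivative) auto
  show ?case
    using Suc d assms(1) by (auto intro!: Ck_on_cong[OF assms(1) d] Suc.IH differentiable_add)
qed

lemma Ck_on_sum:
  assumes "open U" "\<And>i. i \<in> I \<Longrightarrow> Ck_on k U (f i)"
  shows "Ck_on k U (\<lambda>x. \<Sum>i\<in>I. f i x)"
  using assms(2)
  by (induction I rule: infinite_finite_induct) (auto simp: Ck_on_const intro!: Ck_on_add[OF assms(1)])

lemma Ck_on_bilinear:
  assumes B: "bounded_bilinear B" and "open U" "Ck_on k U f" "Ck_on k U g"
  shows "Ck_on k U (\<lambda>x. B (f x) (g x))"
  using assms(3,4)
proof (induction k arbitrary: f g)
  case 0
  then show ?case by (auto intro: bounded_bilinear.continuous_on[OF B])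
next
  case (Suc k)
  have hd: "((\<lambda>x. B (f x) (g x)) has_derivative (\<lambda>v. B (f x) (dird g v x) + B (dird f v x) (g x))) (at x)"
    if "x \<in> U" for x
    using Suc.prems that by (intro bounded_bilinear.FDERIV[OF B] dird_has_derivative) auto
  have "Ck_on k U (dird (\<lambda>x. B (f x) (g x)) v)" for v
    using Suc.prems Ck_on_SucD[OF Suc.prems(1)] Ck_on_SucD[OF Suc.prems(2)]
    by (auto intro!: Ck_on_cong[OF assms(2) dird_eqI[OF hd]] Suc.IH Ck_on_add[OF assms(2)])
  then show ?case
    using hd by (auto simp: differentiable_def)
qed

lemma dird_basis:
  fixes f :: "'a::euclidean_space \<Rightarrow> 'b::real_normed_vector"
  assumes "f differentiable (at x)"
  shows "dird f v x = (\<Sum>b\<in>Basis. (v \<bullet> b) *\<^sub>R dird f b x)"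
proof -
  have "dird f v x = dird f (\<Sum>b\<in>Basis. (v \<bullet> b) *\<^sub>R b) x"
    by (simp add: euclidean_representation)
  also have "\<dots> = (\<Sum>b\<in>Basis. (v \<bullet> b) *\<^sub>R dird f b x)"
    by (simp add: linear_sum[OF dird_linear[OF assms]] linear_cmul[OF dird_linear[OF assms]])
  finally show ?thesis .
qed

lemma Ck_on_compose:
  fixes f :: "'b::euclidean_space \<Rightarrow> 'c::real_normed_vector"
  assumes "open U" "Ck_on k U g" "g ` U \<subseteq> W" "Ck_on k W f"
  shows "Ck_on k U (\<lambda>x. f (g x))"
  using assms(2,4)
proof (induction k arbitrary: f)
  case 0
  then show ?case
    using continuous_on_compose2 assms(3) by (metis Ck_on.simps(1))
next
  case (Suc k)
  have hd: "((\<lambda>x. f (g x)) has_derivative (\<lambda>v. dird f (dird g v x) (g x))) (at x)"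
    if "x \<in> U" for x
  proof -
    have "(f has_derivative (\<lambda>v. dird f v (g x))) (at (g x))"
      "(g has_derivative (\<lambda>v. dird g v x)) (at x)"
      using Suc.prems that assms(3) by (auto simp: image_subset_iff intro!: dird_has_derivative)
    then show ?thesis using has_derivative_compose by fast
  qed
  \<comment> \<open>\<open>Ck_on\<close> differentiates in fixed directions, but the chain rule
    produces the moving direction \<open>dird g v x\<close>. Expanding it over \<open>Basis\<close>
    gives products to which the induction hypothesis applies.\<close>
  have eq: "dird (\<lambda>x. f (g x)) v x = (\<Sum>b\<in>Basis. (dird g v x \<bullet> b) *\<^sub>R dird f b (g x))"
    if "x \<in> U" for v x
  proof -
    have "f differentiable (at (g x))" using Suc.prems that assms(3) by auto
    from dird_basis[OF this, of "dird g v x"] show ?thesis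
      using dird_eqI[OF hd[OF that], of v] by (rule trans[rotated])
  qed
  have g: "Ck_on k U g" using Ck_on_SucD[OF Suc.prems(1)] .
  have c: "Ck_on k U (\<lambda>x. (dird g v x \<bullet> b) *\<^sub>R dird f b (g x))" for v b
  proof (rule Ck_on_bilinear[OF bounded_bilinear_scaleR assms(1)])
    show "Ck_on k U (\<lambda>x. dird g v x \<bullet> b)"
      using Suc.prems(1)
      by (intro Ck_on_bilinear[OF bounded_bilinear_inner assms(1) _ Ck_on_const]) simp
    show "Ck_on k U (\<lambda>x. dird f b (g x))"
      using Suc.prems(2) by (intro Suc.IH[OF g]) simp
  qed
  have "Ck_on k U (dird (\<lambda>x. f (g x)) v)" for v
    by (rule Ck_on_cong[OF assms(1) eq Ck_on_sum[OF assms(1) c]])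
  then show ?case
    using hd by (auto simp: differentiable_def)
qed

lemma Ck_on_linear_compose:
  fixes f :: "_ \<Rightarrow> 'b::euclidean_space"
  assumes "open U" "bounded_linear h" "Ck_on k U f"
  shows "Ck_on k U (\<lambda>x. h (f x))"
  by (rule Ck_on_compose[OF assms(1,3) subset_UNIV Ck_on_linear[OF assms(2)]])

lemma Ck_on_inverse: "Ck_on k (- {0}) (inverse :: real \<Rightarrow> real)"
proof (induction k)
  case 0
  then show ?case by (auto intro: continuous_on_inverse continuous_on_id)
next
  case (Suc k)
  have hd: "(inverse has_derivative (\<lambda>v. - (inverse x * v * inverse x))) (at x)" if "x \<noteq> 0" for x :: real
    using has_derivative_inverse'[OF that] by simp
  have "Ck_on k (- {0}) (dird inverse v)" for v :: real
  proof (rule Ck_on_cong)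
    show "dird inverse v y = - (inverse y * v * inverse y)" if "y \<in> - {0}" for y
      using hd that by (intro dird_eqI) auto
    show "Ck_on k (- {0}) (\<lambda>y. - (inverse y * v * inverse y))"
      by (rule Ck_on_linear_compose[OF _ bounded_linear_minus[OF bounded_linear_ident]
        Ck_on_bilinear[OF bounded_bilinear_mult _ Ck_on_bilinear[OF bounded_bilinear_mult _ Suc Ck_on_const] Suc]]) auto
  qed auto
  then show ?case
    using hd by (auto simp: differentiable_def)
qed

lemma Ck_on_sqrt: "Ck_on k {0<..} sqrt"
proof (induction k)
  case 0
  then show ?case by (auto intro: continuous_on_real_sqrt continuous_on_id)
next
  case (Suc k)
  have hd: "(sqrt has_derivative (\<lambda>v. inverse (sqrt x) * (v / 2))) (at x)" if "x > 0" for x :: real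
    using DERIV_real_sqrt[OF that] unfolding has_field_derivative_def
    by (rule has_derivative_eq_rhs) (auto simp: fun_eq_iff)
  have i: "Ck_on k {0<..} (\<lambda>x. inverse (sqrt x))"
    by (rule Ck_on_compose[OF _ Suc _ Ck_on_inverse]) auto
  have "Ck_on k {0<..} (dird sqrt v)" for v :: real
  proof (rule Ck_on_cong)
    show "dird sqrt v y = inverse (sqrt y) * (v / 2)" if "y \<in> {0<..}" for y
      using hd that by (intro dird_eqI) auto
    show "Ck_on k {0<..} (\<lambda>y. inverse (sqrt y) * (v / 2))"
      by (rule Ck_on_bilinear[OF bounded_bilinear_mult _ i Ck_on_const]) auto
  qed auto
  then show ?case
    using hd by (auto simp: differentiable_def)
qed

lemma smooth_on_const: "smooth_on U (\<lambda>x. c)"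
  by (simp add: smooth_on_def Ck_on_const)

lemma smooth_on_linear: "bounded_linear h \<Longrightarrow> smooth_on U h"
  by (simp add: smooth_on_def Ck_on_linear)

lemma smooth_on_id: "smooth_on U (\<lambda>x. x)"
  by (rule smooth_on_linear[OF bounded_linear_ident])

lemma smooth_on_add:
  "open U \<Longrightarrow> smooth_on U f \<Longrightarrow> smooth_on U g \<Longrightarrow> smooth_on U (\<lambda>x. f x + g x)"
  by (simp add: smooth_on_def Ck_on_add)

lemma smooth_on_sum:
  "open U \<Longrightarrow> (\<And>i. i \<in> I \<Longrightarrow> smooth_on U (F i)) \<Longrightarrow> smooth_on U (\<lambda>x. \<Sum>i\<in>I. F i x)"
  by (simp add: smooth_on_def Ck_on_sum)

lemma smooth_on_bilinear:
  assumes "bounded_bilinear B" "open U" "smooth_on U f" "smooth_on U g"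
  shows "smooth_on U (\<lambda>x. B (f x) (g x))"
  using assms Ck_on_bilinear[OF assms(1,2)] unfolding smooth_on_def by simp

lemma smooth_on_compose:
  fixes f :: "'b::euclidean_space \<Rightarrow> 'c::real_normed_vector"
  assumes "open U" "smooth_on U g" "g ` U \<subseteq> W" "smooth_on W f"
  shows "smooth_on U (\<lambda>x. f (g x))"
  unfolding smooth_on_def
proof
  fix k show "Ck_on k U (\<lambda>x. f (g x))"
    by (rule Ck_on_compose[OF assms(1) _ assms(3)]) (use assms(2,4) in \<open>auto simp: smooth_on_def\<close>)
qed

lemma smooth_on_linear_compose:
  "open U \<Longrightarrow> bounded_linear h \<Longrightarrow> smooth_on U f \<Longrightarrow> smooth_on U (\<lambda>x. h (f x))"
  for f :: "_ \<Rightarrow> 'b::euclidean_space"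
  using smooth_on_compose[of U f UNIV h] smooth_on_linear by auto

lemma smooth_on_diff:
  fixes f g :: "_ \<Rightarrow> 'b::euclidean_space"
  assumes "open U" "smooth_on U f" "smooth_on U g"
  shows "smooth_on U (\<lambda>x. f x - g x)"
  using smooth_on_add[OF assms(1,2) smooth_on_linear_compose[OF assms(1) bounded_linear_minus[OF bounded_linear_ident] assms(3)]]
  by simp

lemma smooth_on_inverse:
  assumes "open U" "smooth_on U f" "\<And>x. x \<in> U \<Longrightarrow> f x \<noteq> (0::real)"
  shows "smooth_on U (\<lambda>x. inverse (f x))"
  using assms Ck_on_inverse by (intro smooth_on_compose[OF assms(1,2), of "- {0}"]) (auto simp: smooth_on_def)

lemma smooth_on_sqrt:
  assumes "open U" "smooth_on U f" "\<And>x. x \<in> U \<Longrightarrow> f x > (0::real)"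
  shows "smooth_on U (\<lambda>x. sqrt (f x))"
  using assms Ck_on_sqrt by (intro smooth_on_compose[OF assms(1,2), of "{0<..}"]) (auto simp: smooth_on_def)

lemma smooth_on_local:
  assumes "open U" "\<And>x. x \<in> U \<Longrightarrow> \<exists>V. open V \<and> x \<in> V \<and> smooth_on V f"
  shows "smooth_on U f"
proof -
  have "Ck_on k U f" if "\<And>x. x \<in> U \<Longrightarrow> \<exists>V. open V \<and> x \<in> V \<and> Ck_on k V f" for k
    using that
  proof (induction k arbitrary: f)
    case 0
    have "isCont f x" if "x \<in> U" for x
      using 0[OF that] continuous_on_eq_continuous_at by (metis Ck_on.simps(1))
    then show ?case by (auto intro: continuous_at_imp_continuous_on)
  next
    case (Suc k)
    have "Ck_on k U (dird f v)" for v
      using Suc.prems by (intro Suc.IH) (metis Ck_on.simps(2))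
    moreover have "f differentiable (at x)" if "x \<in> U" for x
      using Suc.prems[OF that] by auto
    ultimately show ?case by simp
  qed
  moreover have "\<exists>V. open V \<and> x \<in> V \<and> Ck_on k V f" if "x \<in> U" for x k
    using assms(2)[OF that] unfolding smooth_on_def by blast
  ultimately show ?thesis unfolding smooth_on_def by simp
qed

lemma dird_add:
  "f differentiable (at x) \<Longrightarrow> g differentiable (at x) \<Longrightarrow> dird (\<lambda>x. f x + g x) v x = dird f v x + dird g v x"
  by (auto intro!: dird_eqI has_derivative_add simp: frechet_derivative_works)

lemma dird_diff:
  "f differentiable (at x) \<Longrightarrow> g differentiable (at x) \<Longrightarrow> dird (\<lambda>x. f x - g x) v x = dird f v x - dird g v x"
  by (auto intro!: dird_eqI has_derivative_diff simp: frechet_derivative_works)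

lemma dird_sum:
  "(\<And>i. i \<in> I \<Longrightarrow> f i differentiable (at x)) \<Longrightarrow> dird (\<lambda>x. \<Sum>i\<in>I. f i x) v x = (\<Sum>i\<in>I. dird (f i) v x)"
  by (auto intro!: dird_eqI has_derivative_sum simp: frechet_derivative_works)

lemma dird_bilinear:
  assumes "bounded_bilinear B" "f differentiable (at x)" "g differentiable (at x)"
  shows "dird (\<lambda>x. B (f x) (g x)) v x = B (f x) (dird g v x) + B (dird f v x) (g x)"
  using assms by (auto intro!: dird_eqI bounded_bilinear.FDERIV simp: frechet_derivative_works)

lemma dird_compose:
  assumes "f differentiable (at (g x))" "g differentiable (at x)"
  shows "dird (\<lambda>x. f (g x)) v x = dird f (dird g v x) (g x)"
  using assms
  by (auto intro!: dird_eqI has_derivative_compose[of g _ x UNIV f] simp: frechet_derivative_works)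

lemma linear_compose_differentiable:
  "bounded_linear h \<Longrightarrow> f differentiable (at x) \<Longrightarrow> (\<lambda>x. h (f x)) differentiable (at x)"
  unfolding differentiable_def using bounded_linear.has_derivative by blast

lemma dird_linear_compose:
  assumes "bounded_linear h" "g differentiable (at x)"
  shows "dird (\<lambda>x. h (g x)) v x = h (dird g v x)"
  using assms
  by (auto intro!: dird_eqI bounded_linear.has_derivative[of h g] simp: frechet_derivative_works)

lemma bilinear_differentiable:
  assumes "bounded_bilinear B" "f differentiable (at x)" "g differentiable (at x)"
  shows "(\<lambda>x. B (f x) (g x)) differentiable (at x)"
  using assms bounded_bilinear.FDERIV unfolding differentiable_def by blast

subsection \<open>Symmetry of second derivatives\<close>

lemma line_has_real_derivative:
  fixes f :: "'a::real_normed_vector \<Rightarrow> real"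
  assumes "f differentiable (at (a + t *\<^sub>R w))"
  shows "((\<lambda>t. f (a + t *\<^sub>R w)) has_real_derivative dird f w (a + t *\<^sub>R w)) (at t)"
proof -
  have "((\<lambda>t. a + t *\<^sub>R w) has_derivative (\<lambda>s. s *\<^sub>R w)) (at t)"
    by (auto intro!: derivative_eq_intros)
  from has_derivative_compose[OF this, of f] assms
  have "((\<lambda>t. f (a + t *\<^sub>R w)) has_derivative (\<lambda>s. dird f (s *\<^sub>R w) (a + t *\<^sub>R w))) (at t)"
    unfolding frechet_derivative_works by blast
  then show ?thesis unfolding has_field_derivative_def
    by (rule has_derivative_eq_rhs) (simp add: fun_eq_iff linear_cmul[OF dird_linear[OF assms]])
qed

text \<open>The mean value theorem is used twice, first in direction \<open>u\<close> on the
  increment of \<open>f\<close> in direction \<open>v\<close>, then in direction \<open>v\<close> on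
  the derivative along \<open>u\<close>.\<close>

lemma second_difference:
  fixes f :: "'a::real_normed_vector \<Rightarrow> real"
  assumes "open U" "smooth_on U f" "s > 0"
    and U: "\<And>a b. 0 \<le> a \<Longrightarrow> a \<le> s \<Longrightarrow> 0 \<le> b \<Longrightarrow> b \<le> s \<Longrightarrow> x + a *\<^sub>R u + b *\<^sub>R v \<in> U"
  shows "\<exists>a b. 0 \<le> a \<and> a \<le> s \<and> 0 \<le> b \<and> b \<le> s \<and>
    f (x + s *\<^sub>R u + s *\<^sub>R v) - f (x + s *\<^sub>R u) - f (x + s *\<^sub>R v) + f x
      = s * s * dird (dird f u) v (x + a *\<^sub>R u + b *\<^sub>R v)"
proof -
  have d: "((\<lambda>a. f ((x + c *\<^sub>R v) + a *\<^sub>R u)) has_real_derivative dird f u ((x + c *\<^sub>R v) + a *\<^sub>R u)) (at a)"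
    if "0 \<le> a" "a \<le> s" "0 \<le> c" "c \<le> s" for a c
    using U[OF that] smooth_onD(1)[OF assms(2)]
    by (intro line_has_real_derivative) (auto simp: algebra_simps)
  have "((\<lambda>a. f ((x + s *\<^sub>R v) + a *\<^sub>R u) - f (x + a *\<^sub>R u)) has_real_derivative
     dird f u ((x + s *\<^sub>R v) + a *\<^sub>R u) - dird f u (x + a *\<^sub>R u)) (at a)"
    if "0 \<le> a" "a \<le> s" for a
    using d[of a s] d[of a 0] that assms(3) by (auto intro: DERIV_diff)
  from MVT2[OF assms(3), OF this] obtain a where a: "0 < a" "a < s"
    "f (x + s *\<^sub>R v + s *\<^sub>R u) - f (x + s *\<^sub>R u) - (f (x + s *\<^sub>R v) - f x)
      = s * (dird f u ((x + s *\<^sub>R v) + a *\<^sub>R u) - dird f u (x + a *\<^sub>R u))"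
    by auto
  have "((\<lambda>b. dird f u ((x + a *\<^sub>R u) + b *\<^sub>R v)) has_real_derivative dird (dird f u) v ((x + a *\<^sub>R u) + b *\<^sub>R v)) (at b)"
    if "0 \<le> b" "b \<le> s" for b
    using U[of a b] that a smooth_onD(1)[OF smooth_onD(2)[OF assms(2)]]
    by (intro line_has_real_derivative) auto
  from MVT2[OF assms(3), OF this] obtain b where b: "0 < b" "b < s"
    "dird f u ((x + a *\<^sub>R u) + s *\<^sub>R v) - dird f u (x + a *\<^sub>R u)
      = s * dird (dird f u) v ((x + a *\<^sub>R u) + b *\<^sub>R v)"
    by auto
  show ?thesis
    using a b by (intro exI[of _ a] exI[of _ b]) (auto simp: algebra_simps)
qed

text \<open>The second difference is symmetric in \<open>u\<close> and \<open>v\<close>, so both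
  mixed derivatives take a common value at points arbitrarily close to \<open>x\<close>; continuity
  carries the equality to \<open>x\<close>.\<close>

lemma dird_commute_real:
  fixes f :: "'a::real_normed_vector \<Rightarrow> real"
  assumes "open U" "smooth_on U f" "x \<in> U"
  shows "dird (dird f u) v x = dird (dird f v) u x"
proof (rule ccontr)
  assume ne: "\<not> ?thesis"
  define D where "D = (\<lambda>y. dird (dird f u) v y - dird (dird f v) u y)"
  \<comment> \<open>Half of the supposed gap: two errors below \<open>e\<close> cannot bridge
    it.\<close>
  define e where "e = \<bar>D x\<bar> / 2"
  have e: "e > 0" using ne unfolding e_def D_def by simp
  have c: "isCont (dird (dird f u) v) x" for u v
    using smooth_onD(3)[OF smooth_onD(2)[OF smooth_onD(2)[OF assms(2)]]] assms(1,3)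
    by (simp add: continuous_on_eq_continuous_at)
  obtain d1 where d1: "d1 > 0" "\<And>y. dist y x < d1 \<Longrightarrow> dist (dird (dird f u) v y) (dird (dird f u) v x) < e"
    using c[of u v, unfolded continuous_at_eps_delta, rule_format, OF e] by blast
  obtain d2 where d2: "d2 > 0" "\<And>y. dist y x < d2 \<Longrightarrow> dist (dird (dird f v) u y) (dird (dird f v) u x) < e"
    using c[of v u, unfolded continuous_at_eps_delta, rule_format, OF e] by blast
  note d12 = d1 d2
  obtain d3 where d3: "d3 > 0" "ball x d3 \<subseteq> U" using assms open_contains_ball by blast
  define d where "d = min d1 (min d2 d3)"
  have d: "d > 0" using d12 d3 by (simp add: d_def)
  define m where "m = norm u + norm v + 1"
  have m: "m > 0" unfolding m_def by (intro add_nonneg_pos) auto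
  \<comment> \<open>With this side length the whole parallelogram lies within distance
    \<open>s * m = d / 2\<close> of \<open>x\<close>.\<close>
  define s where "s = d / (2 * m)"
  have s: "s > 0" using d m by (simp add: s_def)
  have near: "dist (x + a *\<^sub>R u + b *\<^sub>R v) x < d" if "0 \<le> a" "a \<le> s" "0 \<le> b" "b \<le> s" for a b
  proof -
    have "dist (x + a *\<^sub>R u + b *\<^sub>R v) x \<le> a * norm u + b * norm v"
      using norm_triangle_ineq[of "a *\<^sub>R u" "b *\<^sub>R v"] that by (simp add: dist_norm)
    also have "\<dots> \<le> s * norm u + s * norm v"
      using that by (intro add_mono mult_right_mono) auto
    also have "\<dots> \<le> s * m" using s by (simp add: m_def algebra_simps)
    also have "\<dots> = d / 2" using m by (simp add: s_def)
    finally show ?thesis using d by simp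
  qed
  have U: "x + a *\<^sub>R u + b *\<^sub>R v \<in> U" if "0 \<le> a" "a \<le> s" "0 \<le> b" "b \<le> s" for a b
    using near[OF that] d3 by (auto simp: d_def dist_commute subset_iff)
  have "\<exists>a b. 0 \<le> a \<and> a \<le> s \<and> 0 \<le> b \<and> b \<le> s \<and> f (x + s *\<^sub>R u + s *\<^sub>R v) - f (x + s *\<^sub>R u) - f (x + s *\<^sub>R v) + f x
      = s * s * dird (dird f u) v (x + a *\<^sub>R u + b *\<^sub>R v)"
    by (rule second_difference[OF assms(1,2) s U])
  then obtain a b where ab: "0 \<le> a \<and> a \<le> s \<and> 0 \<le> b \<and> b \<le> s \<and> f (x + s *\<^sub>R u + s *\<^sub>R v) - f (x + s *\<^sub>R u) - f (x + s *\<^sub>R v) + f x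
      = s * s * dird (dird f u) v (x + a *\<^sub>R u + b *\<^sub>R v)" by (elim exE)
  have U': "x + a *\<^sub>R v + b *\<^sub>R u \<in> U" if "0 \<le> a" "a \<le> s" "0 \<le> b" "b \<le> s" for a b
    using U[OF that(3,4,1,2)] by (simp only: add.assoc add.commute[of "a *\<^sub>R v"])
  have "\<exists>a b. 0 \<le> a \<and> a \<le> s \<and> 0 \<le> b \<and> b \<le> s \<and> f (x + s *\<^sub>R v + s *\<^sub>R u) - f (x + s *\<^sub>R v) - f (x + s *\<^sub>R u) + f x
      = s * s * dird (dird f v) u (x + a *\<^sub>R v + b *\<^sub>R u)"
    by (rule second_difference[OF assms(1,2) s U'])
  then obtain a' b' where ab': "0 \<le> a' \<and> a' \<le> s \<and> 0 \<le> b' \<and> b' \<le> s \<and> f (x + s *\<^sub>R v + s *\<^sub>R u) - f (x + s *\<^sub>R v) - f (x + s *\<^sub>R u) + f x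
      = s * s * dird (dird f v) u (x + a' *\<^sub>R v + b' *\<^sub>R u)" by (elim exE)
  have sw: "x + c *\<^sub>R v + d *\<^sub>R u = x + d *\<^sub>R u + c *\<^sub>R v" for c d by simp
  have "s * s * dird (dird f v) u (x + b' *\<^sub>R u + a' *\<^sub>R v) = s * s * dird (dird f u) v (x + a *\<^sub>R u + b *\<^sub>R v)"
    using ab ab' unfolding sw[of a' b'] sw[of s s] by linarith
  then have "dird (dird f v) u (x + b' *\<^sub>R u + a' *\<^sub>R v) = dird (dird f u) v (x + a *\<^sub>R u + b *\<^sub>R v)"
    using s by simp
  moreover have "dist (dird (dird f u) v (x + a *\<^sub>R u + b *\<^sub>R v)) (dird (dird f u) v x) < e"
    using near[of a b] ab by (intro d1(2)) (simp add: d_def)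
  moreover have "dist (dird (dird f v) u (x + b' *\<^sub>R u + a' *\<^sub>R v)) (dird (dird f v) u x) < e"
    using near[of b' a'] ab' by (intro d2(2)) (simp add: d_def)
  ultimately have "\<bar>D x\<bar> < 2 * e" unfolding D_def dist_real_def by linarith
  then show False unfolding e_def by linarith
qed

lemma dird_commute:
  fixes f :: "'a::real_normed_vector \<Rightarrow> 'b::euclidean_space"
  assumes "open U" "smooth_on U f" "x \<in> U"
  shows "dird (dird f u) v x = dird (dird f v) u x"
proof (rule euclidean_eqI)
  fix b :: 'b assume "b \<in> Basis"
  have bl: "bounded_linear (\<lambda>z::'b. z \<bullet> b)" by (rule bounded_linear_inner_left)
  have sm: "smooth_on U (\<lambda>x. f x \<bullet> b)" by (rule smooth_on_linear_compose[OF assms(1) bl assms(2)])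
  have "dird (dird f u) v x \<bullet> b = dird (dird (\<lambda>x. f x \<bullet> b) u) v x" for u v
  proof -
    have "dird (dird (\<lambda>x. f x \<bullet> b) u) v x = dird (\<lambda>x. dird f u x \<bullet> b) v x"
      using smooth_onD(1)[OF assms(2)] smooth_onD(1)[OF smooth_onD(2)[OF assms(2)]] assms(3)
      by (intro dird_cong_open(2)[OF assms(1,3)] dird_linear_compose[OF bl])
         (auto intro: linear_compose_differentiable[OF bl])
    also have "\<dots> = dird (dird f u) v x \<bullet> b"
      using smooth_onD(1)[OF smooth_onD(2)[OF assms(2)]] assms(3) by (intro dird_linear_compose[OF bl])
    finally show ?thesis by simp
  qed
  then show "dird (dird f u) v x \<bullet> b = dird (dird f v) u x \<bullet> b"
    using dird_commute_real[OF assms(1) sm assms(3)] by simp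
qed

subsection \<open>Linear systems with smooth coefficients\<close>

text \<open>The product rule is out of reach because \<open>f\<close> is only continuous. As both
  factors vanish at \<open>x\<close>, the product is still of smaller order than the increment. This
  lets continuity of a solution be upgraded to differentiability.\<close>

lemma product_has_derivative_zero:
  fixes f :: "'a::real_normed_vector \<Rightarrow> real" and g :: "'a \<Rightarrow> 'b::real_normed_vector"
  assumes "isCont f x" "f x = 0" "(g has_derivative g') (at x)" "g x = 0"
  shows "((\<lambda>y. f y *\<^sub>R g y) has_derivative (\<lambda>h. 0)) (at x)"
proof -
  from has_derivative_bounded_linear[OF assms(3)] obtain K where K: "\<And>h. norm (g' h) \<le> norm h * K"
    using bounded_linear.bounded by blast
  define q where "q = (\<lambda>y. norm (g y - g x - g' (y - x)) / norm (y - x))"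
  have q: "(q \<longlongrightarrow> 0) (at x)"
    using assms(3) unfolding has_derivative_iff_norm q_def by blast
  have "((\<lambda>y. \<bar>f y\<bar> * (q y + K)) \<longlongrightarrow> \<bar>f x\<bar> * (0 + K)) (at x)"
    by (intro tendsto_mult tendsto_rabs tendsto_add tendsto_const q assms(1)[unfolded isCont_def])
  then have lim: "((\<lambda>y. \<bar>f y\<bar> * (q y + K)) \<longlongrightarrow> 0) (at x)" using assms(2) by simp
  have "((\<lambda>y. norm (f y *\<^sub>R g y) / norm (y - x)) \<longlongrightarrow> 0) (at x)"
  proof (rule tendsto_sandwich[OF _ _ tendsto_const lim])
    show "\<forall>\<^sub>F y in at x. norm (f y *\<^sub>R g y) / norm (y - x) \<le> \<bar>f y\<bar> * (q y + K)"
    proof (rule eventually_at_filter[THEN iffD2, OF always_eventually], intro allI impI)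
      fix y assume "y \<noteq> x"
      then have n: "norm (y - x) > 0" by simp
      have "norm (g y) \<le> norm (g y - g' (y - x)) + norm (g' (y - x))"
        using norm_triangle_ineq[of "g y - g' (y - x)" "g' (y - x)"] by simp
      also have "\<dots> \<le> (q y + K) * norm (y - x)"
      proof -
        have "q y * norm (y - x) = norm (g y - g' (y - x))" using n assms(4) by (simp add: q_def)
        then show ?thesis using K[of "y - x"] by (simp add: distrib_right mult.commute)
      qed
      finally have "norm (g y) / norm (y - x) \<le> q y + K" using n by (simp add: pos_divide_le_eq)
      from mult_left_mono[OF this abs_ge_zero[of "f y"]]
      show "norm (f y *\<^sub>R g y) / norm (y - x) \<le> \<bar>f y\<bar> * (q y + K)" by simp
    qed
  qed (auto intro: always_eventually)
  then show ?thesis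
    using assms(2) unfolding has_derivative_iff_norm by simp
qed

lemma linear_basis_expansion:
  fixes f :: "'a::euclidean_space \<Rightarrow> 'b::real_vector"
  assumes "linear f"
  shows "f u = (\<Sum>c\<in>Basis. (u \<bullet> c) *\<^sub>R f c)"
proof -
  have "f (\<Sum>c\<in>Basis. (u \<bullet> c) *\<^sub>R c) = (\<Sum>c\<in>Basis. (u \<bullet> c) *\<^sub>R f c)"
    by (simp only: linear_sum[OF assms] linear_cmul[OF assms])
  then show ?thesis by (simp only: euclidean_representation)
qed

text \<open>A lower bound \<open>B\<close> at \<open>x0\<close> survives a perturbation of size
  below \<open>B / 2\<close>. The size is measured on basis vectors, where continuity is
  available.\<close>

lemma linear_lower_bound_nearby:
  fixes A :: "'a::metric_space \<Rightarrow> 'e::euclidean_space \<Rightarrow> 'f::euclidean_space"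
  assumes U: "open U" "x0 \<in> U" and lin: "\<And>x. x \<in> U \<Longrightarrow> linear (A x)" and inj: "inj (A x0)"
    and cont: "\<And>u. continuous_on U (\<lambda>x. A x u)"
  obtains c V where "c > 0" "open V" "x0 \<in> V" "V \<subseteq> U" "\<And>x v. x \<in> V \<Longrightarrow> c * norm v \<le> norm (A x v)"
proof -
  obtain B where B: "B > 0" "\<And>v. B * norm v \<le> norm (A x0 v)"
    using linear_inj_bounded_below_pos[OF lin[OF U(2)] inj] by metis
  define s where "s = (\<lambda>x. \<Sum>b\<in>Basis. norm (A x b - A x0 b))"
  have cs: "continuous_on U s" unfolding s_def by (intro continuous_intros cont)
  have s0: "s x0 = 0" by (simp add: s_def)
  define V where "V = U \<inter> s -` {..<B / 2}"
  have V: "open V" unfolding V_def by (rule continuous_open_preimage[OF cs U(1) open_lessThan])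
  have bd: "norm (A x v - A x0 v) \<le> norm v * s x" if "x \<in> U" for x v
  proof -
    have "A x v - A x0 v = (\<Sum>b\<in>Basis. (v \<bullet> b) *\<^sub>R (A x b - A x0 b))"
      by (simp only: linear_basis_expansion[OF lin[OF that], of v] linear_basis_expansion[OF lin[OF U(2)], of v]
          sum_subtractf scaleR_diff_right)
    also have "norm \<dots> \<le> (\<Sum>b\<in>Basis. norm ((v \<bullet> b) *\<^sub>R (A x b - A x0 b)))" by (rule norm_sum)
    also have "\<dots> \<le> (\<Sum>b\<in>Basis. norm v * norm (A x b - A x0 b))"
      by (intro sum_mono) (auto intro!: mult_right_mono Basis_le_norm)
    finally show ?thesis by (simp add: s_def sum_distrib_left)
  qed
  show ?thesis
  proof (rule that[of "B / 2" V])
    fix x v assume "x \<in> V"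
    then have x: "x \<in> U" "s x < B / 2" by (auto simp: V_def)
    have "norm (A x0 v) \<le> norm (A x v) + norm (A x v - A x0 v)"
      using norm_triangle_ineq4[of "A x v" "A x v - A x0 v"] by simp
    moreover have "norm v * s x \<le> norm v * (B / 2)" using x by (intro mult_left_mono) auto
    ultimately show "B / 2 * norm v \<le> norm (A x v)" using bd[OF x(1), of v] B(2)[of v]
      by (simp add: algebra_simps)
  qed (use B V s0 U(2) in \<open>auto simp: V_def\<close>)
qed

context
  fixes U :: "'a::euclidean_space set" and A :: "'a \<Rightarrow> 'e::euclidean_space \<Rightarrow> 'e"
  assumes U: "open U" and lin: "\<And>x. x \<in> U \<Longrightarrow> linear (A x)" and inj: "\<And>x. x \<in> U \<Longrightarrow> inj (A x)"
    and sm: "\<And>u. smooth_on U (\<lambda>x. A x u)"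
begin

lemma solve_eq:
  assumes "x \<in> U"
  shows "A x (inv (A x) z) = z" "inv (A x) (A x u) = u"
  using linear_injective_imp_surjective[OF lin[OF assms] inj[OF assms]] inj[OF assms]
  by (simp_all add: surj_f_inv_f)

lemma solve_linear: "x \<in> U \<Longrightarrow> linear (inv (A x))"
  using inj_linear_imp_inv_linear[OF lin inj] .

lemma solve_isCont:
  assumes "x0 \<in> U" "continuous_on U b"
  shows "isCont (\<lambda>x. inv (A x) (b x)) x0"
proof -
  let ?y = "\<lambda>x. inv (A x) (b x)"
  obtain c V where V: "c > 0" "open V" "x0 \<in> V" "V \<subseteq> U" "\<And>x v. x \<in> V \<Longrightarrow> c * norm v \<le> norm (A x v)"
    using linear_lower_bound_nearby[of U x0 A] U assms(1) lin inj smooth_onD(3)[OF sm] by metis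
  define r where "r = (\<lambda>x. norm (b x - A x (?y x0)) / c)"
  have "continuous_on U r" unfolding r_def
    by (intro continuous_intros assms(2) smooth_onD(3)[OF sm]) (use V in auto)
  then have "(r \<longlongrightarrow> r x0) (at x0)"
    using U assms(1) by (simp add: continuous_on_eq_continuous_at isCont_def)
  then have r: "(r \<longlongrightarrow> 0) (at x0)" using solve_eq(1)[OF assms(1)] by (simp add: r_def)
  have "((\<lambda>x. ?y x - ?y x0) \<longlongrightarrow> 0) (at x0)"
  proof (rule Lim_null_comparison[OF _ r])
    have "norm (?y x - ?y x0) \<le> r x" if "x \<in> V" for x
    proof -
      have "A x (?y x - ?y x0) = b x - A x (?y x0)"
        using solve_eq(1) lin that V(4) by (simp add: linear_diff subset_iff)
      then show ?thesis using V(5)[OF that, of "?y x - ?y x0"] V(1)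
        by (simp add: r_def pos_le_divide_eq mult.commute)
    qed
    then show "\<forall>\<^sub>F x in at x0. norm (?y x - ?y x0) \<le> r x"
      using V(2,3) eventually_at_topological by blast
  qed
  then show ?thesis unfolding isCont_def by (rule LIM_zero_cancel)
qed

lemma solve_has_derivative:
  assumes x0: "x0 \<in> U" and b: "continuous_on U b" "b differentiable (at x0)"
  shows "((\<lambda>x. inv (A x) (b x)) has_derivative
    (\<lambda>v. inv (A x0) (dird b v x0 - (\<Sum>c\<in>Basis. (inv (A x0) (b x0) \<bullet> c) *\<^sub>R dird (\<lambda>x. A x c) v x0)))) (at x0)"
proof -
  let ?y = "\<lambda>x. inv (A x) (b x)"
  define y0 where "y0 = ?y x0"
  have exp: "A x u = (\<Sum>c\<in>Basis. (u \<bullet> c) *\<^sub>R A x c)" if "x \<in> U" for x u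
    by (rule linear_basis_expansion[OF lin[OF that]])
  \<comment> \<open>The error term is (A x - A x0) applied to the increment of the solution. Each
    summand is a product of a continuous and a differentiable function vanishing at
    \<open>x0\<close>, so its derivative there is 0.\<close>
  define E where "E = (\<lambda>x. \<Sum>c\<in>Basis. ((?y x - y0) \<bullet> c) *\<^sub>R (A x c - A x0 c))"
  have dA: "((\<lambda>x. A x c) has_derivative (\<lambda>v. dird (\<lambda>x. A x c) v x0)) (at x0)" for c
    by (rule smooth_has_derivative[OF sm x0])
  have E: "(E has_derivative (\<lambda>v. \<Sum>c\<in>(Basis::'e set). 0)) (at x0)"
    unfolding E_def
  proof (intro has_derivative_sum product_has_derivative_zero)
    fix c :: 'e
    show "isCont (\<lambda>x. (?y x - y0) \<bullet> c) x0"
      by (intro continuous_intros solve_isCont[OF x0 b(1)])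
    show "((\<lambda>x. A x c - A x0 c) has_derivative (\<lambda>v. dird (\<lambda>x. A x c) v x0 - 0)) (at x0)"
      by (intro has_derivative_diff dA has_derivative_const)
  qed (auto simp: y0_def)
  have il: "bounded_linear (inv (A x0))" using solve_linear[OF x0] linear_conv_bounded_linear by blast
  have main: "((\<lambda>x. y0 + inv (A x0) (b x - (\<Sum>c\<in>Basis. (y0 \<bullet> c) *\<^sub>R A x c) - E x)) has_derivative
     (\<lambda>v. 0 + inv (A x0) (dird b v x0 - (\<Sum>c\<in>Basis. (y0 \<bullet> c) *\<^sub>R dird (\<lambda>x. A x c) v x0) - (\<Sum>c\<in>(Basis::'e set). 0)))) (at x0)"
    by (intro has_derivative_add has_derivative_const bounded_linear.has_derivative[OF il] has_derivative_diff
        dird_has_derivative[OF b(2)] has_derivative_sum has_derivative_scaleR_right dA E)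
  have eq: "y0 + inv (A x0) (b x - (\<Sum>c\<in>Basis. (y0 \<bullet> c) *\<^sub>R A x c) - E x) = ?y x" if x: "x \<in> U" for x
  proof -
    have "E x = A x (?y x - y0) - A x0 (?y x - y0)"
      unfolding E_def exp[OF x, of "?y x - y0"] exp[OF x0, of "?y x - y0"]
      by (simp only: sum_subtractf scaleR_diff_right)
    also have "A x (?y x - y0) = b x - A x y0" using solve_eq(1)[OF x] lin[OF x] by (simp add: linear_diff)
    finally have "b x - (\<Sum>c\<in>Basis. (y0 \<bullet> c) *\<^sub>R A x c) - E x = A x0 (?y x - y0)"
      unfolding exp[OF x, of y0] by (simp only:) simp
    then show ?thesis using solve_eq(2)[OF x0] by simp
  qed
  from has_derivative_transform_within_open[OF main U x0 eq] show ?thesis by (simp add: y0_def)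
qed

text \<open>The derivative of a solution solves the same system with a right-hand side made of
  \<open>dird b v\<close>, the derivatives of \<open>A\<close> and the solution itself, so one order
  of smoothness is gained at a time.\<close>

lemma Ck_on_solve: "Ck_on k U b \<Longrightarrow> Ck_on k U (\<lambda>x. inv (A x) (b x))"
proof (induction k arbitrary: b)
  case 0
  then have "continuous_on U b" by simp
  then show ?case using solve_isCont by (auto intro: continuous_at_imp_continuous_on)
next
  case (Suc k)
  let ?y = "\<lambda>x. inv (A x) (b x)"
  have b: "Ck_on k U b" by (rule Ck_on_SucD[OF Suc.prems])
  have y: "Ck_on k U ?y" by (rule Suc.IH[OF b])
  note hd = solve_has_derivative[OF _ Ck_on_continuous[OF b]]
  have d: "b differentiable (at x)" if "x \<in> U" for x using Suc.prems that by simp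
  have "Ck_on k U (dird ?y v)" for v
  proof (rule Ck_on_cong[OF U])
    show "dird ?y v x = inv (A x) (dird b v x - (\<Sum>c\<in>Basis. (?y x \<bullet> c) *\<^sub>R dird (\<lambda>x. A x c) v x))"
      if "x \<in> U" for x
      by (rule dird_eqI[OF hd[OF that d[OF that]]])
    have t: "Ck_on k U (\<lambda>x. (?y x \<bullet> c) *\<^sub>R dird (\<lambda>x. A x c) v x)" for c
    proof (rule Ck_on_bilinear[OF bounded_bilinear_scaleR U])
      show "Ck_on k U (\<lambda>x. ?y x \<bullet> c)"
        by (rule Ck_on_linear_compose[OF U bounded_linear_inner_left y])
      show "Ck_on k U (dird (\<lambda>x. A x c) v)"
        using smooth_onD(2)[OF sm[of c]] unfolding smooth_on_def by blast
    qed
    have t2: "Ck_on k U (\<lambda>x. - (\<Sum>c\<in>Basis. (?y x \<bullet> c) *\<^sub>R dird (\<lambda>x. A x c) v x))"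
      by (rule Ck_on_linear_compose[OF U bounded_linear_minus[OF bounded_linear_ident] Ck_on_sum[OF U t]])
    have t3: "Ck_on k U (dird b v)" using Suc.prems by simp
    have "Ck_on k U (\<lambda>x. dird b v x - (\<Sum>c\<in>Basis. (?y x \<bullet> c) *\<^sub>R dird (\<lambda>x. A x c) v x))"
      using Ck_on_add[OF U t3 t2] by simp
    from Suc.IH[OF this]
    show "Ck_on k U (\<lambda>x. inv (A x) (dird b v x - (\<Sum>c\<in>Basis. (?y x \<bullet> c) *\<^sub>R dird (\<lambda>x. A x c) v x)))" .
  qed
  moreover have "?y differentiable (at x)" if "x \<in> U" for x
    using hd[OF that d[OF that]] unfolding differentiable_def by blast
  ultimately show ?case by simp
qed

lemma smooth_on_solve: "smooth_on U b \<Longrightarrow> smooth_on U (\<lambda>x. inv (A x) (b x))"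
  using Ck_on_solve unfolding smooth_on_def by simp

end

subsection \<open>Maps and fields on embedded submanifolds\<close>

lemma smooth_map_onE:
  assumes "smooth_map_on M f" "p \<in> M"
  obtains U F where "open U" "p \<in> U" "smooth_on U F" "\<And>x. x \<in> U \<Longrightarrow> x \<in> M \<Longrightarrow> F x = f x"
  using assms unfolding smooth_map_on_def smooth_on_def by (metis IntI)

lemma smooth_map_onI:
  assumes "\<And>p. p \<in> M \<Longrightarrow> \<exists>U F. open U \<and> p \<in> U \<and> smooth_on U F \<and> (\<forall>x\<in>U \<inter> M. F x = f x)"
  shows "smooth_map_on M f"
  using assms unfolding smooth_map_on_def smooth_on_def by blast

lemma smooth_map_on_restrict: "open U \<Longrightarrow> M \<subseteq> U \<Longrightarrow> smooth_on U f \<Longrightarrow> smooth_map_on M f"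
  by (intro smooth_map_onI exI[of _ U] exI[of _ f]) auto

lemma smooth_map_on_cong:
  assumes "smooth_map_on M g" "\<And>x. x \<in> M \<Longrightarrow> f x = g x"
  shows "smooth_map_on M f"
proof (rule smooth_map_onI)
  fix p assume "p \<in> M"
  with assms(1) obtain U F where "open U" "p \<in> U" "smooth_on U F" "\<And>x. x \<in> U \<Longrightarrow> x \<in> M \<Longrightarrow> F x = g x"
    by (rule smooth_map_onE) blast
  then show "\<exists>U F. open U \<and> p \<in> U \<and> smooth_on U F \<and> (\<forall>x\<in>U \<inter> M. F x = f x)"
    using assms(2) by (intro exI[of _ U] exI[of _ F]) auto
qed

lemma smooth_map_on_compose_smooth:
  assumes f: "smooth_map_on M f" and W: "open W" "f ` M \<subseteq> W" "smooth_on W h"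
  shows "smooth_map_on M (\<lambda>x. h (f x))"
proof (rule smooth_map_onI)
  fix p assume p: "p \<in> M"
  obtain U F where U: "open U" "p \<in> U" "smooth_on U F" "\<And>x. x \<in> U \<Longrightarrow> x \<in> M \<Longrightarrow> F x = f x"
    using f p by (rule smooth_map_onE) blast
  have o: "open (U \<inter> F -` W)" using continuous_open_preimage[OF smooth_onD(3)[OF U(3)] U(1) W(1)] .
  have "smooth_on (U \<inter> F -` W) (\<lambda>x. h (F x))"
    by (rule smooth_on_compose[OF o smooth_on_subset[OF U(3)] _ W(3)]) auto
  then show "\<exists>U G. open U \<and> p \<in> U \<and> smooth_on U G \<and> (\<forall>x\<in>U \<inter> M. G x = h (f x))"
    using o U p W(2) by (intro exI[of _ "U \<inter> F -` W"] exI[of _ "\<lambda>x. h (F x)"]) auto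
qed

lemma smooth_map_on_compose:
  assumes X: "smooth_map_on M X" "X ` M \<subseteq> N" and Z: "smooth_map_on N Z"
  shows "smooth_map_on M (\<lambda>x. Z (X x))"
proof (rule smooth_map_onI)
  fix p assume p: "p \<in> M"
  obtain U F where U: "open U" "p \<in> U" "smooth_on U F" "\<And>x. x \<in> U \<Longrightarrow> x \<in> M \<Longrightarrow> F x = X x"
    using X(1) p by (rule smooth_map_onE) blast
  obtain W G where W: "open W" "X p \<in> W" "smooth_on W G" "\<And>x. x \<in> W \<Longrightarrow> x \<in> N \<Longrightarrow> G x = Z x"
    using Z X(2) p smooth_map_onE[of N Z "X p"] by (metis image_subset_iff)
  have o: "open (U \<inter> F -` W)" using continuous_open_preimage[OF smooth_onD(3)[OF U(3)] U(1) W(1)] .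
  have "smooth_on (U \<inter> F -` W) (\<lambda>x. G (F x))"
    by (rule smooth_on_compose[OF o smooth_on_subset[OF U(3)] _ W(3)]) auto
  moreover have "G (F x) = Z (X x)" if "x \<in> U \<inter> F -` W \<inter> M" for x
    using U(4)[of x] W(4)[of "X x"] that X(2) by auto
  ultimately show "\<exists>U G. open U \<and> p \<in> U \<and> smooth_on U G \<and> (\<forall>x\<in>U \<inter> M. G x = Z (X x))"
    using o U p W(2) by (intro exI[of _ "U \<inter> F -` W"] exI[of _ "\<lambda>x. G (F x)"]) auto
qed

lemma smooth_map_on_const: "smooth_map_on M (\<lambda>x. c)"
  by (rule smooth_map_on_restrict[OF open_UNIV subset_UNIV smooth_on_const])

lemma smooth_map_on_linear: "bounded_linear h \<Longrightarrow> smooth_map_on M h"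
  by (rule smooth_map_on_restrict[OF open_UNIV subset_UNIV smooth_on_linear])

lemma smooth_map_on_id: "smooth_map_on M (\<lambda>x. x)"
  by (rule smooth_map_on_linear[OF bounded_linear_ident])

lemma smooth_map_on_bilinear:
  assumes B: "bounded_bilinear B" and f: "smooth_map_on M f" and g: "smooth_map_on M g"
  shows "smooth_map_on M (\<lambda>x. B (f x) (g x))"
proof (rule smooth_map_onI)
  fix p assume p: "p \<in> M"
  obtain U F where U: "open U" "p \<in> U" "smooth_on U F" "\<And>x. x \<in> U \<Longrightarrow> x \<in> M \<Longrightarrow> F x = f x"
    using f p by (rule smooth_map_onE) blast
  obtain W G where W: "open W" "p \<in> W" "smooth_on W G" "\<And>x. x \<in> W \<Longrightarrow> x \<in> M \<Longrightarrow> G x = g x"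
    using g p by (rule smooth_map_onE) blast
  have "smooth_on (U \<inter> W) (\<lambda>x. B (F x) (G x))"
    using U(1) W(1) smooth_on_subset[OF U(3)] smooth_on_subset[OF W(3)]
    by (intro smooth_on_bilinear[OF B]) auto
  then show "\<exists>U G. open U \<and> p \<in> U \<and> smooth_on U G \<and> (\<forall>x\<in>U \<inter> M. G x = B (f x) (g x))"
    using U W by (intro exI[of _ "U \<inter> W"] exI[of _ "\<lambda>x. B (F x) (G x)"]) auto
qed

lemma smooth_map_on_linear_compose:
  "bounded_linear h \<Longrightarrow> smooth_map_on M f \<Longrightarrow> smooth_map_on M (\<lambda>x. h (f x))"
  by (rule smooth_map_on_compose_smooth[OF _ open_UNIV subset_UNIV smooth_on_linear])

lemma smooth_map_on_pair:
  assumes "smooth_map_on M f" "smooth_map_on M g"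
  shows "smooth_map_on M (\<lambda>x. (f x, g x))"
proof (rule smooth_map_onI)
  fix p assume p: "p \<in> M"
  obtain U F where U: "open U" "p \<in> U" "smooth_on U F" "\<And>x. x \<in> U \<Longrightarrow> x \<in> M \<Longrightarrow> F x = f x"
    using assms(1) p by (rule smooth_map_onE) blast
  obtain W G where W: "open W" "p \<in> W" "smooth_on W G" "\<And>x. x \<in> W \<Longrightarrow> x \<in> M \<Longrightarrow> G x = g x"
    using assms(2) p by (rule smooth_map_onE) blast
  have o: "open (U \<inter> W)" using U W by auto
  have l: "bounded_linear (\<lambda>x. (x, 0))" "bounded_linear (\<lambda>x. (0, x))"
    by (auto intro: bounded_linear_Pair bounded_linear_ident bounded_linear_zero)
  have "smooth_on (U \<inter> W) (\<lambda>x. (F x, 0) + (0, G x))"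
    by (intro smooth_on_add[OF o] smooth_on_linear_compose[OF o l(1)] smooth_on_linear_compose[OF o l(2)]
        smooth_on_subset[OF U(3)] smooth_on_subset[OF W(3)]) auto
  then show "\<exists>U H. open U \<and> p \<in> U \<and> smooth_on U H \<and> (\<forall>x\<in>U \<inter> M. H x = (f x, g x))"
    using U W by (intro exI[of _ "U \<inter> W"] exI[of _ "\<lambda>x. (F x, 0) + (0, G x)"]) auto
qed

lemma smooth_map_on_add:
  assumes "smooth_map_on M f" "smooth_map_on M g"
  shows "smooth_map_on M (\<lambda>x. f x + g x)"
proof -
  have "bounded_linear (\<lambda>z. fst z + snd z)" by (intro bounded_linear_add bounded_linear_fst bounded_linear_snd)
  from smooth_map_on_linear_compose[OF this smooth_map_on_pair[OF assms]] show ?thesis by simp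
qed

lemma smooth_map_on_minus: "smooth_map_on M f \<Longrightarrow> smooth_map_on M (\<lambda>x. - f x)"
  by (rule smooth_map_on_linear_compose[OF bounded_linear_minus[OF bounded_linear_ident]])

lemma smooth_map_on_diff:
  "smooth_map_on M f \<Longrightarrow> smooth_map_on M g \<Longrightarrow> smooth_map_on M (\<lambda>x. f x - g x)"
  using smooth_map_on_add[OF _ smooth_map_on_minus] by fastforce

lemma smooth_map_on_sum:
  "(\<And>i. i \<in> I \<Longrightarrow> smooth_map_on M (f i)) \<Longrightarrow> smooth_map_on M (\<lambda>x. \<Sum>i\<in>I. f i x)"
  by (induction I rule: infinite_finite_induct) (auto simp: smooth_map_on_const intro: smooth_map_on_add)

lemmas smooth_map_on_scaleR = smooth_map_on_bilinear[OF bounded_bilinear_scaleR]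
lemmas smooth_map_on_mult = smooth_map_on_bilinear[OF bounded_bilinear_mult]

lemma smooth_map_on_continuous:
  assumes "smooth_map_on M f"
  shows "continuous_on M f"
  unfolding continuous_on_eq_continuous_within
proof
  fix p assume p: "p \<in> M"
  obtain U F where U: "open U" "p \<in> U" "smooth_on U F" "\<And>x. x \<in> U \<Longrightarrow> x \<in> M \<Longrightarrow> F x = f x"
    using assms p by (rule smooth_map_onE) blast
  have "isCont F p" using smooth_onD(3)[OF U(3)] U(1,2) by (simp add: continuous_on_eq_continuous_at)
  then have "continuous (at p within M) F" by (rule continuous_at_imp_continuous_at_within)
  moreover have "\<forall>\<^sub>F x in at p within M. F x = f x"
    using U unfolding eventually_at_topological by blast
  ultimately show "continuous (at p within M) f"
    using U(4)[OF U(2) p] unfolding continuous_within by (metis Lim_transform_eventually)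
qed

section \<open>Tangent vectors and tangential derivatives\<close>

lemma tangent_spaceE:
  assumes "v \<in> tangent_space M p"
  obtains c where "range c \<subseteq> M" "c 0 = p" "(c has_vector_derivative v) (at (0::real))"
  using assms unfolding tangent_space_def by blast

lemma tangent_space_memD: "v \<in> tangent_space M p \<Longrightarrow> p \<in> M"
  by (metis tangent_spaceE rangeI subsetD)

lemma curve_has_derivative_within:
  assumes "(f has_derivative f') (at p within M)" "range c \<subseteq> M" "c 0 = p"
    "(c has_vector_derivative v) (at 0)"
  shows "((\<lambda>t::real. f (c t)) has_vector_derivative f' v) (at 0)"
proof -
  have "(f has_derivative f') (at (c 0) within range c)"
    using has_derivative_subset[OF assms(1,2)] assms(3) by simp
  from has_derivative_in_compose[OF assms(4)[unfolded has_vector_derivative_def] this]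
  have "((\<lambda>t. f (c t)) has_derivative (\<lambda>t. f' (t *\<^sub>R v))) (at 0)" .
  moreover have "f' (t *\<^sub>R v) = t *\<^sub>R f' v" for t
    using has_derivative_linear[OF assms(1)] by (rule linear_cmul)
  ultimately show ?thesis unfolding has_vector_derivative_def by simp
qed

text \<open>
  Tangential derivatives may be computed with any local extension; this is what makes the
  otherwise ambiguous derivative within \<open>M\<close> usable.
\<close>

lemma tderiv_eq:
  assumes v: "v \<in> tangent_space M p" and W: "open W" "p \<in> W" "F differentiable (at p)"
    and eq: "\<And>x. x \<in> W \<Longrightarrow> x \<in> M \<Longrightarrow> F x = f x"
  shows "tderiv M f p v = dird F v p"
proof -
  have p: "p \<in> M" by (rule tangent_space_memD[OF v])
  obtain e where e: "e > 0" "ball p e \<subseteq> W" using W open_contains_ball by blast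
  have "(f has_derivative (\<lambda>v. dird F v p)) (at p within M)"
  proof (rule has_derivative_transform_within[OF has_derivative_at_withinI[OF dird_has_derivative[OF W(3)]] e(1) p])
    fix x assume "x \<in> M" "dist x p < e"
    then have "x \<in> W" using e(2) by (auto simp: dist_commute subset_iff)
    then show "F x = f x" using \<open>x \<in> M\<close> eq by simp
  qed
  note 1 = this
  then have "(f has_derivative frechet_derivative f (at p within M)) (at p within M)"
    using frechet_derivative_works differentiable_def by blast
  note 2 = this
  obtain c where c: "range c \<subseteq> M" "c 0 = p" "(c has_vector_derivative v) (at 0)"
    using v by (rule tangent_spaceE) blast
  show ?thesis unfolding tderiv_def
    using vector_derivative_unique_at[OF curve_has_derivative_within[OF 2 c] curve_has_derivative_within[OF 1 c]] .
qed

text \<open>A single extension computes \<open>tderiv\<close> at all nearby points of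
  \<open>M\<close>, not just at \<open>p\<close>; this is what allows a second
  differentiation.\<close>

lemma smooth_map_on_tderivE:
  assumes "smooth_map_on M f" "p \<in> M"
  obtains U F where "open U" "p \<in> U" "smooth_on U F" "\<And>x. x \<in> U \<Longrightarrow> x \<in> M \<Longrightarrow> F x = f x"
    "\<And>q v. q \<in> U \<Longrightarrow> v \<in> tangent_space M q \<Longrightarrow> tderiv M f q v = dird F v q"
proof -
  obtain U F where U: "open U" "p \<in> U" "smooth_on U F" "\<And>x. x \<in> U \<Longrightarrow> x \<in> M \<Longrightarrow> F x = f x"
    using assms by (rule smooth_map_onE) blast
  have "tderiv M f q v = dird F v q" if "q \<in> U" "v \<in> tangent_space M q" for q v
    by (rule tderiv_eq[OF that(2) U(1) that(1) smooth_onD(1)[OF U(3) that(1)] U(4)])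
  with U show ?thesis using that by blast
qed

text \<open>Tangent vectors being velocities of curves in \<open>M\<close>, identities for
  \<open>tderiv\<close> reduce to uniqueness of the velocity of a curve.\<close>

lemma tderiv_curve:
  assumes "smooth_map_on M f" "range c \<subseteq> M" "c 0 = p" "(c has_vector_derivative v) (at (0::real))"
  shows "((\<lambda>t. f (c t)) has_vector_derivative tderiv M f p v) (at 0)"
proof -
  have v: "v \<in> tangent_space M p" using assms(2-4) unfolding tangent_space_def by blast
  have p: "p \<in> M" by (rule tangent_space_memD[OF v])
  obtain U F where U: "open U" "p \<in> U" "smooth_on U F" "\<And>x. x \<in> U \<Longrightarrow> x \<in> M \<Longrightarrow> F x = f x"
    "\<And>q v. q \<in> U \<Longrightarrow> v \<in> tangent_space M q \<Longrightarrow> tderiv M f q v = dird F v q"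
    using assms(1) p by (rule smooth_map_on_tderivE) blast
  obtain e where e: "e > 0" "ball p e \<subseteq> U" using U open_contains_ball by blast
  have "(f has_derivative (\<lambda>v. dird F v p)) (at p within M)"
  proof (rule has_derivative_transform_within[OF has_derivative_at_withinI[OF smooth_has_derivative[OF U(3,2)]] e(1) p])
    fix x assume "x \<in> M" "dist x p < e"
    then have "x \<in> U" using e(2) by (auto simp: dist_commute subset_iff)
    then show "F x = f x" using \<open>x \<in> M\<close> U(4) by simp
  qed
  from curve_has_derivative_within[OF this assms(2-4)] show ?thesis using U(5)[OF U(2) v] by simp
qed

lemma tderiv_cong:
  assumes "smooth_map_on M g" "v \<in> tangent_space M p" "\<And>x. x \<in> M \<Longrightarrow> f x = g x"
  shows "tderiv M f p v = tderiv M g p v"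
proof -
  obtain U F where U: "open U" "p \<in> U" "smooth_on U F" "\<And>x. x \<in> U \<Longrightarrow> x \<in> M \<Longrightarrow> F x = g x"
    "\<And>q v. q \<in> U \<Longrightarrow> v \<in> tangent_space M q \<Longrightarrow> tderiv M g q v = dird F v q"
    using assms(1) tangent_space_memD[OF assms(2)] by (rule smooth_map_on_tderivE) blast
  have "tderiv M f p v = dird F v p"
    by (rule tderiv_eq[OF assms(2) U(1,2) smooth_onD(1)[OF U(3,2)]]) (simp add: U(4) assms(3))
  then show ?thesis using U(5)[OF U(2) assms(2)] by simp
qed

lemma tderiv_smooth:
  assumes "open U" "M \<subseteq> U" "smooth_on U F" "v \<in> tangent_space M p"
  shows "tderiv M F p v = dird F v p"
  using tderiv_eq[OF assms(4,1) _ smooth_onD(1)[OF assms(3)]] tangent_space_memD[OF assms(4)] assms(2)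
  by (simp add: subset_iff)

lemma tderiv_const: "v \<in> tangent_space M p \<Longrightarrow> tderiv M (\<lambda>x. c) p v = 0"
  by (subst tderiv_smooth[OF open_UNIV subset_UNIV smooth_on_const]) auto

lemma tderiv_linear:
  assumes "bounded_linear h" "v \<in> tangent_space M p"
  shows "tderiv M h p v = h v"
  using tderiv_smooth[OF open_UNIV subset_UNIV smooth_on_linear[OF assms(1)] assms(2)]
    dird_eqI[OF bounded_linear_imp_has_derivative[OF assms(1)]] by simp

lemma tderiv_id: "v \<in> tangent_space M p \<Longrightarrow> tderiv M (\<lambda>x. x) p v = v"
  by (rule tderiv_linear[OF bounded_linear_ident])

lemma tderiv_bilinear:
  assumes B: "bounded_bilinear B" and f: "smooth_map_on M f" and g: "smooth_map_on M g"
    and v: "v \<in> tangent_space M p"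
  shows "tderiv M (\<lambda>x. B (f x) (g x)) p v = B (f p) (tderiv M g p v) + B (tderiv M f p v) (g p)"
proof -
  have p: "p \<in> M" by (rule tangent_space_memD[OF v])
  obtain U F where U: "open U" "p \<in> U" "smooth_on U F" "\<And>x. x \<in> U \<Longrightarrow> x \<in> M \<Longrightarrow> F x = f x"
    "\<And>q v. q \<in> U \<Longrightarrow> v \<in> tangent_space M q \<Longrightarrow> tderiv M f q v = dird F v q"
    using f p by (rule smooth_map_on_tderivE) blast
  obtain W G where W: "open W" "p \<in> W" "smooth_on W G" "\<And>x. x \<in> W \<Longrightarrow> x \<in> M \<Longrightarrow> G x = g x"
    "\<And>q v. q \<in> W \<Longrightarrow> v \<in> tangent_space M q \<Longrightarrow> tderiv M g q v = dird G v q"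
    using g p by (rule smooth_map_on_tderivE) blast
  note d = smooth_onD(1)[OF U(3,2)] smooth_onD(1)[OF W(3,2)]
  have "tderiv M (\<lambda>x. B (f x) (g x)) p v = dird (\<lambda>x. B (F x) (G x)) v p"
    using U W by (intro tderiv_eq[OF v, of "U \<inter> W"] bilinear_differentiable[OF B d]) auto
  also have "\<dots> = B (F p) (dird G v p) + B (dird F v p) (G p)" by (rule dird_bilinear[OF B d])
  finally show ?thesis using U(4)[OF U(2) p] W(4)[OF W(2) p] U(5)[OF U(2) v] W(5)[OF W(2) v] by simp
qed

lemma tderiv_linear_compose:
  assumes h: "bounded_linear h" and f: "smooth_map_on M f" and v: "v \<in> tangent_space M p"
  shows "tderiv M (\<lambda>x. h (f x)) p v = h (tderiv M f p v)"
proof -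
  have p: "p \<in> M" by (rule tangent_space_memD[OF v])
  obtain U F where U: "open U" "p \<in> U" "smooth_on U F" "\<And>x. x \<in> U \<Longrightarrow> x \<in> M \<Longrightarrow> F x = f x"
    "\<And>q v. q \<in> U \<Longrightarrow> v \<in> tangent_space M q \<Longrightarrow> tderiv M f q v = dird F v q"
    using f p by (rule smooth_map_on_tderivE) blast
  note d = smooth_onD(1)[OF U(3,2)]
  have "tderiv M (\<lambda>x. h (f x)) p v = dird (\<lambda>x. h (F x)) v p"
    using U by (intro tderiv_eq[OF v, of U] linear_compose_differentiable[OF h d]) auto
  then show ?thesis using dird_linear_compose[OF h d] U(5)[OF U(2) v] by simp
qed

lemma tderiv_add:
  assumes f: "smooth_map_on M f" and g: "smooth_map_on M g" and v: "v \<in> tangent_space M p"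
  shows "tderiv M (\<lambda>x. f x + g x) p v = tderiv M f p v + tderiv M g p v"
proof -
  have p: "p \<in> M" by (rule tangent_space_memD[OF v])
  obtain U F where U: "open U" "p \<in> U" "smooth_on U F" "\<And>x. x \<in> U \<Longrightarrow> x \<in> M \<Longrightarrow> F x = f x"
    "\<And>q v. q \<in> U \<Longrightarrow> v \<in> tangent_space M q \<Longrightarrow> tderiv M f q v = dird F v q"
    using f p by (rule smooth_map_on_tderivE) blast
  obtain W G where W: "open W" "p \<in> W" "smooth_on W G" "\<And>x. x \<in> W \<Longrightarrow> x \<in> M \<Longrightarrow> G x = g x"
    "\<And>q v. q \<in> W \<Longrightarrow> v \<in> tangent_space M q \<Longrightarrow> tderiv M g q v = dird G v q"
    using g p by (rule smooth_map_on_tderivE) blast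
  note d = smooth_onD(1)[OF U(3,2)] smooth_onD(1)[OF W(3,2)]
  have "tderiv M (\<lambda>x. f x + g x) p v = dird (\<lambda>x. F x + G x) v p"
    using U W d by (intro tderiv_eq[OF v, of "U \<inter> W"] differentiable_add) auto
  then show ?thesis using dird_add[OF d] U(5)[OF U(2) v] W(5)[OF W(2) v] by simp
qed

lemmas tderiv_scaleR = tderiv_bilinear[OF bounded_bilinear_scaleR]

lemma tderiv_on_tangent_linear:
  assumes "smooth_map_on M f" "p \<in> M"
  obtains L where "linear L" "\<And>v. v \<in> tangent_space M p \<Longrightarrow> tderiv M f p v = L v"
proof -
  obtain U F where U: "open U" "p \<in> U" "smooth_on U F" "\<And>x. x \<in> U \<Longrightarrow> x \<in> M \<Longrightarrow> F x = f x"
    "\<And>q v. q \<in> U \<Longrightarrow> v \<in> tangent_space M q \<Longrightarrow> tderiv M f q v = dird F v q"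
    using assms by (rule smooth_map_on_tderivE) blast
  show ?thesis using that[of "\<lambda>v. dird F v p"] dird_linear[OF smooth_onD(1)[OF U(3,2)]] U(5)[OF U(2)] by blast
qed

lemma tderiv_tangent:
  assumes "smooth_map_on M X" "X ` M \<subseteq> N" "v \<in> tangent_space M p"
  shows "tderiv M X p v \<in> tangent_space N (X p)"
proof -
  obtain c where c: "range c \<subseteq> M" "c 0 = p" "(c has_vector_derivative v) (at 0)"
    using assms(3) by (rule tangent_spaceE) blast
  show ?thesis unfolding tangent_space_def
    using tderiv_curve[OF assms(1) c] c assms(2) by (intro CollectI exI[of _ "\<lambda>t. X (c t)"]) auto
qed

lemma tderiv_chain:
  assumes "smooth_map_on M X" "X ` M \<subseteq> N" "smooth_map_on N Z" "v \<in> tangent_space M p"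
  shows "tderiv M (\<lambda>x. Z (X x)) p v = tderiv N Z (X p) (tderiv M X p v)"
proof -
  obtain c where c: "range c \<subseteq> M" "c 0 = p" "(c has_vector_derivative v) (at 0)"
    using assms(4) by (rule tangent_spaceE) blast
  have "range (\<lambda>t. X (c t)) \<subseteq> N" using c assms(2) by auto
  from tderiv_curve[OF assms(3) this _ tderiv_curve[OF assms(1) c]]
  have "((\<lambda>t. Z (X (c t))) has_vector_derivative tderiv N Z (X p) (tderiv M X p v)) (at 0)" using c(2) by simp
  moreover have "((\<lambda>t. Z (X (c t))) has_vector_derivative tderiv M (\<lambda>x. Z (X x)) p v) (at 0)"
    by (rule tderiv_curve[OF smooth_map_on_compose[OF assms(1-3)] c])
  ultimately show ?thesis by (rule vector_derivative_unique_at[rotated])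
qed

lemma vector_fieldsD:
  assumes "V \<in> vector_fields M"
  shows "smooth_map_on M V" "p \<in> M \<Longrightarrow> V p \<in> tangent_space M p"
  using assms by (auto simp: vector_fields_def fields_along_def)

lemma fields_alongD:
  assumes "Y \<in> fields_along M N X"
  shows "smooth_map_on M Y" "p \<in> M \<Longrightarrow> Y p \<in> tangent_space N (X p)"
  using assms by (auto simp: fields_along_def)

lemma fields_alongI:
  "smooth_map_on M Y \<Longrightarrow> (\<And>p. p \<in> M \<Longrightarrow> Y p \<in> tangent_space N (X p)) \<Longrightarrow> Y \<in> fields_along M N X"
  by (auto simp: fields_along_def)

lemma vector_fieldsI:
  "smooth_map_on M Y \<Longrightarrow> (\<And>p. p \<in> M \<Longrightarrow> Y p \<in> tangent_space M p) \<Longrightarrow> Y \<in> vector_fields M"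
  by (auto simp: vector_fields_def fields_along_def)

lemma smooth_tderiv_field:
  assumes f: "smooth_map_on M f" and V: "V \<in> vector_fields M"
  shows "smooth_map_on M (\<lambda>p. tderiv M f p (V p))"
proof (rule smooth_map_onI)
  fix p assume p: "p \<in> M"
  obtain U F where U: "open U" "p \<in> U" "smooth_on U F" "\<And>x. x \<in> U \<Longrightarrow> x \<in> M \<Longrightarrow> F x = f x"
    "\<And>q v. q \<in> U \<Longrightarrow> v \<in> tangent_space M q \<Longrightarrow> tderiv M f q v = dird F v q"
    using f p by (rule smooth_map_on_tderivE) blast
  obtain W G where W: "open W" "p \<in> W" "smooth_on W G" "\<And>x. x \<in> W \<Longrightarrow> x \<in> M \<Longrightarrow> G x = V x"
    using vector_fieldsD(1)[OF V] p by (rule smooth_map_onE) blast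
  have o: "open (U \<inter> W)" using U W by auto
  have s: "smooth_on (U \<inter> W) (\<lambda>x. \<Sum>b\<in>Basis. (G x \<bullet> b) *\<^sub>R dird F b x)"
    by (intro smooth_on_sum[OF o] smooth_on_bilinear[OF bounded_bilinear_scaleR o]
        smooth_on_linear_compose[OF o bounded_linear_inner_left] smooth_on_subset[OF W(3)]
        smooth_on_subset[OF smooth_onD(2)[OF U(3)]]) auto
  have "(\<Sum>b\<in>Basis. (G x \<bullet> b) *\<^sub>R dird F b x) = tderiv M f x (V x)" if "x \<in> U \<inter> W \<inter> M" for x
    using that W(4)[of x] U(5)[of x "V x"] vector_fieldsD(2)[OF V] dird_basis[OF smooth_onD(1)[OF U(3)], of x "V x"]
    by auto
  with s show "\<exists>U H. open U \<and> p \<in> U \<and> smooth_on U H \<and> (\<forall>x\<in>U \<inter> M. H x = tderiv M f x (V x))"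
    using U W o by blast
qed

text \<open>With a local extension \<open>F\<close>, each iterated derivative splits into the second
  derivative of \<open>F\<close> on the two field values and the first derivative of
  \<open>F\<close> along the derivative of the inner field. The former parts cancel by symmetry; the
  latter combine to the bracket.\<close>

lemma tderiv_commutator:
  assumes f: "smooth_map_on M f" and U: "U \<in> vector_fields M" and V: "V \<in> vector_fields M"
    and p: "p \<in> M" and lie: "lie_bracket M U V p \<in> tangent_space M p"
  shows "tderiv M (\<lambda>q. tderiv M f q (V q)) p (U p) - tderiv M (\<lambda>q. tderiv M f q (U q)) p (V p)
    = tderiv M f p (lie_bracket M U V p)"
proof -
  obtain O1 F where F: "open O1" "p \<in> O1" "smooth_on O1 F" "\<And>x. x \<in> O1 \<Longrightarrow> x \<in> M \<Longrightarrow> F x = f x"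
    "\<And>q v. q \<in> O1 \<Longrightarrow> v \<in> tangent_space M q \<Longrightarrow> tderiv M f q v = dird F v q"
    using f p by (rule smooth_map_on_tderivE) blast
  note dF = smooth_onD(1)[OF F(3,2)]
  have one: "tderiv M (\<lambda>q. tderiv M f q (V q)) p u
      = (\<Sum>b\<in>Basis. \<Sum>c\<in>Basis. ((V p \<bullet> b) * (u \<bullet> c)) *\<^sub>R dird (dird F b) c p) + dird F (tderiv M V p u) p"
    if V: "V \<in> vector_fields M" and u: "u \<in> tangent_space M p" for V u
  proof -
    obtain W G where W: "open W" "p \<in> W" "smooth_on W G" "\<And>x. x \<in> W \<Longrightarrow> x \<in> M \<Longrightarrow> G x = V x"
      "\<And>q v. q \<in> W \<Longrightarrow> v \<in> tangent_space M q \<Longrightarrow> tderiv M V q v = dird G v q"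
      using vector_fieldsD(1)[OF V] p by (rule smooth_map_on_tderivE) blast
    note dG = smooth_onD(1)[OF W(3,2)]
    note d1 = linear_compose_differentiable[OF bounded_linear_inner_left dG]
    note d2 = smooth_onD(1)[OF smooth_onD(2)[OF F(3)] F(2)]
    note d = bilinear_differentiable[OF bounded_bilinear_scaleR d1 d2]
    have "tderiv M (\<lambda>q. tderiv M f q (V q)) p u = dird (\<lambda>x. \<Sum>b\<in>Basis. (G x \<bullet> b) *\<^sub>R dird F b x) u p"
    proof (rule tderiv_eq[OF u])
      show "open (O1 \<inter> W)" "p \<in> O1 \<inter> W" using F W by auto
      show "(\<lambda>x. \<Sum>b\<in>Basis. (G x \<bullet> b) *\<^sub>R dird F b x) differentiable (at p)"
        by (rule differentiable_sum) (auto intro: d)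
      fix x assume "x \<in> O1 \<inter> W" "x \<in> M"
      then show "(\<Sum>b\<in>Basis. (G x \<bullet> b) *\<^sub>R dird F b x) = tderiv M f x (V x)"
        using W(4)[of x] F(5)[of x "V x"] vector_fieldsD(2)[OF V] dird_basis[OF smooth_onD(1)[OF F(3)], of x "V x"]
        by auto
    qed
    also have "\<dots> = (\<Sum>b\<in>Basis. (G p \<bullet> b) *\<^sub>R dird (dird F b) u p + (dird G u p \<bullet> b) *\<^sub>R dird F b p)"
      by (simp only: dird_sum[OF d] dird_bilinear[OF bounded_bilinear_scaleR d1 d2]
          dird_linear_compose[OF bounded_linear_inner_left dG])
    also have "\<dots> = (\<Sum>b\<in>Basis. (G p \<bullet> b) *\<^sub>R dird (dird F b) u p) + (\<Sum>b\<in>Basis. (dird G u p \<bullet> b) *\<^sub>R dird F b p)"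
      by (rule sum.distrib)
    also have "(\<Sum>b\<in>Basis. (dird G u p \<bullet> b) *\<^sub>R dird F b p) = dird F (tderiv M V p u) p"
      unfolding W(5)[OF W(2) u] by (rule dird_basis[OF dF, symmetric])
    also have "(\<Sum>b\<in>Basis. (G p \<bullet> b) *\<^sub>R dird (dird F b) u p)
        = (\<Sum>b\<in>Basis. \<Sum>c\<in>Basis. ((V p \<bullet> b) * (u \<bullet> c)) *\<^sub>R dird (dird F b) c p)"
      unfolding W(4)[OF W(2) p]
      by (subst dird_basis[OF d2, of _ u]) (simp add: scaleR_sum_right)
    finally show ?thesis .
  qed
  have sw: "(\<Sum>b\<in>Basis. \<Sum>c\<in>Basis. ((U p \<bullet> b) * (V p \<bullet> c)) *\<^sub>R dird (dird F b) c p)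
    = (\<Sum>b\<in>Basis. \<Sum>c\<in>Basis. ((V p \<bullet> b) * (U p \<bullet> c)) *\<^sub>R dird (dird F b) c p)"
    by (subst sum.swap, intro sum.cong refl) (simp add: dird_commute[OF F(1,3,2)] mult.commute)
  show ?thesis
    unfolding one[OF V vector_fieldsD(2)[OF U p]] one[OF U vector_fieldsD(2)[OF V p]] sw F(5)[OF F(2) lie]
    unfolding lie_bracket_def by (simp add: linear_diff[OF dird_linear[OF dF]])
qed

subsection \<open>Connections\<close>

lemma connection_alongD:
  assumes c: "connection_along M N X D" and V: "V \<in> vector_fields M" and Y: "Y \<in> fields_along M N X"
  shows "D V Y \<in> fields_along M N X"
    and "Z \<in> fields_along M N X \<Longrightarrow> p \<in> M \<Longrightarrow> D V (\<lambda>q. Y q + Z q) p = D V Y p + D V Z p"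
    and "smooth_map_on M f \<Longrightarrow> p \<in> M \<Longrightarrow>
      D V (\<lambda>q. f q *\<^sub>R Y q) p = tderiv M f p (V p) *\<^sub>R Y p + f p *\<^sub>R D V Y p"
proof -
  note c' = c[unfolded connection_along_def]
  show "D V Y \<in> fields_along M N X" using c'[THEN conjunct1] V Y by simp
  show "Z \<in> fields_along M N X \<Longrightarrow> p \<in> M \<Longrightarrow> D V (\<lambda>q. Y q + Z q) p = D V Y p + D V Z p"
    using c'[THEN conjunct2, THEN conjunct2, THEN conjunct1] V Y by simp
  show "smooth_map_on M f \<Longrightarrow> p \<in> M \<Longrightarrow>
      D V (\<lambda>q. f q *\<^sub>R Y q) p = tderiv M f p (V p) *\<^sub>R Y p + f p *\<^sub>R D V Y p"
    using c'[THEN conjunct2, THEN conjunct2, THEN conjunct2] V Y by simp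
qed

lemma is_levi_civitaD:
  assumes D: "is_levi_civita M g D" and V: "V \<in> vector_fields M" and W: "W \<in> vector_fields M"
  shows "connection_along M M (\<lambda>p. p) D" and "D V W \<in> vector_fields M"
    and "p \<in> M \<Longrightarrow> D V W p - D W V p = lie_bracket M V W p"
    and "U \<in> vector_fields M \<Longrightarrow> p \<in> M \<Longrightarrow>
      tderiv M (\<lambda>q. g q (V q) (W q)) p (U p) = g p (D U V p) (W p) + g p (V p) (D U W p)"
proof -
  note D' = D[unfolded is_levi_civita_def]
  show c: "connection_along M M (\<lambda>p. p) D" by (rule D'[THEN conjunct1])
  show "D V W \<in> vector_fields M"
    using connection_alongD(1)[OF c V] W unfolding vector_fields_def by simp
  show "p \<in> M \<Longrightarrow> D V W p - D W V p = lie_bracket M V W p"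
    using D'[THEN conjunct2, THEN conjunct1] V W by simp
  show "U \<in> vector_fields M \<Longrightarrow> p \<in> M \<Longrightarrow>
      tderiv M (\<lambda>q. g q (V q) (W q)) p (U p) = g p (D U V p) (W p) + g p (V p) (D U W p)"
    using D'[THEN conjunct2, THEN conjunct2] V W by simp
qed

text \<open>The difference \<open>S\<close> of two such connections is symmetric because the
  torsions agree and skew because both are metric, which forces it to vanish. The form is only
  assumed nondegenerate on tangent spaces, so the argument covers the Lorentzian metric as well as
  \<open>g\<close>.\<close>

lemma levi_civita_unique:
  assumes D: "is_levi_civita M g D" "is_levi_civita M g D'"
    and ext: "\<And>p v. p \<in> M \<Longrightarrow> v \<in> tangent_space M p \<Longrightarrow> \<exists>V\<in>vector_fields M. V p = v"
    and sub: "\<And>p. p \<in> M \<Longrightarrow> subspace (tangent_space M p)"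
    and sym: "\<And>p u v. u \<in> tangent_space M p \<Longrightarrow> v \<in> tangent_space M p \<Longrightarrow> g p u v = g p v u"
    and diff: "\<And>p u v w. u \<in> tangent_space M p \<Longrightarrow> v \<in> tangent_space M p \<Longrightarrow> w \<in> tangent_space M p \<Longrightarrow>
        g p (u - v) w = g p u w - g p v w"
    and nondeg: "\<And>p u. u \<in> tangent_space M p \<Longrightarrow> (\<And>w. w \<in> tangent_space M p \<Longrightarrow> g p u w = 0) \<Longrightarrow> u = 0"
    and V: "V \<in> vector_fields M" and W: "W \<in> vector_fields M" and p: "p \<in> M"
  shows "D V W p = D' V W p"
proof -
  have tan: "E V W p \<in> tangent_space M p"
    if "is_levi_civita M g E" "V \<in> vector_fields M" "W \<in> vector_fields M" for E V W
    by (rule vector_fieldsD(2)[OF is_levi_civitaD(2)[OF that] p])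
  note t1 = tan[OF D(1)] and t2 = tan[OF D(2)]
  define S where "S = (\<lambda>V W. D V W p - D' V W p)"
  have tS: "S V W \<in> tangent_space M p" if "V \<in> vector_fields M" "W \<in> vector_fields M" for V W
    unfolding S_def by (rule subspace_diff[OF sub[OF p] t1[OF that] t2[OF that]])
  have gS: "g p (S V W) u = g p (D V W p) u - g p (D' V W p) u"
    if "V \<in> vector_fields M" "W \<in> vector_fields M" "u \<in> tangent_space M p" for V W u
    unfolding S_def by (rule diff[OF t1[OF that(1,2)] t2[OF that(1,2)] that(3)])
  have tor: "E V W p - E W V p = lie_bracket M V W p"
    if "is_levi_civita M g E" "V \<in> vector_fields M" "W \<in> vector_fields M" for E V W
    by (rule is_levi_civitaD(3)[OF that p])
  have symS: "S V W = S W V" if "V \<in> vector_fields M" "W \<in> vector_fields M" for V W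
    using tor[OF D(1) that] tor[OF D(2) that] unfolding S_def by (simp add: algebra_simps)
  have met: "tderiv M (\<lambda>q. g q (V q) (W q)) p (U p) = g p (E U V p) (W p) + g p (V p) (E U W p)"
    if "is_levi_civita M g E" "U \<in> vector_fields M" "V \<in> vector_fields M" "W \<in> vector_fields M" for E U V W
    by (rule is_levi_civitaD(4)[OF that(1,3,4,2) p])
  have skew: "g p (S U V) (W p) = - g p (S U W) (V p)"
    if "U \<in> vector_fields M" "V \<in> vector_fields M" "W \<in> vector_fields M" for U V W
  proof -
    note v = vector_fieldsD(2)[OF that(2) p] and w = vector_fieldsD(2)[OF that(3) p]
    show ?thesis
      using met[OF D(1) that] met[OF D(2) that] sym[OF v t1[OF that(1,3)]] sym[OF v t2[OF that(1,3)]]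
      unfolding gS[OF that(1,2) w] gS[OF that(1,3) v] by simp
  qed
  have "S V W = 0"
  proof (rule nondeg[OF tS[OF V W]])
    fix u assume "u \<in> tangent_space M p"
    then obtain U where U: "U \<in> vector_fields M" "U p = u" using ext[OF p] by blast
    \<comment> \<open>Skewness exchanges the last two entries and symmetry the first two.
      Alternating them, with three sign changes, returns to the start with the opposite
      sign.\<close>
    have "g p (S V W) (U p) = - g p (S V U) (W p)" by (rule skew[OF V W U(1)])
    also have "\<dots> = - g p (S U V) (W p)" by (simp only: symS[OF V U(1)])
    also have "\<dots> = g p (S U W) (V p)" using skew[OF U(1) V W] by simp
    also have "\<dots> = g p (S W U) (V p)" by (simp only: symS[OF U(1) W])
    also have "\<dots> = - g p (S W V) (U p)" by (rule skew[OF W U(1) V])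
    also have "\<dots> = - g p (S V W) (U p)" by (simp only: symS[OF V W])
    finally show "g p (S V W) u = 0" using U(2) by simp
  qed
  then show ?thesis by (simp add: S_def)
qed

text \<open>Fields are functions on the whole ambient type, so it has to be shown that
  \<open>D\<close> ignores their values off \<open>M\<close>.\<close>

lemma connection_along_zero_on:
  assumes D: "connection_along M N X D" and V: "V \<in> vector_fields M" and Z: "Z \<in> fields_along M N X"
    and zero: "\<And>q. q \<in> M \<Longrightarrow> Z q = 0" and p: "p \<in> M"
  shows "D V Z p = 0"
proof -
  \<comment> \<open>Multiplication by this \<open>f\<close> leaves \<open>Z\<close> unchanged as a
    function, while \<open>f\<close> and its tangential derivative vanish on \<open>M\<close>; the
    Leibniz rule then gives 0.\<close>
  define f where "f = (\<lambda>q. if q \<in> M then 0 else 1 :: real)"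
  have f: "smooth_map_on M f" by (rule smooth_map_on_cong[OF smooth_map_on_const[of M 0]]) (simp add: f_def)
  have "tderiv M f p (V p) = tderiv M (\<lambda>q. 0) p (V p)"
    by (rule tderiv_cong[OF smooth_map_on_const vector_fieldsD(2)[OF V p]]) (simp add: f_def)
  then have "tderiv M f p (V p) = 0" by (simp add: tderiv_const[OF vector_fieldsD(2)[OF V p]])
  moreover have "D V (\<lambda>q. f q *\<^sub>R Z q) p = tderiv M f p (V p) *\<^sub>R Z p + f p *\<^sub>R D V Z p"
    by (rule connection_alongD(3)[OF D V Z f p])
  moreover have "(\<lambda>q. f q *\<^sub>R Z q) = Z" using zero by (auto simp: f_def fun_eq_iff)
  ultimately show ?thesis using p by (simp add: f_def)
qed

lemma connection_along_cong:
  assumes D: "connection_along M N X D" and V: "V \<in> vector_fields M"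
    and Y: "Y \<in> fields_along M N X" "Y' \<in> fields_along M N X"
    and sub: "\<And>q. q \<in> M \<Longrightarrow> subspace (tangent_space N (X q))"
    and eq: "\<And>q. q \<in> M \<Longrightarrow> Y q = Y' q" and p: "p \<in> M"
  shows "D V Y p = D V Y' p"
proof -
  have Z: "(\<lambda>q. Y q - Y' q) \<in> fields_along M N X"
    using fields_alongD[OF Y(1)] fields_alongD[OF Y(2)]
    by (intro fields_alongI smooth_map_on_diff subspace_diff[OF sub]) auto
  have "D V (\<lambda>q. Y' q + (Y q - Y' q)) p = D V Y' p + D V (\<lambda>q. Y q - Y' q) p"
    by (rule connection_alongD(2)[OF D V Y(2) Z p])
  then show ?thesis using connection_along_zero_on[OF D V Z _ p] eq by simp
qed

lemma connection_along_sum: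
  assumes D: "connection_along M N X D" and V: "V \<in> vector_fields M"
    and sub: "\<And>q. q \<in> M \<Longrightarrow> subspace (tangent_space N (X q))"
    and Y: "\<And>i. i \<in> I \<Longrightarrow> Y i \<in> fields_along M N X" and f: "\<And>i. i \<in> I \<Longrightarrow> smooth_map_on M (f i)"
    and I: "finite I" and p: "p \<in> M"
  shows "(\<lambda>q. \<Sum>i\<in>I. f i q *\<^sub>R Y i q) \<in> fields_along M N X \<and>
    D V (\<lambda>q. \<Sum>i\<in>I. f i q *\<^sub>R Y i q) p = (\<Sum>i\<in>I. tderiv M (f i) p (V p) *\<^sub>R Y i p + f i p *\<^sub>R D V (Y i) p)"
  using I Y f
proof (induction I)
  case empty
  have "(\<lambda>q. 0) \<in> fields_along M N X"
    by (intro fields_alongI smooth_map_on_const subspace_0[OF sub]) auto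
  then show ?case using connection_along_zero_on[OF D V _ _ p] by simp
next
  case (insert i I)
  let ?Z = "\<lambda>q. \<Sum>i\<in>I. f i q *\<^sub>R Y i q"
  have Z: "?Z \<in> fields_along M N X"
    "D V ?Z p = (\<Sum>i\<in>I. tderiv M (f i) p (V p) *\<^sub>R Y i p + f i p *\<^sub>R D V (Y i) p)"
    using insert by auto
  have Yi: "Y i \<in> fields_along M N X" and fi: "smooth_map_on M (f i)" using insert by auto
  have fY: "(\<lambda>q. f i q *\<^sub>R Y i q) \<in> fields_along M N X"
    using fields_alongD[OF Yi] by (intro fields_alongI smooth_map_on_scaleR fi subspace_scale[OF sub]) auto
  have "D V (\<lambda>q. f i q *\<^sub>R Y i q + ?Z q) p = D V (\<lambda>q. f i q *\<^sub>R Y i q) p + D V ?Z p"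
    by (rule connection_alongD(2)[OF D V fY Z(1) p])
  moreover have "D V (\<lambda>q. f i q *\<^sub>R Y i q) p = tderiv M (f i) p (V p) *\<^sub>R Y i p + f i p *\<^sub>R D V (Y i) p"
    by (rule connection_alongD(3)[OF D V Yi fi p])
  moreover have "(\<lambda>q. f i q *\<^sub>R Y i q + ?Z q) \<in> fields_along M N X"
    using fields_alongD[OF fY] fields_alongD[OF Z(1)]
    by (intro fields_alongI smooth_map_on_add subspace_add[OF sub]) auto
  ultimately show ?case using insert(1,2) Z(2) by simp
qed

subsection \<open>Quadrics\<close>

text \<open>Covers both the round sphere, with \<open>inner\<close> and \<open>s = 1\<close>, and de
  Sitter space, with \<open>mink\<close> and \<open>s = \<rho>\<^sup>2\<close>.\<close>

locale quadric =
  fixes B :: "'b::euclidean_space \<Rightarrow> 'b \<Rightarrow> real" and s :: real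
  assumes bil: "bounded_bilinear B" and symm: "B x y = B y x" and s: "s > 0"
    and nondegenerate: "(\<And>y. B x y = 0) \<Longrightarrow> x = 0"
begin

abbreviation Q where "Q \<equiv> {x. B x x = s}"

text \<open>The \<open>B\<close>-orthogonal projection of \<open>v\<close> to the tangent space at
  \<open>x\<close>. With \<open>v\<close> fixed it is a tangent field, so these fields realize every
  tangent vector and generate all fields.\<close>

definition proj :: "'b \<Rightarrow> 'b \<Rightarrow> 'b" where "proj v x = v - (B x v / s) *\<^sub>R x"

lemmas B_simps =
  bounded_bilinear.add_left[OF bil] bounded_bilinear.add_right[OF bil]
  bounded_bilinear.diff_left[OF bil] bounded_bilinear.diff_right[OF bil]
  bounded_bilinear.scaleR_left[OF bil] bounded_bilinear.scaleR_right[OF bil]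
  bounded_bilinear.minus_left[OF bil] bounded_bilinear.minus_right[OF bil]
  bounded_bilinear.zero_left[OF bil] bounded_bilinear.zero_right[OF bil]

text \<open>One inclusion comes from differentiating \<open>B (c t) (c t) = s\<close>. For the
  other, \<open>tangent_space\<close> demands a curve inside \<open>Q\<close> for all real times: in
  b x + a v the factor \<open>a\<close> is bounded and \<open>b\<close> is solved from the equation
  of the quadric.\<close>

lemma tangent_space_Q:
  assumes x: "x \<in> Q"
  shows "tangent_space Q x = {v. B x v = 0}"
proof (intro set_eqI iffI)
  fix v assume "v \<in> tangent_space Q x"
  then obtain c where c: "range c \<subseteq> Q" "c 0 = x" "(c has_vector_derivative v) (at 0)"
    by (rule tangent_spaceE) blast
  have "((\<lambda>t. B (c t) (c t)) has_vector_derivative B (c 0) v + B v (c 0)) (at 0)"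
    by (rule bounded_bilinear.has_vector_derivative[OF bil c(3,3)])
  moreover have "(\<lambda>t. B (c t) (c t)) = (\<lambda>t. s)" using c(1) by auto
  ultimately have "B (c 0) v + B v (c 0) = 0"
    using vector_derivative_unique_at has_vector_derivative_const by metis
  then show "v \<in> {v. B x v = 0}" using c(2) symm[of v x] by simp
next
  fix v assume "v \<in> {v. B x v = 0}"
  then have v: "B x v = 0" "B v x = 0" using symm by auto
  define k where "k = B v v"
  \<comment> \<open>Chosen to have \<open>m \<ge> 1\<close> and
    \<open>k / s \<le> m\<^sup>2\<close>: as \<open>a\<close> has modulus at most
    \<open>1 / m\<close>, the radicand in \<open>b\<close> stays nonnegative at all times.\<close>
  define m where "m = 1 + \<bar>k\<bar> / s"
  have m1: "m \<ge> 1" using s by (simp add: m_def)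
  then have m: "m \<ge> 1" "m > 0" "m \<noteq> 0" by linarith+
  have "k / s \<le> m" using s abs_ge_self[of k] divide_right_mono[of k "\<bar>k\<bar>" s] by (simp add: m_def)
  also have "m * 1 \<le> m * m" using m by (intro mult_left_mono) auto
  finally have km: "k / s \<le> m\<^sup>2" by (simp add: power2_eq_square)
  define a where "a = (\<lambda>t. sin (m * t) / m)"
  define b where "b = (\<lambda>t. sqrt (1 - (a t)\<^sup>2 * (k / s)))"
  have arg: "1 - (a t)\<^sup>2 * (k / s) \<ge> 0" for t
  proof -
    have "(a t)\<^sup>2 * (k / s) \<le> (a t)\<^sup>2 * m\<^sup>2" by (intro mult_left_mono km) auto
    also have "\<dots> = (sin (m * t))\<^sup>2" using m by (simp add: a_def power_divide)
    also have "\<dots> \<le> 1" by (simp add: abs_square_le_1)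
    finally show ?thesis by simp
  qed
  have da: "(a has_real_derivative 1) (at 0)"
    unfolding a_def using m by (auto intro!: derivative_eq_intros)
  have a0: "a 0 = 0" by (simp add: a_def)
  have db: "(b has_real_derivative 0) (at 0)"
    unfolding b_def using s by (auto intro!: derivative_eq_intros da simp: a0)
  define c where "c = (\<lambda>t. b t *\<^sub>R x + a t *\<^sub>R v)"
  have "B (c t) (c t) = s" for t
  proof -
    have "B (c t) (c t) = (b t)\<^sup>2 * s + (a t)\<^sup>2 * k"
      using x v by (simp add: c_def B_simps k_def power2_eq_square)
    also have "(b t)\<^sup>2 = 1 - (a t)\<^sup>2 * (k / s)" unfolding b_def using arg by simp
    finally show ?thesis using s by (simp add: field_simps)
  qed
  moreover have "(c has_vector_derivative (b 0 *\<^sub>R 0 + 0 *\<^sub>R x) + (a 0 *\<^sub>R 0 + 1 *\<^sub>R v)) (at 0)"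
    unfolding c_def
    by (intro has_vector_derivative_add has_vector_derivative_scaleR da db has_vector_derivative_const)
  moreover have "c 0 = x" by (simp add: c_def a0 b_def)
  ultimately show "v \<in> tangent_space Q x"
    unfolding tangent_space_def by (intro CollectI exI[of _ c]) auto
qed

lemma subspace_tangent_Q: "x \<in> Q \<Longrightarrow> subspace (tangent_space Q x)"
  unfolding tangent_space_Q by (auto simp: subspace_def B_simps)

lemma smooth_map_on_B: "smooth_map_on M f \<Longrightarrow> smooth_map_on M g \<Longrightarrow> smooth_map_on M (\<lambda>x. B (f x) (g x))"
  by (rule smooth_map_on_bilinear[OF bil])

lemma smooth_map_on_B_scaleR:
  "smooth_map_on M f \<Longrightarrow> smooth_map_on M g \<Longrightarrow> smooth_map_on M h \<Longrightarrow> smooth_map_on M (\<lambda>x. (B (f x) (g x) / s) *\<^sub>R h x)"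
  by (intro smooth_map_on_scaleR smooth_map_on_linear_compose[OF bounded_linear_divide] smooth_map_on_B)

lemma proj_field: "proj v \<in> vector_fields Q"
proof (rule vector_fieldsI)
  show "smooth_map_on Q (proj v)" unfolding proj_def[abs_def]
    by (intro smooth_map_on_diff smooth_map_on_const smooth_map_on_B_scaleR smooth_map_on_id)
  show "proj v p \<in> tangent_space Q p" if "p \<in> Q" for p
    unfolding tangent_space_Q[OF that] using that s by (simp add: proj_def B_simps)
qed

lemma proj_tangent: "x \<in> Q \<Longrightarrow> v \<in> tangent_space Q x \<Longrightarrow> proj v x = v"
  unfolding tangent_space_Q by (simp add: proj_def)

lemma ext_field_Q:
  assumes "x \<in> Q" "v \<in> tangent_space Q x"
  shows "ext_field Q x v \<in> vector_fields Q" "ext_field Q x v x = v"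
proof -
  have "\<exists>V. V \<in> vector_fields Q \<and> V x = v" using proj_field proj_tangent[OF assms] by blast
  from someI_ex[OF this] show "ext_field Q x v \<in> vector_fields Q" "ext_field Q x v x = v"
    by (auto simp: ext_field_def)
qed

text \<open>The tangential part of the flat derivative of \<open>Y\<close>. The normal at
  \<open>X p\<close> is \<open>X p\<close> itself, and by \<open>tderiv_along\<close> the normal
  coefficient to be removed is \<open>- B (tderiv M X p (V p)) (Y p) / s\<close>. With
  \<open>X\<close> the identity of \<open>Q\<close> this is its Levi-Civita connection.\<close>

definition conn :: "'a::euclidean_space set \<Rightarrow> ('a \<Rightarrow> 'b) \<Rightarrow> ('a \<Rightarrow> 'a) \<Rightarrow> ('a \<Rightarrow> 'b) \<Rightarrow> 'a \<Rightarrow> 'b" where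
  "conn M X V Y p = tderiv M Y p (V p) + (B (tderiv M X p (V p)) (Y p) / s) *\<^sub>R X p"

lemma tderiv_along:
  assumes X: "smooth_map_on M X" "X ` M \<subseteq> Q" and Y: "Y \<in> fields_along M Q X" and v: "v \<in> tangent_space M p"
  shows "B (X p) (tderiv M Y p v) = - B (tderiv M X p v) (Y p)"
proof -
  have p: "p \<in> M" by (rule tangent_space_memD[OF v])
  have "B (X q) (Y q) = 0" if "q \<in> M" for q
    using fields_alongD(2)[OF Y that] tangent_space_Q[of "X q"] X(2) that by auto
  then have "tderiv M (\<lambda>q. B (X q) (Y q)) p v = tderiv M (\<lambda>q. 0) p v"
    by (intro tderiv_cong[OF smooth_map_on_const v])
  then show ?thesis
    by (simp add: tderiv_bilinear[OF bil X(1) fields_alongD(1)[OF Y] v] tderiv_const[OF v])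
qed

lemma connection_along_conn:
  assumes X: "smooth_map_on M X" "X ` M \<subseteq> Q"
    and sub: "\<And>p. p \<in> M \<Longrightarrow> subspace (tangent_space M p)"
  shows "connection_along M Q X (conn M X)"
  unfolding connection_along_def
proof (intro conjI ballI allI impI)
  fix V Y assume V: "V \<in> vector_fields M" and Y: "Y \<in> fields_along M Q X"
  note sY = fields_alongD(1)[OF Y]
  show "conn M X V Y \<in> fields_along M Q X"
  proof (rule fields_alongI)
    show "smooth_map_on M (conn M X V Y)" unfolding conn_def[abs_def]
      by (intro smooth_map_on_add smooth_map_on_B_scaleR smooth_tderiv_field V X(1) sY)
    fix p assume p: "p \<in> M"
    then have "X p \<in> Q" using X(2) by auto
    with tderiv_along[OF X Y vector_fieldsD(2)[OF V p]] s
    show "conn M X V Y p \<in> tangent_space Q (X p)"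
      by (simp add: tangent_space_Q conn_def B_simps)
  qed
next
  fix V W Y p and f :: "_ \<Rightarrow> real"
  assume V: "V \<in> vector_fields M" and W: "W \<in> vector_fields M" and Y: "Y \<in> fields_along M Q X"
    and p: "p \<in> M"
  note v = vector_fieldsD(2)[OF V p] and w = vector_fieldsD(2)[OF W p]
  have fvw: "f p *\<^sub>R V p + W p \<in> tangent_space M p"
    using v w sub[OF p] by (intro subspace_add subspace_scale)
  obtain L where L: "linear L" "\<And>v. v \<in> tangent_space M p \<Longrightarrow> tderiv M X p v = L v"
    using tderiv_on_tangent_linear[OF X(1) p] by blast
  obtain K where K: "linear K" "\<And>v. v \<in> tangent_space M p \<Longrightarrow> tderiv M Y p v = K v"
    using tderiv_on_tangent_linear[OF fields_alongD(1)[OF Y] p] by blast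
  show "conn M X (\<lambda>q. f q *\<^sub>R V q + W q) Y p = f p *\<^sub>R conn M X V Y p + conn M X W Y p"
    unfolding conn_def L(2)[OF v] L(2)[OF w] L(2)[OF fvw] K(2)[OF v] K(2)[OF w] K(2)[OF fvw]
    by (simp add: linear_add[OF L(1)] linear_cmul[OF L(1)] linear_add[OF K(1)] linear_cmul[OF K(1)] B_simps
        algebra_simps add_divide_distrib)
next
  fix V Y Z p assume V: "V \<in> vector_fields M" and Y: "Y \<in> fields_along M Q X" "Z \<in> fields_along M Q X"
    and p: "p \<in> M"
  show "conn M X V (\<lambda>q. Y q + Z q) p = conn M X V Y p + conn M X V Z p"
    unfolding conn_def
    by (simp add: tderiv_add[OF fields_alongD(1)[OF Y(1)] fields_alongD(1)[OF Y(2)] vector_fieldsD(2)[OF V p]]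
        B_simps algebra_simps add_divide_distrib)
next
  fix V Y p and f :: "_ \<Rightarrow> real" assume V: "V \<in> vector_fields M" and Y: "Y \<in> fields_along M Q X"
    and f: "smooth_map_on M f" and p: "p \<in> M"
  show "conn M X V (\<lambda>q. f q *\<^sub>R Y q) p = tderiv M f p (V p) *\<^sub>R Y p + f p *\<^sub>R conn M X V Y p"
    unfolding conn_def
    by (simp add: tderiv_scaleR[OF f fields_alongD(1)[OF Y] vector_fieldsD(2)[OF V p]] B_simps algebra_simps)
qed

lemma is_levi_civita_conn: "is_levi_civita Q (\<lambda>x. B) (conn Q (\<lambda>x. x))"
  unfolding is_levi_civita_def
proof (intro conjI ballI)
  show "connection_along Q Q (\<lambda>p. p) (conn Q (\<lambda>x. x))"
    by (rule connection_along_conn[OF smooth_map_on_id _ subspace_tangent_Q]) auto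
next
  fix V W p assume V: "V \<in> vector_fields Q" and W: "W \<in> vector_fields Q" and p: "p \<in> Q"
  show "conn Q (\<lambda>x. x) V W p - conn Q (\<lambda>x. x) W V p = lie_bracket Q V W p"
    unfolding conn_def lie_bracket_def
    by (simp add: tderiv_id[OF vector_fieldsD(2)[OF V p]] tderiv_id[OF vector_fieldsD(2)[OF W p]] symm[of "W p" "V p"])
next
  fix U V W p assume U: "U \<in> vector_fields Q" and V: "V \<in> vector_fields Q" and W: "W \<in> vector_fields Q" and p: "p \<in> Q"
  have "B p (V p) = 0" "B p (W p) = 0" "B (V p) p = 0"
    using vector_fieldsD(2)[OF V p] vector_fieldsD(2)[OF W p] tangent_space_Q[OF p] symm[of "V p" p] by auto
  then show "tderiv Q (\<lambda>q. B (V q) (W q)) p (U p) = B (conn Q (\<lambda>x. x) U V p) (W p) + B (V p) (conn Q (\<lambda>x. x) U W p)"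
    by (simp add: conn_def B_simps
        tderiv_bilinear[OF bil vector_fieldsD(1)[OF V] vector_fieldsD(1)[OF W] vector_fieldsD(2)[OF U p]])
qed

lemma levi_civita_Q:
  assumes V: "V \<in> vector_fields Q" and W: "W \<in> vector_fields Q" and p: "p \<in> Q"
  shows "levi_civita Q (\<lambda>x. B) V W p = conn Q (\<lambda>x. x) V W p"
proof (rule levi_civita_unique[OF _ is_levi_civita_conn _ _ _ _ _ V W p])
  show "is_levi_civita Q (\<lambda>x. B) (levi_civita Q (\<lambda>x. B))"
    unfolding levi_civita_def by (rule someI[of _ "conn Q (\<lambda>x. x)"], rule is_levi_civita_conn)
  show "\<exists>V\<in>vector_fields Q. V p = v" if "p \<in> Q" "v \<in> tangent_space Q p" for p v
    using ext_field_Q[OF that] by blast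
  fix p u
  assume u: "u \<in> tangent_space Q p" and 0: "\<And>w. w \<in> tangent_space Q p \<Longrightarrow> B u w = 0"
  have p: "p \<in> Q" by (rule tangent_space_memD[OF u])
  show "u = 0"
  proof (rule nondegenerate)
    fix z
    \<comment> \<open>Nondegeneracy on the tangent space: any ambient \<open>z\<close> differs from
      a tangent vector by a multiple of \<open>p\<close>, to which \<open>u\<close> is
      orthogonal.\<close>
    have "B u (proj z p) = 0" by (rule 0[OF vector_fieldsD(2)[OF proj_field p]])
    moreover have "B u p = 0" using u symm[of u p] by (simp add: tangent_space_Q[OF p])
    ultimately show "B u z = 0" by (simp add: proj_def B_simps)
  qed
qed (auto simp: symm B_simps subspace_tangent_Q)

lemma is_pullback_connection_conn:
  assumes X: "smooth_map_on M X" "X ` M \<subseteq> Q"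
    and sub: "\<And>p. p \<in> M \<Longrightarrow> subspace (tangent_space M p)"
  shows "is_pullback_connection M Q (\<lambda>x. B) X (conn M X)"
  unfolding is_pullback_connection_def
proof (intro conjI ballI)
  show "connection_along M Q X (conn M X)" by (rule connection_along_conn[OF assms])
  fix V Z p assume V: "V \<in> vector_fields M" and Z: "Z \<in> vector_fields Q" and p: "p \<in> M"
  note v = vector_fieldsD(2)[OF V p]
  have Xp: "X p \<in> Q" using X(2) p by auto
  note t = tderiv_tangent[OF X v]
  note e = ext_field_Q[OF Xp t]
  show "conn M X V (\<lambda>q. Z (X q)) p = levi_civita Q (\<lambda>x. B) (ext_field Q (X p) (tderiv M X p (V p))) Z (X p)"
    unfolding levi_civita_Q[OF e(1) Z Xp] conn_def e(2) tderiv_chain[OF X vector_fieldsD(1)[OF Z] v] tderiv_id[OF t] ..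
qed

text \<open>The defining property prescribes a pullback connection only on fields \<open>Z\<close>
  composed with \<open>X\<close>. It is nevertheless determined, because every field along
  \<open>X\<close> is a combination of such fields with smooth coefficients.\<close>

lemma pullback_connection_Q:
  assumes X: "smooth_map_on M X" "X ` M \<subseteq> Q"
    and sub: "\<And>p. p \<in> M \<Longrightarrow> subspace (tangent_space M p)"
    and V: "V \<in> vector_fields M" and Y: "Y \<in> fields_along M Q X" and p: "p \<in> M"
  shows "pullback_connection M Q (\<lambda>x. B) X V Y p = conn M X V Y p"
proof -
  \<comment> \<open>The expansion of \<open>Y\<close> in constant vectors, each projected to the
    tangent space of \<open>Q\<close>; projecting does not change \<open>Y\<close>, which is tangent
    already.\<close>
  define Y' where "Y' = (\<lambda>q. \<Sum>b\<in>Basis. (Y q \<bullet> b) *\<^sub>R proj b (X q))"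
  have Xq: "X q \<in> Q" if "q \<in> M" for q using X(2) that by auto
  have YY': "Y q = Y' q" if "q \<in> M" for q
  proof -
    have "linear (\<lambda>v. proj v (X q))"
      by (rule linearI) (simp_all add: proj_def B_simps algebra_simps add_divide_distrib)
    from linear_basis_expansion[OF this, of "Y q"]
    show ?thesis using proj_tangent[OF Xq[OF that] fields_alongD(2)[OF Y that]] by (simp add: Y'_def)
  qed
  have PX: "(\<lambda>q. proj b (X q)) \<in> fields_along M Q X" for b
    by (intro fields_alongI smooth_map_on_compose[OF X vector_fieldsD(1)[OF proj_field]]
        vector_fieldsD(2)[OF proj_field] Xq)
  have sc: "smooth_map_on M (\<lambda>q. Y q \<bullet> b)" for b
    by (rule smooth_map_on_linear_compose[OF bounded_linear_inner_left fields_alongD(1)[OF Y]])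
  have subQ: "subspace (tangent_space Q (X q))" if "q \<in> M" for q by (rule subspace_tangent_Q[OF Xq[OF that]])
  have key: "D V Y p = (\<Sum>b\<in>Basis. tderiv M (\<lambda>q. Y q \<bullet> b) p (V p) *\<^sub>R proj b (X p) + (Y p \<bullet> b) *\<^sub>R
        levi_civita Q (\<lambda>x. B) (ext_field Q (X p) (tderiv M X p (V p))) (proj b) (X p))"
    if D: "is_pullback_connection M Q (\<lambda>x. B) X D" for D
  proof -
    have c: "connection_along M Q X D" using D unfolding is_pullback_connection_def by blast
    have l: "D V (\<lambda>q. proj b (X q)) p = levi_civita Q (\<lambda>x. B) (ext_field Q (X p) (tderiv M X p (V p))) (proj b) (X p)" for b
      using D V proj_field p unfolding is_pullback_connection_def by blast
    have sum: "Y' \<in> fields_along M Q X \<and> D V Y' p =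
        (\<Sum>b\<in>Basis. tderiv M (\<lambda>q. Y q \<bullet> b) p (V p) *\<^sub>R proj b (X p) + (Y p \<bullet> b) *\<^sub>R D V (\<lambda>q. proj b (X q)) p)"
      unfolding Y'_def by (rule connection_along_sum[OF c V subQ PX sc finite_Basis p])
    have "D V Y p = D V Y' p"
      by (rule connection_along_cong[OF c V Y conjunct1[OF sum] subQ YY' p])
    also note conjunct2[OF sum]
    finally show ?thesis unfolding l .
  qed
  have "is_pullback_connection M Q (\<lambda>x. B) X (pullback_connection M Q (\<lambda>x. B) X)"
    unfolding pullback_connection_def
    by (rule someI[of _ "conn M X"], rule is_pullback_connection_conn[OF X sub])
  from key[OF this] key[OF is_pullback_connection_conn[OF X sub]] show ?thesis by simp
qed

end

subsection \<open>Spacelike hypersurfaces of de Sitter space\<close>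

lemma bounded_bilinear_mink: "bounded_bilinear (mink :: ('n::finite) minkowski \<Rightarrow> _)"
proof -
  have l: "bounded_linear (\<lambda>x. (fst x, - snd x) :: 'n minkowski)"
    by (intro bounded_linear_Pair bounded_linear_fst bounded_linear_minus bounded_linear_snd)
  have "mink = (\<lambda>x y :: 'n minkowski. x \<bullet> (fst y, - snd y))"
    by (simp add: mink_def fun_eq_iff inner_prod_def)
  then show ?thesis using bounded_bilinear.comp[OF bounded_bilinear_inner bounded_linear_ident l] by (simp only:)
qed

lemma mink_commute: "mink x y = mink y x"
  by (simp add: mink_def inner_commute)

lemma quadric_mink: "s > 0 \<Longrightarrow> quadric (mink :: ('n::finite) minkowski \<Rightarrow> _) s"
proof (rule quadric.intro[OF bounded_bilinear_mink mink_commute])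
  fix x :: "'n minkowski" assume "\<And>y. mink x y = 0"
  from this[of "(fst x, - snd x)"] have "fst x \<bullet> fst x + snd x * snd x = 0" by (simp add: mink_def)
  then have "x \<bullet> x = 0" by (simp add: inner_prod_def)
  then show "x = 0" by simp
qed

interpretation sph: quadric "inner :: 'a::euclidean_space \<Rightarrow> 'a \<Rightarrow> real" 1
  by (rule quadric.intro[OF bounded_bilinear_inner inner_commute]) (simp, metis inner_eq_zero_iff)

lemma Sn_eq: "Sn = {x. x \<bullet> x = 1}"
  by (auto simp: Sn_def norm_eq_1)

lemma tangent_space_Sn: "p \<in> Sn \<Longrightarrow> tangent_space Sn p = {v. p \<bullet> v = 0}"
  using sph.tangent_space_Q[of p] by (simp add: Sn_eq)

lemma subspace_tangent_Sn: "p \<in> Sn \<Longrightarrow> subspace (tangent_space Sn p)"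
  using sph.subspace_tangent_Q[of p] by (simp add: Sn_eq)

lemma proj_Sn_field: "sph.proj v \<in> vector_fields (Sn :: ('n::finite) euc set)"
  using sph.proj_field[of v] by (simp add: Sn_eq)

lemma proj_Sn_tangent: "p \<in> Sn \<Longrightarrow> sph.proj v p \<in> tangent_space Sn p"
  by (rule vector_fieldsD(2)[OF proj_Sn_field])

lemma proj_Sn_id: "p \<in> Sn \<Longrightarrow> v \<in> tangent_space Sn p \<Longrightarrow> sph.proj v p = v"
  using sph.proj_tangent[of p v] by (simp add: Sn_eq)

lemma proj_Sn_self: "p \<in> Sn \<Longrightarrow> sph.proj p p = 0"
  by (simp add: sph.proj_def Sn_eq)

lemma linear_proj: "linear (\<lambda>v. sph.proj v p)"
  by (rule linearI) (simp_all add: sph.proj_def sph.B_simps algebra_simps)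

lemma ext_field_Sn:
  assumes "p \<in> Sn" "v \<in> tangent_space Sn p"
  shows "ext_field Sn p v \<in> vector_fields Sn" "ext_field Sn p v p = v"
  using sph.ext_field_Q[of p v] assms by (simp_all add: Sn_eq)

text \<open>Tangency is read off from the round metric: its connection is torsion free, so the
  bracket is a difference of two tangent fields.\<close>

lemma lie_bracket_Sn:
  assumes "V \<in> vector_fields Sn" "W \<in> vector_fields (Sn :: ('n::finite) euc set)"
  shows "lie_bracket Sn V W \<in> vector_fields Sn"
proof (rule vector_fieldsI)
  show "smooth_map_on Sn (lie_bracket Sn V W)" unfolding lie_bracket_def[abs_def]
    by (intro smooth_map_on_diff smooth_tderiv_field vector_fieldsD(1)[OF assms(1)] vector_fieldsD(1)[OF assms(2)] assms)
  fix p :: "'n euc" assume p: "p \<in> Sn"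
  have lc: "is_levi_civita Sn (\<lambda>x. (\<bullet>)) (sph.conn (Sn :: 'n euc set) (\<lambda>x. x))"
    using sph.is_levi_civita_conn by (simp add: Sn_eq)
  show "lie_bracket Sn V W p \<in> tangent_space Sn p"
    unfolding is_levi_civitaD(3)[OF lc assms p, symmetric]
    by (intro subspace_diff subspace_tangent_Sn p vector_fieldsD(2)[OF is_levi_civitaD(2)[OF lc assms]]
        vector_fieldsD(2)[OF is_levi_civitaD(2)[OF lc assms(2,1)]])
qed

section \<open>The radial retraction onto the sphere\<close>

text \<open>A smooth retraction of the punctured space to the sphere. Composing with it turns
  functions on \<open>Sn\<close> into functions on an open set, where ordinary derivatives are
  available.\<close>

definition radial :: "'a::real_inner \<Rightarrow> 'a" where "radial x = inverse (sqrt (x \<bullet> x)) *\<^sub>R x"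

lemma open_nonzero: "open (- {0 :: 'a::real_normed_vector})"
  by (intro open_Compl closed_singleton)

lemma smooth_on_radial: "smooth_on (- {0}) (radial :: 'a::euclidean_space \<Rightarrow> 'a)"
proof -
  have o: "open (- {0 :: 'a})" by auto
  show ?thesis unfolding radial_def[abs_def]
    by (intro smooth_on_bilinear[OF bounded_bilinear_scaleR o] smooth_on_inverse[OF o] smooth_on_sqrt[OF o]
        smooth_on_bilinear[OF bounded_bilinear_inner o] smooth_on_id) auto
qed

lemma radial_Sn: "x \<noteq> 0 \<Longrightarrow> radial x \<in> Sn"
proof -
  assume "x \<noteq> 0"
  then have "x \<bullet> x > 0" by simp
  then have "inverse (sqrt (x \<bullet> x)) * inverse (sqrt (x \<bullet> x)) * (x \<bullet> x) = 1"
    by (simp flip: inverse_mult_distrib)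
  then show ?thesis by (simp add: radial_def Sn_eq mult.assoc)
qed

lemma radial_id: "x \<in> Sn \<Longrightarrow> radial x = x"
  by (simp add: radial_def Sn_eq)

lemma Sn_nonzero: "x \<in> Sn \<Longrightarrow> x \<noteq> 0"
  by (auto simp: Sn_eq)

lemma smooth_map_on_open: "open U \<Longrightarrow> smooth_map_on U f \<Longrightarrow> smooth_on U f"
proof (rule smooth_on_local)
  fix x assume U: "open U" "smooth_map_on U f" "x \<in> U"
  obtain V F where V: "open V" "x \<in> V" "smooth_on V F" "\<And>y. y \<in> V \<Longrightarrow> y \<in> U \<Longrightarrow> F y = f y"
    using U(2,3) by (rule smooth_map_onE) blast
  have "smooth_on (V \<inter> U) f"
    using V(4) by (intro smooth_on_cong[OF smooth_on_subset[OF V(3)]]) (auto simp: U(1) V(1))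
  then show "\<exists>V. open V \<and> x \<in> V \<and> smooth_on V f" using U V by blast
qed

lemma smooth_on_radial_ext:
  assumes "smooth_map_on (Sn :: ('n::finite) euc set) f"
  shows "smooth_on (- {0}) (\<lambda>x. f (radial x))"
proof (rule smooth_map_on_open)
  show "smooth_map_on (- {0}) (\<lambda>x :: 'n euc. f (radial x))"
    by (rule smooth_map_on_compose[OF smooth_map_on_restrict[OF _ subset_refl smooth_on_radial] _ assms])
       (rule open_nonzero, use radial_Sn in blast)
qed auto

text \<open>Solving needs invertible operators on an open set; precomposition with
  \<open>radial\<close> provides them without leaving the family given on the sphere.\<close>

lemma smooth_map_on_solve_Sn:
  fixes A :: "('n::finite) euc \<Rightarrow> 'e::euclidean_space \<Rightarrow> 'e"
  assumes "\<And>p. p \<in> Sn \<Longrightarrow> linear (A p)" "\<And>p. p \<in> Sn \<Longrightarrow> inj (A p)"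
    "\<And>u. smooth_map_on Sn (\<lambda>p. A p u)" "smooth_map_on Sn b"
  shows "smooth_map_on Sn (\<lambda>p. inv (A p) (b p))"
proof (rule smooth_map_on_cong)
  show "smooth_map_on Sn (\<lambda>p. inv (A (radial p)) (b (radial p)))"
  proof (rule smooth_map_on_restrict)
    show o: "open (- {0 :: 'n euc})" by (rule open_nonzero)
    show "Sn \<subseteq> - {0 :: 'n euc}" using Sn_nonzero by blast
    show "smooth_on (- {0}) (\<lambda>p. inv (A (radial p)) (b (radial p)))"
      by (rule smooth_on_solve[OF o _ _ smooth_on_radial_ext smooth_on_radial_ext])
        (use assms radial_Sn in blast)+
  qed
qed (simp add: radial_id)

lemma linear_inj_surj: "linear f \<Longrightarrow> inj f \<Longrightarrow> surj f" for f :: "'a::euclidean_space \<Rightarrow> 'a"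
  by (rule linear_injective_imp_surjective) simp_all

locale embedding =
  fixes g :: "('n::finite) euc form2" and \<rho> :: real and X :: "'n euc \<Rightarrow> 'n minkowski"
  assumes rho: "\<rho> > 0" and g: "riemannian_metric Sn g" and X: "isometric_embedding g \<rho> X"
begin

sublocale dS: quadric "mink :: 'n minkowski \<Rightarrow> _" "\<rho>\<^sup>2"
  using rho by (intro quadric_mink) simp

abbreviation T where "T \<equiv> tangent_space (Sn :: 'n euc set)"
abbreviation dX where "dX \<equiv> tderiv Sn X"

lemma X_smooth: "smooth_map_on Sn X" and X_image: "X ` Sn \<subseteq> dS.Q"
  using X by (auto simp: isometric_embedding_def smooth_embedding_def de_sitter_def)

lemma X_X: "p \<in> Sn \<Longrightarrow> mink (X p) (X p) = \<rho>\<^sup>2"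
  using X_image by auto

lemma g_eq: "u \<in> T p \<Longrightarrow> v \<in> T p \<Longrightarrow> mink (dX p u) (dX p v) = g p u v"
  using X tangent_space_memD unfolding isometric_embedding_def de_sitter_metric_def by blast

lemma g_pos: "u \<in> T p \<Longrightarrow> u \<noteq> 0 \<Longrightarrow> g p u u > 0"
  using g tangent_space_memD unfolding riemannian_metric_def by blast

lemma X_dX: "v \<in> T p \<Longrightarrow> mink (X p) (dX p v) = 0"
  using tderiv_tangent[OF X_smooth X_image, of v p] dS.tangent_space_Q[of "X p"] X_image tangent_space_memD[of v Sn p]
  by auto

text \<open>The differential of \<open>X\<close>, made meaningful and linear on the whole ambient
  space by projecting its argument first. It kills the radial direction.\<close>

definition J :: "'n euc \<Rightarrow> 'n euc \<Rightarrow> 'n minkowski" where "J p v = dX p (sph.proj v p)"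

lemma J_dX: "v \<in> T p \<Longrightarrow> J p v = dX p v"
  using proj_Sn_id[OF tangent_space_memD[of v Sn p]] by (simp add: J_def)

lemma linear_J: assumes p: "p \<in> Sn" shows "linear (J p)"
proof -
  obtain L where L: "linear L" "\<And>v. v \<in> T p \<Longrightarrow> dX p v = L v"
    using tderiv_on_tangent_linear[OF X_smooth p] by blast
  have "J p = L \<circ> (\<lambda>v. sph.proj v p)" using L(2)[OF proj_Sn_tangent[OF p]] by (auto simp: J_def)
  then show ?thesis using linear_compose[OF linear_proj L(1)] by simp
qed

lemma J_self: "p \<in> Sn \<Longrightarrow> J p p = 0"
  using proj_Sn_self[of p] linear_0[OF linear_J, of p] J_dX[OF subspace_0[OF subspace_tangent_Sn], of p]
  by (simp add: J_def)

lemma J_proj: "p \<in> Sn \<Longrightarrow> J p (sph.proj v p) = J p v"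
  using J_dX[OF proj_Sn_tangent, of p v] by (simp add: J_def)

lemma smooth_J: "smooth_map_on Sn (\<lambda>p. J p v)"
  unfolding J_def by (rule smooth_tderiv_field[OF X_smooth proj_Sn_field])

lemma smooth_J_field:
  assumes "smooth_map_on Sn V"
  shows "smooth_map_on Sn (\<lambda>p. J p (V p))"
proof (rule smooth_map_on_cong)
  show "smooth_map_on Sn (\<lambda>p. \<Sum>b\<in>Basis. (V p \<bullet> b) *\<^sub>R J p b)"
    by (intro smooth_map_on_sum smooth_map_on_scaleR smooth_J smooth_map_on_linear_compose[OF bounded_linear_inner_left assms])
  show "J p (V p) = (\<Sum>b\<in>Basis. (V p \<bullet> b) *\<^sub>R J p b)" if "p \<in> Sn" for p
    by (rule linear_basis_expansion[OF linear_J[OF that]])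
qed

lemma J_X: "p \<in> Sn \<Longrightarrow> mink (X p) (J p v) = 0" "p \<in> Sn \<Longrightarrow> mink (J p v) (X p) = 0"
  using X_dX[OF proj_Sn_tangent] by (simp_all add: J_def mink_commute)

lemma J_J: "u \<in> T p \<Longrightarrow> v \<in> T p \<Longrightarrow> mink (J p u) (J p v) = g p u v"
  by (simp add: J_dX g_eq)

lemma J_zero: assumes "p \<in> Sn" "mink (J p u) (J p u) = 0" shows "sph.proj u p = 0"
  using g_pos[OF proj_Sn_tangent[OF assms(1)], of u] J_J[OF proj_Sn_tangent proj_Sn_tangent, OF assms(1,1), of u u]
    assms J_proj by fastforce

lemma J_nonneg: assumes "p \<in> Sn" shows "mink (J p u) (J p u) \<ge> 0"
proof (cases "sph.proj u p = 0")
  case True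
  then show ?thesis using J_proj[OF assms, of u] linear_0[OF linear_J[OF assms]] by (simp add: dS.B_simps)
next
  case False
  then show ?thesis using g_pos[OF proj_Sn_tangent[OF assms] False] J_J[OF proj_Sn_tangent proj_Sn_tangent, OF assms assms, of u u]
    J_proj[OF assms] by simp
qed

text \<open>The operator of a positive definite form on the ambient space: \<open>g\<close> on
  tangent vectors, completed by (p . u) (p . b) in the radial direction. Being invertible
  everywhere, it can be solved with smooth dependence on \<open>p\<close>.\<close>

definition gram :: "'n euc \<Rightarrow> 'n euc \<Rightarrow> 'n euc" where
  "gram p u = (\<Sum>b\<in>Basis. (mink (J p u) (J p b) + (p \<bullet> u) * (p \<bullet> b)) *\<^sub>R b)"

lemma gram_inner:
  assumes p: "p \<in> Sn"
  shows "gram p u \<bullet> w = mink (J p u) (J p w) + (p \<bullet> u) * (p \<bullet> w)"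
proof -
  have lin: "linear (\<lambda>w. mink (J p u) (J p w) + (p \<bullet> u) * (p \<bullet> w))"
    by (rule linearI) (simp_all add: linear_add[OF linear_J[OF p]] linear_cmul[OF linear_J[OF p]] dS.B_simps
        inner_right_distrib inner_scaleR_right algebra_simps)
  show ?thesis
    unfolding linear_basis_expansion[OF lin, of w]
    by (simp add: gram_def inner_sum_left inner_commute[of w] mult.commute)
qed

lemma linear_gram: assumes p: "p \<in> Sn" shows "linear (gram p)"
proof -
  have "gram p (a *\<^sub>R u + b *\<^sub>R v) \<bullet> w = (a *\<^sub>R gram p u + b *\<^sub>R gram p v) \<bullet> w" for a b u v w
    unfolding inner_left_distrib inner_scaleR_left gram_inner[OF p]
    by (simp add: linear_add[OF linear_J[OF p]] linear_cmul[OF linear_J[OF p]] dS.B_simps inner_simps algebra_simps)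
  then have *: "gram p (a *\<^sub>R u + b *\<^sub>R v) = a *\<^sub>R gram p u + b *\<^sub>R gram p v" for a b u v
    by (metis vector_eq_rdot)
  show ?thesis
    using *[of 1 _ 1] *[of _ _ 0 0] by (intro linearI) simp_all
qed

text \<open>Both summands of the quadratic form are nonnegative. If they vanish, the tangential part
  of \<open>u\<close> is 0 by positivity of \<open>g\<close>, and so is the radial part.\<close>

lemma inj_gram: assumes p: "p \<in> Sn" shows "inj (gram p)"
proof (rule linear_injective_0[OF linear_gram[OF p], THEN iffD2], intro allI impI)
  fix u assume "gram p u = 0"
  then have "mink (J p u) (J p u) + (p \<bullet> u) * (p \<bullet> u) = 0" using gram_inner[OF p, of u u] by simp
  then have "mink (J p u) (J p u) = 0" "p \<bullet> u = 0"
    using J_nonneg[OF p, of u] by (auto simp: add_nonneg_eq_0_iff)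
  then show "u = 0" using J_zero[OF p, of u] by (simp add: sph.proj_def)
qed

text \<open>
  The adjoint of the differential of \<open>X\<close> with respect to \<open>g\<close>: it combines the projection of the
  ambient space to the tangent space of the hypersurface with the inverse of that differential.
\<close>

definition pull :: "'n euc \<Rightarrow> 'n minkowski \<Rightarrow> 'n euc" where
  "pull p \<eta> = inv (gram p) (\<Sum>b\<in>Basis. mink \<eta> (J p b) *\<^sub>R b)"

lemma gram_pull: assumes p: "p \<in> Sn" shows "gram p (pull p \<eta>) \<bullet> w = mink \<eta> (J p w)"
proof -
  have lin: "linear (\<lambda>w. mink \<eta> (J p w))"
    by (rule linearI) (simp_all add: linear_add[OF linear_J[OF p]] linear_cmul[OF linear_J[OF p]] dS.B_simps)
  have "gram p (pull p \<eta>) = (\<Sum>b\<in>Basis. mink \<eta> (J p b) *\<^sub>R b)"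
    unfolding pull_def by (rule surj_f_inv_f[OF linear_inj_surj[OF linear_gram[OF p] inj_gram[OF p]]])
  then show ?thesis
    unfolding linear_basis_expansion[OF lin, of w] by (simp add: inner_sum_left inner_commute[of w] mult.commute)
qed

lemma pull_tangent: assumes p: "p \<in> Sn" shows "pull p \<eta> \<in> T p"
  using gram_pull[OF p, of \<eta> p] gram_inner[OF p, of "pull p \<eta>" p] J_self[OF p] Sn_nonzero[OF p]
  by (simp add: tangent_space_Sn[OF p] dS.B_simps)

lemma J_pull: assumes p: "p \<in> Sn" shows "mink (J p (pull p \<eta>)) (J p w) = mink \<eta> (J p w)"
  using gram_pull[OF p, of \<eta> w] gram_inner[OF p, of "pull p \<eta>" w] pull_tangent[OF p, of \<eta>]
  by (simp add: tangent_space_Sn[OF p])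

lemma g_pull: "p \<in> Sn \<Longrightarrow> w \<in> T p \<Longrightarrow> g p (pull p \<eta>) w = mink \<eta> (J p w)"
  using J_pull J_J[OF pull_tangent] by metis

lemma pull_unique:
  assumes u: "u \<in> T p" and "\<And>w. w \<in> T p \<Longrightarrow> g p u w = mink \<eta> (J p w)"
  shows "pull p \<eta> = u"
proof -
  have p: "p \<in> Sn" by (rule tangent_space_memD[OF u])
  have t: "pull p \<eta> - u \<in> T p" by (intro subspace_diff subspace_tangent_Sn p pull_tangent u)
  have "g p (pull p \<eta> - u) (pull p \<eta> - u) = mink (J p (pull p \<eta>)) (J p (pull p \<eta> - u)) - mink (J p u) (J p (pull p \<eta> - u))"
    unfolding J_J[OF t t, symmetric]
    by (simp only: linear_diff[OF linear_J[OF p], of "pull p \<eta>" u] dS.B_simps(3))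
  also have "\<dots> = 0" using assms(2)[OF t] J_pull[OF p] J_J[OF u t] by simp
  finally show ?thesis using g_pos[OF t] by force
qed

lemma pull_J: "u \<in> T p \<Longrightarrow> pull p (J p u) = u"
  by (rule pull_unique) (simp_all add: J_J)

lemma linear_pull: assumes p: "p \<in> Sn" shows "linear (pull p)"
proof -
  have gl: "linear (inv (gram p))" using inj_linear_imp_inv_linear[OF linear_gram[OF p] inj_gram[OF p]] .
  have "linear (\<lambda>\<eta>. \<Sum>b\<in>Basis. mink \<eta> (J p b) *\<^sub>R b)"
    by (rule linearI) (simp_all add: dS.B_simps scaleR_left_distrib sum.distrib scaleR_sum_right)
  from linear_compose[OF this gl] show ?thesis by (simp add: pull_def[abs_def] o_def)
qed

lemma smooth_gram: "smooth_map_on Sn (\<lambda>p. gram p u)"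
  unfolding gram_def
  by (intro smooth_map_on_sum smooth_map_on_scaleR smooth_map_on_const smooth_map_on_add
      dS.smooth_map_on_B smooth_J smooth_map_on_mult smooth_map_on_linear_compose[OF bounded_linear_inner_left]
      smooth_map_on_id)

lemma smooth_pull:
  assumes Y: "smooth_map_on Sn Y"
  shows "smooth_map_on Sn (\<lambda>p. pull p (Y p))"
  unfolding pull_def
proof (rule smooth_map_on_solve_Sn[OF linear_gram inj_gram])
  show "smooth_map_on Sn (\<lambda>p. gram p u)" for u by (rule smooth_gram)
  show "smooth_map_on Sn (\<lambda>p. \<Sum>b\<in>Basis. mink (Y p) (J p b) *\<^sub>R b)"
    by (intro smooth_map_on_sum smooth_map_on_scaleR smooth_map_on_const dS.smooth_map_on_B smooth_J Y)
qed

subsection \<open>The unit normal\<close>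

text \<open>The component of \<open>E0\<close> orthogonal to \<open>X p\<close> and to the
  hypersurface, an explicit and smooth choice of normal direction.\<close>

definition nrm :: "'n euc \<Rightarrow> 'n minkowski" where
  "nrm p = E0 - (mink (X p) E0 / \<rho>\<^sup>2) *\<^sub>R X p - J p (pull p E0)"

lemma smooth_nrm: "smooth_map_on Sn nrm"
  unfolding nrm_def[abs_def]
  by (intro smooth_map_on_diff smooth_map_on_const dS.smooth_map_on_B_scaleR X_smooth smooth_J_field smooth_pull)

lemma nrm_X: "p \<in> Sn \<Longrightarrow> mink (nrm p) (X p) = 0"
  using rho by (simp add: nrm_def dS.B_simps X_X J_X mink_commute[of E0])

lemma nrm_J: "p \<in> Sn \<Longrightarrow> mink (nrm p) (J p w) = 0"
  by (simp add: nrm_def dS.B_simps J_X J_pull)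

lemma nrm_nrm: assumes p: "p \<in> Sn" shows "mink (nrm p) (nrm p) = mink (nrm p) E0"
proof -
  have "mink (nrm p) (nrm p) = mink (nrm p) (E0 - (mink (X p) E0 / \<rho>\<^sup>2) *\<^sub>R X p - J p (pull p E0))"
    by (simp only: nrm_def)
  then show ?thesis by (simp add: dS.B_simps nrm_X[OF p] nrm_J[OF p])
qed

text \<open>\<open>E0\<close> has square -1, and the two components removed from it are spacelike,
  so what remains is at least as timelike. In particular \<open>nrm\<close> never vanishes and can
  be normalized.\<close>

lemma nrm_E0: assumes p: "p \<in> Sn" shows "mink (nrm p) E0 \<le> -1"
proof -
  have 1: "mink (J p (pull p E0)) E0 = mink (J p (pull p E0)) (J p (pull p E0))"
    using J_pull[OF p, of E0 "pull p E0"] by (simp add: mink_commute)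
  have 2: "mink E0 (E0 :: 'n minkowski) = -1" by (simp add: mink_def E0_def)
  have "mink (nrm p) E0 = -1 - mink (X p) E0 * mink (X p) E0 / \<rho>\<^sup>2 - mink (J p (pull p E0)) (J p (pull p E0))"
    by (simp add: nrm_def dS.B_simps 1 2)
  moreover have "mink (X p) E0 * mink (X p) E0 / \<rho>\<^sup>2 \<ge> 0" by (intro divide_nonneg_nonneg) auto
  ultimately show ?thesis using J_nonneg[OF p, of "pull p E0"] by linarith
qed

text \<open>\<open>nrm\<close> has negative product with \<open>E0\<close>; the minus sign makes the
  normal downward pointing.\<close>

definition nu :: "'n euc \<Rightarrow> 'n minkowski" where
  "nu p = (- inverse (sqrt (- mink (nrm p) (nrm p)))) *\<^sub>R nrm p"

lemma smooth_nu: "smooth_map_on Sn nu"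
proof -
  have "smooth_map_on Sn (\<lambda>p. - mink (nrm p) (nrm p))"
    by (intro smooth_map_on_minus dS.smooth_map_on_B smooth_nrm)
  moreover have "- mink (nrm p) (nrm p) > 0" if "p \<in> Sn" for p
    using nrm_nrm[OF that] nrm_E0[OF that] by simp
  moreover have "smooth_on {0<..} (\<lambda>x. inverse (sqrt x))"
    by (intro smooth_on_inverse smooth_on_sqrt smooth_on_id) auto
  ultimately have "smooth_map_on Sn (\<lambda>p. inverse (sqrt (- mink (nrm p) (nrm p))))"
    by (intro smooth_map_on_compose_smooth[where W = "{0<..}" and h = "\<lambda>x. inverse (sqrt x)"]) auto
  then show ?thesis unfolding nu_def[abs_def]
    by (intro smooth_map_on_scaleR smooth_map_on_minus smooth_nrm)
qed

lemma nu_X: "p \<in> Sn \<Longrightarrow> mink (nu p) (X p) = 0" "p \<in> Sn \<Longrightarrow> mink (X p) (nu p) = 0"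
  using nrm_X[of p] mink_commute[of "X p"] by (simp_all add: nu_def dS.B_simps)

lemma nu_J: "p \<in> Sn \<Longrightarrow> mink (nu p) (J p w) = 0" "p \<in> Sn \<Longrightarrow> mink (J p w) (nu p) = 0"
  using nrm_J[of p w] mink_commute[of "J p w"] by (simp_all add: nu_def dS.B_simps)

lemma nu_nu: assumes "p \<in> Sn" shows "mink (nu p) (nu p) = -1"
proof -
  let ?m = "- mink (nrm p) (nrm p)"
  have m: "?m > 0" using nrm_nrm[OF assms] nrm_E0[OF assms] by simp
  have "mink (nu p) (nu p) = inverse (sqrt ?m) * inverse (sqrt ?m) * mink (nrm p) (nrm p)"
    by (simp add: nu_def dS.B_simps)
  also have "inverse (sqrt ?m) * inverse (sqrt ?m) = inverse ?m"
    using m by (simp only: inverse_mult_distrib[symmetric] real_sqrt_mult_self abs_of_pos)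
  finally show ?thesis using m by (simp add: field_simps)
qed

lemma nu_E0: assumes "p \<in> Sn" shows "mink (nu p) E0 > 0"
proof -
  have "mink (nu p) E0 = inverse (sqrt (- mink (nrm p) (nrm p))) * (- mink (nrm p) E0)"
    by (simp add: nu_def dS.B_simps)
  also have "\<dots> > 0" using nrm_nrm[OF assms] nrm_E0[OF assms]
    by (intro mult_pos_pos) auto
  finally show ?thesis .
qed

lemma orthogonal_zero:
  assumes p: "p \<in> Sn" and z: "mink z (X p) = 0" "mink z (nu p) = 0" "\<And>w. w \<in> T p \<Longrightarrow> mink z (J p w) = 0"
  shows "z = 0"
proof -
  \<comment> \<open>\<open>L\<close> assembles the tangent directions, \<open>X p\<close> and
    \<open>nu p\<close>. Since \<open>J p\<close> ignores the radial part of \<open>fst w\<close>,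
    that coordinate is free to multiply \<open>X p\<close>, which makes \<open>L\<close> an
    endomorphism; injectivity then yields surjectivity.\<close>
  define L :: "'n minkowski \<Rightarrow> 'n minkowski"
    where "L = (\<lambda>w. J p (fst w) + (p \<bullet> fst w) *\<^sub>R X p + snd w *\<^sub>R nu p)"
  have lin: "linear L" unfolding L_def
    by (rule linearI) (simp_all add: linear_add[OF linear_J[OF p]] linear_cmul[OF linear_J[OF p]] inner_simps algebra_simps)
  have "inj L"
  proof (rule linear_injective_0[OF lin, THEN iffD2], intro allI impI)
    fix w assume w: "L w = 0"
    have "mink (L w) (nu p) = - snd w" "mink (L w) (X p) = (p \<bullet> fst w) * \<rho>\<^sup>2"
      "mink (L w) (J p (fst w)) = mink (J p (fst w)) (J p (fst w))"
      unfolding L_def using p by (simp_all add: dS.B_simps J_X nu_X nu_J nu_nu X_X)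
    then have "snd w = 0" "p \<bullet> fst w = 0" "sph.proj (fst w) p = 0"
      using w rho J_zero[OF p, of "fst w"] by (simp_all add: dS.B_simps)
    then show "w = 0" by (simp add: sph.proj_def prod_eq_iff)
  qed
  then have sj: "surj L" by (rule linear_inj_surj[OF lin])
  have "mink z (L w) = 0" for w
    unfolding L_def using z(1,2) z(3)[OF proj_Sn_tangent[OF p], of "fst w"]
    by (simp add: dS.B_simps J_proj[OF p])
  then have "mink z y = 0" for y using sj by (metis surjD)
  then show ?thesis by (rule dS.nondegenerate)
qed

text \<open>The coefficients come from the squares \<open>\<rho>\<^sup>2\<close> of
  \<open>X p\<close> and -1 of \<open>nu p\<close>; the latter explains the minus sign.\<close>

lemma decomposition:
  assumes p: "p \<in> Sn"
  shows "\<eta> = J p (pull p \<eta>) + (mink \<eta> (X p) / \<rho>\<^sup>2) *\<^sub>R X p - mink \<eta> (nu p) *\<^sub>R nu p"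
proof -
  have "\<eta> - (J p (pull p \<eta>) + (mink \<eta> (X p) / \<rho>\<^sup>2) *\<^sub>R X p - mink \<eta> (nu p) *\<^sub>R nu p) = 0"
    using p rho by (intro orthogonal_zero[OF p]) (simp_all add: dS.B_simps J_X nu_X nu_J nu_nu X_X J_pull)
  then show ?thesis by simp
qed

lemma unit_normal_eq: assumes p: "p \<in> Sn" shows "unit_normal \<rho> X p = nu p"
  unfolding unit_normal_def de_sitter_metric_def
proof (rule the_equality)
  have XQ: "X p \<in> dS.Q" using X_image p by auto
  have ts: "tangent_space (de_sitter \<rho>) (X p) = {v. mink (X p) v = 0}"
    using dS.tangent_space_Q[OF XQ] by (simp add: de_sitter_def)
  show "nu p \<in> tangent_space (de_sitter \<rho>) (X p) \<and> (\<forall>v\<in>T p. mink (nu p) (dX p v) = 0) \<and>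
      mink (nu p) (nu p) = - 1 \<and> 0 < mink (nu p) E0"
    using p nu_J(1)[OF p] by (simp add: ts nu_X nu_nu nu_E0 flip: J_dX)
  fix m assume m: "m \<in> tangent_space (de_sitter \<rho>) (X p) \<and> (\<forall>v\<in>T p. mink m (dX p v) = 0) \<and>
      mink m m = - 1 \<and> 0 < mink m E0"
  then have mX: "mink m (X p) = 0" by (simp add: ts mink_commute)
  have "pull p m = 0"
  proof (rule pull_unique[OF subspace_0[OF subspace_tangent_Sn[OF p]]])
    fix w assume w: "w \<in> T p"
    show "g p 0 w = mink m (J p w)"
      unfolding J_J[OF subspace_0[OF subspace_tangent_Sn[OF p]] w, symmetric]
      using m w by (simp add: linear_0[OF linear_J[OF p]] dS.B_simps J_dX[OF w])
  qed
  then have mc: "m = (- mink m (nu p)) *\<^sub>R nu p"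
    using decomposition[OF p, of m] mX linear_0[OF linear_J[OF p]] by simp
  define c where "c = - mink m (nu p)"
  have mc: "m = c *\<^sub>R nu p" using mc by (simp add: c_def)
  have "mink m m = - (c * c)" unfolding mc by (simp add: dS.B_simps nu_nu[OF p])
  then have "c * c = 1" using m by simp
  moreover have "c * mink (nu p) E0 > 0" using m unfolding mc by (simp add: dS.B_simps)
  then have "c > 0" using nu_E0[OF p] by (simp add: zero_less_mult_iff)
  ultimately have "c = 1" by (metis abs_of_pos real_sqrt_mult_self real_sqrt_one real_sqrt_abs2)
  then show "m = nu p" using mc by simp
qed

end

subsection \<open>The equations of Gauss and Weingarten\<close>

lemma tderiv_const_on:
  assumes "v \<in> tangent_space M p" "\<And>q. q \<in> M \<Longrightarrow> f q = c"
  shows "tderiv M f p v = 0"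
proof -
  have "tderiv M f p v = tderiv M (\<lambda>x. c) p v" by (rule tderiv_cong[OF smooth_map_on_const assms])
  then show ?thesis by (simp only: tderiv_const[OF assms(1)])
qed

context embedding
begin

lemma g_lin:
  assumes "u \<in> T p" "v \<in> T p" "w \<in> T p"
  shows "g p (u + v) w = g p u w + g p v w" "g p (u - v) w = g p u w - g p v w"
    "g p (a *\<^sub>R u) w = a * g p u w" "g p (- u) w = - g p u w"
proof -
  have p: "p \<in> Sn" by (rule tangent_space_memD[OF assms(1)])
  note l = linear_J[OF p] and s = subspace_tangent_Sn[OF p]
  show "g p (u + v) w = g p u w + g p v w" "g p (u - v) w = g p u w - g p v w"
    "g p (a *\<^sub>R u) w = a * g p u w" "g p (- u) w = - g p u w"
    using assms s
    by (simp_all add: J_J[symmetric] subspace_add subspace_diff subspace_scale subspace_neg linear_add[OF l]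
        linear_diff[OF l] linear_cmul[OF l] linear_neg[OF l] dS.B_simps)
qed

lemma g_sym: "u \<in> T p \<Longrightarrow> v \<in> T p \<Longrightarrow> g p u v = g p v u"
  using J_J mink_commute by metis

lemma g_zero: "u \<in> T p \<Longrightarrow> (\<And>w. w \<in> T p \<Longrightarrow> g p u w = 0) \<Longrightarrow> u = 0"
  by (metis g_pos less_irrefl)

abbreviation DX where "DX W \<equiv> (\<lambda>q. J q (W q))"

lemma smooth_DX: "W \<in> vector_fields Sn \<Longrightarrow> smooth_map_on Sn (DX W)"
  by (rule smooth_J_field[OF vector_fieldsD(1)])

text \<open>The derivative in Minkowski space of the pushed-forward field, projected back to the
  sphere. This provides existence of the Levi-Civita connection of \<open>g\<close>, and with it the
  meaning of the choice in \<open>levi_civita\<close>.\<close>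

definition lc :: "('n euc \<Rightarrow> 'n euc) \<Rightarrow> ('n euc \<Rightarrow> 'n euc) \<Rightarrow> 'n euc \<Rightarrow> 'n euc" where
  "lc V W p = pull p (tderiv Sn (DX W) p (V p))"

lemma lc_field: "V \<in> vector_fields Sn \<Longrightarrow> W \<in> vector_fields Sn \<Longrightarrow> lc V W \<in> vector_fields Sn"
  unfolding lc_def
  by (rule vector_fieldsI) (simp_all add: smooth_pull smooth_tderiv_field smooth_DX pull_tangent)

lemma g_lc:
  "p \<in> Sn \<Longrightarrow> w \<in> T p \<Longrightarrow> g p (lc V W p) w = mink (tderiv Sn (DX W) p (V p)) (J p w)"
  unfolding lc_def by (rule g_pull)

lemma connection_along_lc: "connection_along Sn Sn (\<lambda>p. p) lc"
  unfolding connection_along_def vector_fields_def[symmetric]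
proof (intro conjI ballI allI impI)
  fix V W Y :: "'n euc \<Rightarrow> 'n euc" and p :: "'n euc" and f :: "'n euc \<Rightarrow> real"
  assume V: "V \<in> vector_fields Sn" and W: "W \<in> vector_fields Sn" and Y: "Y \<in> vector_fields Sn" and p: "p \<in> Sn"
  obtain L where L: "linear L" "\<And>v. v \<in> T p \<Longrightarrow> tderiv Sn (DX Y) p v = L v"
    using tderiv_on_tangent_linear[OF smooth_DX[OF Y] p] by blast
  note v = vector_fieldsD(2)[OF V p] and w = vector_fieldsD(2)[OF W p]
  have fvw: "f p *\<^sub>R V p + W p \<in> T p"
    using v w subspace_tangent_Sn[OF p] by (intro subspace_add subspace_scale)
  show "lc (\<lambda>q. f q *\<^sub>R V q + W q) Y p = f p *\<^sub>R lc V Y p + lc W Y p"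
    unfolding lc_def L(2)[OF v] L(2)[OF w] L(2)[OF fvw]
    by (simp add: linear_add[OF L(1)] linear_cmul[OF L(1)] linear_add[OF linear_pull[OF p]] linear_cmul[OF linear_pull[OF p]])
next
  fix V Y Z :: "'n euc \<Rightarrow> 'n euc" and p :: "'n euc"
  assume V: "V \<in> vector_fields Sn" and Y: "Y \<in> vector_fields Sn" and Z: "Z \<in> vector_fields Sn" and p: "p \<in> Sn"
  note v = vector_fieldsD(2)[OF V p]
  have "tderiv Sn (DX (\<lambda>q. Y q + Z q)) p (V p) = tderiv Sn (\<lambda>q. J q (Y q) + J q (Z q)) p (V p)"
    by (rule tderiv_cong[OF smooth_map_on_add[OF smooth_DX[OF Y] smooth_DX[OF Z]] v]) (simp add: linear_add[OF linear_J])
  then show "lc V (\<lambda>q. Y q + Z q) p = lc V Y p + lc V Z p"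
    unfolding lc_def by (simp add: tderiv_add[OF smooth_DX[OF Y] smooth_DX[OF Z] v] linear_add[OF linear_pull[OF p]])
next
  fix V Y :: "'n euc \<Rightarrow> 'n euc" and p :: "'n euc" and f :: "'n euc \<Rightarrow> real"
  assume V: "V \<in> vector_fields Sn" and Y: "Y \<in> vector_fields Sn" and f: "smooth_map_on Sn f" and p: "p \<in> Sn"
  note v = vector_fieldsD(2)[OF V p]
  have "tderiv Sn (DX (\<lambda>q. f q *\<^sub>R Y q)) p (V p) = tderiv Sn (\<lambda>q. f q *\<^sub>R J q (Y q)) p (V p)"
    by (rule tderiv_cong[OF smooth_map_on_scaleR[OF f smooth_DX[OF Y]] v]) (simp add: linear_cmul[OF linear_J])
  also have "\<dots> = f p *\<^sub>R tderiv Sn (DX Y) p (V p) + tderiv Sn f p (V p) *\<^sub>R J p (Y p)"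
    by (rule tderiv_scaleR[OF f smooth_DX[OF Y] v])
  finally show "lc V (\<lambda>q. f q *\<^sub>R Y q) p = tderiv Sn f p (V p) *\<^sub>R Y p + f p *\<^sub>R lc V Y p"
    unfolding lc_def
    by (simp add: linear_add[OF linear_pull[OF p]] linear_cmul[OF linear_pull[OF p]] pull_J[OF vector_fieldsD(2)[OF Y p]])
qed (rule lc_field)

lemma tderiv_DX_commutator:
  assumes V: "V \<in> vector_fields Sn" and W: "W \<in> vector_fields Sn" and p: "p \<in> Sn"
  shows "tderiv Sn (DX W) p (V p) - tderiv Sn (DX V) p (W p) = J p (lie_bracket Sn V W p)"
proof -
  note lie = vector_fieldsD(2)[OF lie_bracket_Sn[OF V W] p]
  have "tderiv Sn (DX Y) p v = tderiv Sn (\<lambda>q. dX q (Y q)) p v"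
    if "Y \<in> vector_fields Sn" "v \<in> T p" for Y v
    by (rule tderiv_cong[OF smooth_tderiv_field[OF X_smooth that(1)] that(2)])
       (simp add: J_dX[OF vector_fieldsD(2)[OF that(1)]])
  then show ?thesis
    using tderiv_commutator[OF X_smooth V W p lie] vector_fieldsD(2)[OF V p] vector_fieldsD(2)[OF W p]
    by (simp add: V W J_dX[OF lie])
qed

lemma is_levi_civita_lc: "is_levi_civita Sn g lc"
  unfolding is_levi_civita_def
proof (intro conjI ballI connection_along_lc)
  fix V W :: "'n euc \<Rightarrow> 'n euc" and p :: "'n euc"
  assume V: "V \<in> vector_fields Sn" and W: "W \<in> vector_fields Sn" and p: "p \<in> Sn"
  show "lc V W p - lc W V p = lie_bracket Sn V W p"
    unfolding lc_def linear_diff[OF linear_pull[OF p], symmetric] tderiv_DX_commutator[OF V W p]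
    by (rule pull_J[OF vector_fieldsD(2)[OF lie_bracket_Sn[OF V W] p]])
next
  fix U V W :: "'n euc \<Rightarrow> 'n euc" and p :: "'n euc"
  assume U: "U \<in> vector_fields Sn" and V: "V \<in> vector_fields Sn" and W: "W \<in> vector_fields Sn"
    and p: "p \<in> (Sn :: 'n euc set)"
  note u = vector_fieldsD(2)[OF U p] and v = vector_fieldsD(2)[OF V p] and w = vector_fieldsD(2)[OF W p]
  have "tderiv Sn (\<lambda>q. g q (V q) (W q)) p (U p) = tderiv Sn (\<lambda>q. mink (J q (V q)) (J q (W q))) p (U p)"
    by (rule tderiv_cong[OF dS.smooth_map_on_B[OF smooth_DX[OF V] smooth_DX[OF W]] u])
       (simp add: J_J[OF vector_fieldsD(2)[OF V] vector_fieldsD(2)[OF W]])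
  also have "\<dots> = mink (J p (V p)) (tderiv Sn (DX W) p (U p)) + mink (tderiv Sn (DX V) p (U p)) (J p (W p))"
    by (rule tderiv_bilinear[OF bounded_bilinear_mink smooth_DX[OF V] smooth_DX[OF W] u])
  also have "\<dots> = g p (lc U V p) (W p) + g p (lc U W p) (V p)"
    unfolding g_lc[OF p w] g_lc[OF p v] by (simp add: mink_commute)
  also have "g p (lc U W p) (V p) = g p (V p) (lc U W p)"
    by (rule g_sym[OF vector_fieldsD(2)[OF lc_field[OF U W] p] v])
  finally show "tderiv Sn (\<lambda>q. g q (V q) (W q)) p (U p) = g p (lc U V p) (W p) + g p (V p) (lc U W p)" .
qed

lemma is_levi_civita_levi_civita: "is_levi_civita Sn g (levi_civita Sn g)"
  unfolding levi_civita_def by (rule someI[of _ lc], rule is_levi_civita_lc)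

lemma levi_civita_eq:
  assumes "V \<in> vector_fields Sn" "W \<in> vector_fields Sn" "p \<in> Sn"
  shows "levi_civita Sn g V W p = lc V W p"
  by (rule levi_civita_unique[OF is_levi_civita_levi_civita is_levi_civita_lc _ subspace_tangent_Sn g_sym g_lin(2) g_zero assms])
     (use ext_field_Sn in blast)

text \<open>\<open>levi_civita\<close> and \<open>lc\<close> are known to agree only on
  \<open>Sn\<close>; this permits exchanging one for the other inside a second covariant
  derivative.\<close>

lemma lc_cong:
  assumes "V \<in> vector_fields Sn" "W \<in> vector_fields Sn" "p \<in> Sn" "\<And>q. q \<in> Sn \<Longrightarrow> W' q = W q"
  shows "lc V W' p = lc V W p"
  unfolding lc_def
  using tderiv_cong[OF smooth_DX[OF assms(2)] vector_fieldsD(2)[OF assms(1,3)], of "DX W'"] assms(4) by simp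

text \<open>The sign matches A(u, v) = -<D_u nu, v>. As an endomorphism of the ambient space it has
  tangential values and kills \<open>p\<close>, so its ambient trace equals its trace on the tangent
  space.\<close>

definition shape :: "'n euc \<Rightarrow> 'n euc \<Rightarrow> 'n euc" where
  "shape p u = - pull p (tderiv Sn nu p (sph.proj u p))"

lemma linear_shape: assumes p: "p \<in> Sn" shows "linear (shape p)"
proof -
  obtain L where L: "linear L" "\<And>v. v \<in> T p \<Longrightarrow> tderiv Sn nu p v = L v"
    using tderiv_on_tangent_linear[OF smooth_nu p] by blast
  have "shape p = (\<lambda>u. - pull p (L (sph.proj u p)))" using L(2)[OF proj_Sn_tangent[OF p]] by (simp add: shape_def[abs_def])
  moreover have "linear (\<lambda>u. - pull p (L (sph.proj u p)))"
    by (rule linearI) (simp_all add: linear_add[OF linear_proj] linear_cmul[OF linear_proj] linear_add[OF L(1)]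
        linear_cmul[OF L(1)] linear_add[OF linear_pull[OF p]] linear_cmul[OF linear_pull[OF p]])
  ultimately show ?thesis by simp
qed

lemma shape_tangent: "p \<in> Sn \<Longrightarrow> shape p u \<in> T p"
  unfolding shape_def by (intro subspace_neg subspace_tangent_Sn pull_tangent)

lemma shape_self: "p \<in> Sn \<Longrightarrow> shape p p = 0"
  using linear_0[OF linear_shape, of p] linear_0[OF linear_proj, of p] by (simp add: shape_def proj_Sn_self)

lemma smooth_shape:
  assumes V: "smooth_map_on Sn V"
  shows "smooth_map_on Sn (\<lambda>p. shape p (V p))"
proof (rule smooth_map_on_cong)
  show "smooth_map_on Sn (\<lambda>p. \<Sum>b\<in>Basis. (V p \<bullet> b) *\<^sub>R shape p b)"
    unfolding shape_def
    by (intro smooth_map_on_sum smooth_map_on_scaleR smooth_map_on_linear_compose[OF bounded_linear_inner_left V]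
        smooth_map_on_minus smooth_pull smooth_tderiv_field smooth_nu proj_Sn_field)
  show "shape p (V p) = (\<Sum>b\<in>Basis. (V p \<bullet> b) *\<^sub>R shape p b)" if "p \<in> Sn" for p
    by (rule linear_basis_expansion[OF linear_shape[OF that]])
qed

text \<open>Differentiating the constant products of \<open>nu\<close> with itself and with
  \<open>X\<close> shows that the derivative of \<open>nu\<close> has neither a component along
  \<open>nu\<close> nor one along \<open>X\<close>.\<close>

lemma weingarten:
  assumes v: "v \<in> T p"
  shows "tderiv Sn nu p v = - J p (shape p v)"
proof -
  have p: "p \<in> Sn" by (rule tangent_space_memD[OF v])
  have "tderiv Sn (\<lambda>q. mink (nu q) (nu q)) p v = 0" by (rule tderiv_const_on[OF v nu_nu])
  then have 1: "mink (tderiv Sn nu p v) (nu p) = 0"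
    by (simp add: tderiv_bilinear[OF bounded_bilinear_mink smooth_nu smooth_nu v] mink_commute)
  have "tderiv Sn (\<lambda>q. mink (nu q) (X q)) p v = 0" by (rule tderiv_const_on[OF v nu_X(1)])
  then have 2: "mink (tderiv Sn nu p v) (X p) = 0"
    using nu_J(1)[OF p, of v] by (simp add: tderiv_bilinear[OF bounded_bilinear_mink smooth_nu X_smooth v] J_dX[OF v])
  have "tderiv Sn nu p v = J p (pull p (tderiv Sn nu p v))"
    using decomposition[OF p, of "tderiv Sn nu p v"] by (simp add: 1 2)
  then show ?thesis by (simp add: shape_def proj_Sn_id[OF p v] linear_neg[OF linear_J[OF p]])
qed

lemma second_derivative:
  assumes W: "W \<in> vector_fields Sn" and v: "v \<in> T p"
  shows "mink (tderiv Sn (DX W) p v) (X p) = - mink (J p v) (J p (W p))"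
    and "mink (tderiv Sn (DX W) p v) (nu p) = g p (shape p v) (W p)"
proof -
  have p: "p \<in> Sn" by (rule tangent_space_memD[OF v])
  have "tderiv Sn (\<lambda>q. mink (J q (W q)) (X q)) p v = 0" by (rule tderiv_const_on[OF v J_X(2)])
  then show "mink (tderiv Sn (DX W) p v) (X p) = - mink (J p v) (J p (W p))"
    unfolding tderiv_bilinear[OF bounded_bilinear_mink smooth_DX[OF W] X_smooth v] J_dX[OF v]
    by (simp add: mink_commute[of "J p (W p)"])
  have "tderiv Sn (\<lambda>q. mink (J q (W q)) (nu q)) p v = 0" by (rule tderiv_const_on[OF v nu_J(2)])
  then have "mink (tderiv Sn (DX W) p v) (nu p) = mink (J p (shape p v)) (J p (W p))"
    unfolding tderiv_bilinear[OF bounded_bilinear_mink smooth_DX[OF W] smooth_nu v] weingarten[OF v]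
    by (simp add: dS.B_simps mink_commute[of "J p (W p)"])
  then show "mink (tderiv Sn (DX W) p v) (nu p) = g p (shape p v) (W p)"
    by (simp add: J_J[OF shape_tangent[OF p] vector_fieldsD(2)[OF W p]])
qed

lemma gauss_formula:
  assumes V: "V \<in> vector_fields Sn" and W: "W \<in> vector_fields Sn" and p: "p \<in> Sn"
  shows "J p (lc V W p) = tderiv Sn (DX W) p (V p) + (mink (J p (V p)) (J p (W p)) / \<rho>\<^sup>2) *\<^sub>R X p
    + mink (tderiv Sn (DX W) p (V p)) (nu p) *\<^sub>R nu p"
  using decomposition[OF p, of "tderiv Sn (DX W) p (V p)"] second_derivative(1)[OF W vector_fieldsD(2)[OF V p]]
  unfolding lc_def by (simp add: algebra_simps)

text \<open>By \<open>second_derivative\<close> both sides are \<open>nu\<close>-components of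
  derivatives of pushed-forward fields. Their difference is the component of a pushed-forward
  bracket, which is tangential.\<close>

lemma shape_sym:
  assumes u: "u \<in> T p" and v: "v \<in> T p"
  shows "g p (shape p u) v = g p (shape p v) u"
proof -
  have p: "p \<in> Sn" by (rule tangent_space_memD[OF u])
  note U = ext_field_Sn[OF p u] and V = ext_field_Sn[OF p v]
  have "mink (tderiv Sn (DX (ext_field Sn p v)) p u) (nu p) - mink (tderiv Sn (DX (ext_field Sn p u)) p v) (nu p) = 0"
    using tderiv_DX_commutator[OF U(1) V(1) p] nu_J(2)[OF p]
    unfolding U(2) V(2) dS.B_simps(3)[symmetric] by simp
  then show ?thesis using second_derivative(2)[OF U(1) v] second_derivative(2)[OF V(1) u] by (simp add: U(2) V(2))
qed

text \<open>All choices in the definition are resolved here: the connections by their explicit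
  formulas, the normal by \<open>nu\<close>, and \<open>THE a\<close> because \<open>nu p\<close> is
  not 0.\<close>

lemma second_fundamental_form_eq:
  assumes u: "u \<in> T p" and v: "v \<in> T p"
  shows "second_fundamental_form g \<rho> X p u v = g p (shape p u) v"
proof -
  have p: "p \<in> Sn" by (rule tangent_space_memD[OF u])
  define V W where "V = ext_field Sn p u" and "W = ext_field Sn p v"
  have V: "V \<in> vector_fields Sn" "V p = u" and W: "W \<in> vector_fields Sn" "W p = v"
    using ext_field_Sn[OF p u] ext_field_Sn[OF p v] by (auto simp: V_def W_def)
  let ?Y = "\<lambda>q. dX q (W q)"
  have Y: "?Y \<in> fields_along Sn dS.Q X"
    using tderiv_tangent[OF X_smooth X_image vector_fieldsD(2)[OF W(1)]]
    by (intro fields_alongI smooth_tderiv_field X_smooth W(1)) auto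
  have YD: "tderiv Sn ?Y p u = tderiv Sn (DX W) p u"
    by (rule tderiv_cong[OF smooth_DX[OF W(1)] u]) (simp add: J_dX[OF vector_fieldsD(2)[OF W(1)]])
  have "pullback_connection Sn (de_sitter \<rho>) de_sitter_metric X V ?Y p = dS.conn Sn X V ?Y p"
    using dS.pullback_connection_Q[OF X_smooth X_image subspace_tangent_Sn V(1) Y p]
    by (simp add: de_sitter_def de_sitter_metric_def[abs_def])
  also have "\<dots> = tderiv Sn (DX W) p u + (mink (J p u) (J p v) / \<rho>\<^sup>2) *\<^sub>R X p"
    unfolding dS.conn_def V(2) W(2) YD by (simp add: J_dX u v)
  also have "\<dots> = J p (lc V W p) - g p (shape p u) v *\<^sub>R nu p"
    using gauss_formula[OF V(1) W(1) p] second_derivative(2)[OF W(1) u] by (simp add: V(2) W(2))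
  also have "J p (lc V W p) = dX p (levi_civita Sn g V W p)"
    by (simp add: levi_civita_eq[OF V(1) W(1) p] J_dX[OF vector_fieldsD(2)[OF lc_field[OF V(1) W(1)] p]])
  finally have eq: "pullback_connection Sn (de_sitter \<rho>) de_sitter_metric X V ?Y p
      = dX p (levi_civita Sn g V W p) - g p (shape p u) v *\<^sub>R unit_normal \<rho> X p"
    by (simp add: unit_normal_eq[OF p])
  have "nu p \<noteq> 0" using nu_nu[OF p] by (auto simp: dS.B_simps)
  then show ?thesis
    unfolding second_fundamental_form_def Let_def V_def[symmetric] W_def[symmetric] eq
    by (intro the_equality) (auto simp: unit_normal_eq[OF p])
qed

text \<open>Differentiating the Gauss formula, the multiple of \<open>X\<close> contributes the
  ambient curvature \<open>1 / \<rho>\<^sup>2\<close> and the multiple of \<open>nu\<close> a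
  product of shape operators. The remaining flat second derivative enters the curvature only through
  its commutator.\<close>

lemma lc_lc:
  assumes U: "U \<in> vector_fields Sn" and V: "V \<in> vector_fields Sn" and W: "W \<in> vector_fields Sn" and z: "z \<in> T p"
  shows "g p (lc U (lc V W) p) z = mink (tderiv Sn (\<lambda>q. tderiv Sn (DX W) q (V q)) p (U p)) (J p z)
    + g p (V p) (W p) * g p (U p) z / \<rho>\<^sup>2 - g p (shape p (V p)) (W p) * g p (shape p (U p)) z"
proof -
  have p: "p \<in> Sn" by (rule tangent_space_memD[OF z])
  note u = vector_fieldsD(2)[OF U p] and v = vector_fieldsD(2)[OF V p] and w = vector_fieldsD(2)[OF W p]
  define D where "D = (\<lambda>q. tderiv Sn (DX W) q (V q))"
  define a where "a = (\<lambda>q. mink (J q (V q)) (J q (W q)) / \<rho>\<^sup>2)"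
  define b where "b = (\<lambda>q. mink (D q) (nu q))"
  have D: "smooth_map_on Sn D" unfolding D_def by (rule smooth_tderiv_field[OF smooth_DX[OF W] V])
  have a: "smooth_map_on Sn a" unfolding a_def
    by (intro smooth_map_on_linear_compose[OF bounded_linear_divide] dS.smooth_map_on_B smooth_DX V W)
  have b: "smooth_map_on Sn b" unfolding b_def by (intro dS.smooth_map_on_B D smooth_nu)
  have R: "J q (lc V W q) = D q + a q *\<^sub>R X q + b q *\<^sub>R nu q" if "q \<in> Sn" for q
    using gauss_formula[OF V W that] by (simp add: D_def a_def b_def)
  have sm: "smooth_map_on Sn (\<lambda>q. D q + a q *\<^sub>R X q)" "smooth_map_on Sn (\<lambda>q. a q *\<^sub>R X q)" "smooth_map_on Sn (\<lambda>q. b q *\<^sub>R nu q)"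
    by (intro smooth_map_on_add smooth_map_on_scaleR D a b X_smooth smooth_nu)+
  have "tderiv Sn (DX (lc V W)) p (U p) = tderiv Sn (\<lambda>q. D q + a q *\<^sub>R X q + b q *\<^sub>R nu q) p (U p)"
    by (rule tderiv_cong[OF smooth_map_on_add[OF sm(1,3)] u R])
  also have "\<dots> = tderiv Sn D p (U p) + (a p *\<^sub>R dX p (U p) + tderiv Sn a p (U p) *\<^sub>R X p)
      + (b p *\<^sub>R tderiv Sn nu p (U p) + tderiv Sn b p (U p) *\<^sub>R nu p)"
    by (simp only: tderiv_add[OF sm(1,3) u] tderiv_add[OF D sm(2) u] tderiv_scaleR[OF a X_smooth u] tderiv_scaleR[OF b smooth_nu u])
  finally have "g p (lc U (lc V W) p) z = mink (tderiv Sn D p (U p)) (J p z) + a p * mink (J p (U p)) (J p z)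
      - b p * mink (J p (shape p (U p))) (J p z)"
    unfolding g_lc[OF p z] by (simp add: dS.B_simps weingarten[OF u] J_X[OF p] nu_J[OF p] J_dX[OF u])
  moreover have "a p = g p (V p) (W p) / \<rho>\<^sup>2" by (simp add: a_def J_J[OF v w])
  moreover have "b p = g p (shape p (V p)) (W p)" unfolding b_def D_def by (rule second_derivative(2)[OF W v])
  ultimately show ?thesis by (simp add: D_def J_J[OF u z] J_J[OF shape_tangent[OF p] z])
qed

text \<open>The flat second derivatives cancel against the bracket term. The shape operators carry
  the sign opposite to the Riemannian case because \<open>nu\<close> is timelike.\<close>

lemma gauss_equation:
  assumes u: "u \<in> T p" and v: "v \<in> T p" and w: "w \<in> T p" and z: "z \<in> T p"
  shows "g p (riemann Sn g p u v w) z = (g p v w * g p u z - g p u w * g p v z) / \<rho>\<^sup>2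
    - (g p (shape p v) w * g p (shape p u) z - g p (shape p u) w * g p (shape p v) z)"
proof -
  have p: "p \<in> Sn" by (rule tangent_space_memD[OF u])
  define U V W where "U = ext_field Sn p u" and "V = ext_field Sn p v" and "W = ext_field Sn p w"
  have U: "U \<in> vector_fields Sn" "U p = u" and V: "V \<in> vector_fields Sn" "V p = v"
    and W: "W \<in> vector_fields Sn" "W p = w"
    using ext_field_Sn[OF p u] ext_field_Sn[OF p v] ext_field_Sn[OF p w] by (auto simp: U_def V_def W_def)
  have LL: "levi_civita Sn g A (levi_civita Sn g B W) p = lc A (lc B W) p"
    if A: "A \<in> vector_fields Sn" and B: "B \<in> vector_fields Sn" for A B
    unfolding levi_civita_eq[OF A is_levi_civitaD(2)[OF is_levi_civita_levi_civita B W(1)] p]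
    by (rule lc_cong[OF A lc_field[OF B W(1)] p]) (rule levi_civita_eq[OF B W(1)])
  note lie = lie_bracket_Sn[OF U(1) V(1)]
  have r: "riemann Sn g p u v w = lc U (lc V W) p - lc V (lc U W) p - lc (lie_bracket Sn U V) W p"
    unfolding riemann_def curvature_op_def U_def[symmetric] V_def[symmetric] W_def[symmetric]
    by (simp only: LL[OF U(1) V(1)] LL[OF V(1) U(1)] levi_civita_eq[OF lie W(1) p])
  have t: "lc A (lc B W) p \<in> T p" if "A \<in> vector_fields Sn" "B \<in> vector_fields Sn" for A B
    by (rule vector_fieldsD(2)[OF lc_field[OF that(1) lc_field[OF that(2) W(1)]] p])
  note tl = vector_fieldsD(2)[OF lc_field[OF lie W(1)] p]
  have "g p (riemann Sn g p u v w) z = g p (lc U (lc V W) p) z - g p (lc V (lc U W) p) z - g p (lc (lie_bracket Sn U V) W p) z"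
    unfolding r using g_lin(2)[OF subspace_diff[OF subspace_tangent_Sn[OF p] t[OF U(1) V(1)] t[OF V(1) U(1)]] tl z]
      g_lin(2)[OF t[OF U(1) V(1)] t[OF V(1) U(1)] z] by (simp only:)
  moreover have "mink (tderiv Sn (\<lambda>q. tderiv Sn (DX W) q (V q)) p (U p)) (J p z)
      - mink (tderiv Sn (\<lambda>q. tderiv Sn (DX W) q (U q)) p (V p)) (J p z) = g p (lc (lie_bracket Sn U V) W p) z"
    unfolding g_lc[OF p z] tderiv_commutator[OF smooth_DX[OF W(1)] U(1) V(1) p vector_fieldsD(2)[OF lie p], symmetric]
    by (rule dS.B_simps(3)[symmetric])
  ultimately show ?thesis
    unfolding lc_lc[OF U(1) V(1) W(1) z] lc_lc[OF V(1) U(1) W(1) z] U(2) V(2) W(2) diff_divide_distrib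
    by linarith
qed

subsection \<open>Traces in orthonormal frames\<close>

lemma frame_expansion:
  assumes B: "orthonormal_frame Sn g p B" and u: "u \<in> T p"
  shows "u = (\<Sum>e\<in>B. g p u e *\<^sub>R e)" "w \<in> T p \<Longrightarrow> g p u w = (\<Sum>e\<in>B. g p u e * g p w e)"
proof -
  have p: "p \<in> Sn" by (rule tangent_space_memD[OF u])
  note B' = B[unfolded orthonormal_frame_def]
  have fin: "finite B" by (rule B'[THEN conjunct1])
  have sp: "span B = T p" by (rule B'[THEN conjunct2, THEN conjunct1])
  have on: "g p e f = (if e = f then 1 else 0)" if "e \<in> B" "f \<in> B" for e f
    using B'[THEN conjunct2, THEN conjunct2] that by blast
  have BT: "e \<in> T p" if "e \<in> B" for e using span_base[OF that] unfolding sp .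
  have "u \<in> range (\<lambda>c. \<Sum>e\<in>B. c e *\<^sub>R e)" using u unfolding sp[symmetric] span_finite[OF fin] .
  then obtain c where c: "u = (\<Sum>e\<in>B. c e *\<^sub>R e)" by (rule rangeE) (rule that)
  have lin: "g p (\<Sum>e\<in>B. c e *\<^sub>R e) w = (\<Sum>e\<in>B. c e * g p e w)" if w: "w \<in> T p" for c w
  proof -
    have t: "(\<Sum>e\<in>B. c e *\<^sub>R e) \<in> T p"
      by (rule subspace_sum[OF subspace_tangent_Sn[OF p]]) (rule subspace_scale[OF subspace_tangent_Sn[OF p] BT])
    have "g p (\<Sum>e\<in>B. c e *\<^sub>R e) w = (\<Sum>e\<in>B. c e * mink (J p e) (J p w))"
      by (simp only: J_J[OF t w, symmetric] linear_sum[OF linear_J[OF p]] linear_cmul[OF linear_J[OF p]]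
          bounded_bilinear.sum_left[OF bounded_bilinear_mink] dS.B_simps(5) real_scaleR_def)
    also have "\<dots> = (\<Sum>e\<in>B. c e * g p e w)" by (intro sum.cong refl) (simp only: J_J[OF BT w])
    finally show ?thesis .
  qed
  have cf: "g p u f = c f" if f: "f \<in> B" for f
  proof -
    have "g p u f = (\<Sum>e\<in>B. c e * g p e f)" unfolding c by (rule lin[OF BT[OF f]])
    also have "\<dots> = (\<Sum>e\<in>B. if e = f then c e else 0)" by (rule sum.cong[OF refl]) (simp only: on[OF _ f] mult_1_right mult_zero_right if_distrib[of "(*) _"])
    also have "\<dots> = c f" using fin f by (simp only: sum.delta if_True)
    finally show ?thesis .
  qed
  have eq: "(\<Sum>e\<in>B. g p u e *\<^sub>R e) = (\<Sum>e\<in>B. c e *\<^sub>R e)"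
    by (rule sum.cong[OF refl]) (simp only: cf)
  show u': "u = (\<Sum>e\<in>B. g p u e *\<^sub>R e)" unfolding eq by (rule c)
  assume w: "w \<in> T p"
  have "g p u w = g p (\<Sum>e\<in>B. g p u e *\<^sub>R e) w" 
    by (rule arg_cong[where f = "\<lambda>z. g p z w", OF u'])
  also have "\<dots> = (\<Sum>e\<in>B. g p u e * g p e w)" by (rule lin[OF w])
  also have "\<dots> = (\<Sum>e\<in>B. g p u e * g p w e)" by (intro sum.cong refl) (simp only: g_sym[OF BT w])
  finally show "g p u w = (\<Sum>e\<in>B. g p u e * g p w e)" .
qed

lemma frame_tangent:
  assumes "orthonormal_frame Sn g p B" "e \<in> B"
  shows "e \<in> T p"
proof -
  have "span B = T p" using assms(1) unfolding orthonormal_frame_def by blast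
  then show ?thesis using span_base[OF assms(2)] by simp
qed

end

context embedding
begin

section \<open>Principal frames and traces of the curvature\<close>

lemma principal_frameE:
  assumes p: "p \<in> Sn" and k: "principal_curvatures g \<rho> X p k"
  obtains e where "orthonormal_frame Sn g p (range e)" "\<And>i. e i \<in> T p"
    "\<And>i j. g p (e i) (e j) = (if i = j then 1 else 0)" "\<And>i. shape p (e i) = k $ i *\<^sub>R e i"
    "\<And>u. u \<in> T p \<Longrightarrow> u = (\<Sum>i\<in>UNIV. g p u (e i) *\<^sub>R e i)"
    "\<And>u w. u \<in> T p \<Longrightarrow> w \<in> T p \<Longrightarrow> g p u w = (\<Sum>i\<in>UNIV. g p u (e i) * g p w (e i))"
proof -
  obtain e where e: "inj e" "orthonormal_frame Sn g p (range e)"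
    "\<And>i v. v \<in> T p \<Longrightarrow> second_fundamental_form g \<rho> X p (e i) v = k $ i * g p (e i) v"
    using k unfolding principal_curvatures_def by metis
  have eT: "e i \<in> T p" for i by (rule frame_tangent[OF e(2)]) simp
  have on: "g p (e i) (e j) = (if i = j then 1 else 0)" for i j
  proof -
    have "g p (e i) (e j) = (if e i = e j then 1 else 0)"
      using e(2) unfolding orthonormal_frame_def by blast
    then show ?thesis using e(1) by (simp add: inj_eq)
  qed
  have sh: "shape p (e i) = k $ i *\<^sub>R e i" for i
  proof -
    have ks: "k $ i *\<^sub>R e i \<in> T p" by (rule subspace_scale[OF subspace_tangent_Sn[OF p] eT])
    have "shape p (e i) - k $ i *\<^sub>R e i = 0"
    proof (rule g_zero[OF subspace_diff[OF subspace_tangent_Sn[OF p] shape_tangent[OF p] ks]])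
      fix w assume w: "w \<in> T p"
      show "g p (shape p (e i) - k $ i *\<^sub>R e i) w = 0"
        using e(3)[OF w] second_fundamental_form_eq[OF eT w]
        by (simp add: g_lin(2)[OF shape_tangent[OF p] ks w] g_lin(3)[OF eT eT w])
    qed
    then show ?thesis by simp
  qed
  have 1: "u = (\<Sum>i\<in>UNIV. g p u (e i) *\<^sub>R e i)" if u: "u \<in> T p" for u
    using frame_expansion(1)[OF e(2) u] by (simp add: sum.reindex[OF e(1)])
  have 2: "g p u w = (\<Sum>i\<in>UNIV. g p u (e i) * g p w (e i))" if u: "u \<in> T p" and w: "w \<in> T p" for u w
    using frame_expansion(2)[OF e(2) u w] by (simp add: sum.reindex[OF e(1)])
  show ?thesis by (rule that[OF e(2) eT on sh 1 2])
qed

text \<open>Taking the trace over the ambient \<open>Basis\<close> makes smoothness evident, with no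
  smooth choice of a tangent frame.\<close>

definition mean :: "'n euc \<Rightarrow> real" where "mean p = (\<Sum>b\<in>Basis. shape p b \<bullet> b)"
definition sq :: "'n euc \<Rightarrow> real" where "sq p = (\<Sum>b\<in>Basis. shape p (shape p b) \<bullet> b)"
definition psi :: "'n euc \<Rightarrow> real" where "psi p = mean p * mean p - sq p"

lemma smooth_mean: "smooth_map_on Sn mean"
  unfolding mean_def[abs_def]
  by (intro smooth_map_on_sum smooth_map_on_linear_compose[OF bounded_linear_inner_left] smooth_shape smooth_map_on_const)

lemma smooth_psi: "smooth_map_on Sn psi"
  unfolding psi_def[abs_def] sq_def[abs_def]
  by (intro smooth_map_on_diff smooth_map_on_mult smooth_mean smooth_map_on_sum
      smooth_map_on_linear_compose[OF bounded_linear_inner_left] smooth_shape smooth_map_on_const)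

text \<open>For a map with values in the tangent space, only its restriction to that space
  contributes to the trace: expand the values in the frame and exchange the sums.\<close>

lemma trace_frame:
  fixes e :: "'n \<Rightarrow> 'n euc"
  assumes p: "p \<in> Sn" and eT: "\<And>i. e i \<in> T p" and ex: "\<And>u. u \<in> T p \<Longrightarrow> u = (\<Sum>i\<in>UNIV. g p u (e i) *\<^sub>R e i)"
    and F: "linear F" "\<And>u. F u \<in> T p"
  shows "(\<Sum>b\<in>Basis. F b \<bullet> b) = (\<Sum>i\<in>UNIV. g p (F (e i)) (e i))"
proof -
  have "(\<Sum>b\<in>Basis. F b \<bullet> b) = (\<Sum>b\<in>Basis. (\<Sum>i\<in>UNIV. g p (F b) (e i) *\<^sub>R e i) \<bullet> b)"
    by (rule sum.cong[OF refl]) (simp only: ex[OF F(2), symmetric])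
  also have "\<dots> = (\<Sum>b\<in>Basis. \<Sum>i\<in>UNIV. (e i \<bullet> b) * g p (F b) (e i))"
    by (simp add: inner_sum_left mult.commute)
  also have "\<dots> = (\<Sum>i\<in>UNIV. \<Sum>b\<in>Basis. (e i \<bullet> b) * g p (F b) (e i))" by (rule sum.swap)
  also have "\<dots> = (\<Sum>i\<in>UNIV. g p (F (e i)) (e i))"
  proof (rule sum.cong[OF refl])
    fix i
    have l: "linear (\<lambda>u. g p (F u) (e i))"
      by (rule linearI) (simp_all add: linear_add[OF F(1)] linear_cmul[OF F(1)] g_lin(1)[OF F(2) F(2) eT] g_lin(3)[OF F(2) F(2) eT])
    show "(\<Sum>b\<in>Basis. (e i \<bullet> b) * g p (F b) (e i)) = g p (F (e i)) (e i)"
      using linear_basis_expansion[OF l, of "e i"] by (simp only: real_scaleR_def)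
  qed
  finally show ?thesis .
qed

lemma curvature_traces:
  assumes p: "p \<in> Sn" and k: "principal_curvatures g \<rho> X p k"
  shows "mean p = (\<Sum>i\<in>UNIV. k $ i)" "sq p = (\<Sum>i\<in>UNIV. (k $ i)\<^sup>2)"
    "norm_squared Sn g (second_fundamental_form g \<rho> X) p = sq p"
    "scalar_curvature Sn g p = real CARD('n) * (real CARD('n) - 1) / \<rho>\<^sup>2 - psi p"
proof -
  obtain e where e: "orthonormal_frame Sn g p (range e)" "\<And>i. e i \<in> T p"
    "\<And>i j. g p (e i) (e j) = (if i = j then 1 else 0)" "\<And>i. shape p (e i) = k $ i *\<^sub>R e i"
    "\<And>u. u \<in> T p \<Longrightarrow> u = (\<Sum>i\<in>UNIV. g p u (e i) *\<^sub>R e i)"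
    "\<And>u w. u \<in> T p \<Longrightarrow> w \<in> T p \<Longrightarrow> g p u w = (\<Sum>i\<in>UNIV. g p u (e i) * g p w (e i))"
    using p k by (rule principal_frameE) blast
  note st = shape_tangent[OF p]
  have c: "g p (c *\<^sub>R e i) (e i) = c" for c i by (simp add: g_lin(3)[OF e(2) e(2) e(2)] e(3))
  show m: "mean p = (\<Sum>i\<in>UNIV. k $ i)"
    using trace_frame[OF p e(2) e(5) linear_shape[OF p] st] by (simp only: mean_def e(4) c)
  have s2: "shape p (shape p (e i)) = (k $ i)\<^sup>2 *\<^sub>R e i" for i
    by (simp add: e(4) linear_cmul[OF linear_shape[OF p]] power2_eq_square)
  have l2: "linear (\<lambda>u. shape p (shape p u))"
    using linear_compose[OF linear_shape[OF p] linear_shape[OF p]] by (simp add: o_def)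
  show q: "sq p = (\<Sum>i\<in>UNIV. (k $ i)\<^sup>2)"
    using trace_frame[OF p e(2) e(5) l2 st] by (simp only: sq_def s2 c)
  have S: "g p (shape p u) (e i) = k $ i * g p u (e i)" if u: "u \<in> T p" for u i
    unfolding shape_sym[OF u e(2)] e(4) g_lin(3)[OF e(2) e(2) u] g_sym[OF e(2) u] ..
  \<comment> \<open>The traces to be computed use an unspecified frame \<open>B\<close>. Parseval in
    \<open>B\<close> makes each column sum of the squared transition coefficients equal to 1, which
    moves the sums to the principal frame.\<close>
  have sumB: "(\<Sum>b\<in>B. \<Sum>i\<in>UNIV. c i * (g p b (e i))\<^sup>2) = (\<Sum>i\<in>UNIV. c i)"
    if B: "orthonormal_frame Sn g p B" for B and c :: "'n \<Rightarrow> real"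
  proof -
    have "(\<Sum>b\<in>B. (g p b (e i))\<^sup>2) = 1" for i
    proof -
      have "(\<Sum>b\<in>B. (g p b (e i))\<^sup>2) = (\<Sum>b\<in>B. g p (e i) b * g p (e i) b)"
        by (rule sum.cong[OF refl]) (simp only: g_sym[OF frame_tangent[OF B] e(2)] power2_eq_square)
      also have "\<dots> = g p (e i) (e i)" by (rule frame_expansion(2)[OF B e(2) e(2), symmetric])
      finally show ?thesis by (simp add: e(3))
    qed
    then show ?thesis by (subst sum.swap) (simp flip: sum_distrib_left)
  qed
  have B1: "(\<Sum>b\<in>B. g p (shape p b) b) = (\<Sum>i\<in>UNIV. k $ i)" if B: "orthonormal_frame Sn g p B" for B
  proof -
    have "(\<Sum>b\<in>B. g p (shape p b) b) = (\<Sum>b\<in>B. \<Sum>i\<in>UNIV. k $ i * (g p b (e i))\<^sup>2)"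
      by (rule sum.cong[OF refl])
        (simp add: e(6)[OF st frame_tangent[OF B]] S[OF frame_tangent[OF B]] power2_eq_square mult.assoc)
    then show ?thesis using sumB[OF B] by simp
  qed
  have B2: "(\<Sum>b\<in>B. \<Sum>b'\<in>B. (g p (shape p b) b')\<^sup>2) = (\<Sum>i\<in>UNIV. (k $ i)\<^sup>2)"
    if B: "orthonormal_frame Sn g p B" for B
  proof -
    have "(\<Sum>b'\<in>B. (g p (shape p b) b')\<^sup>2) = (\<Sum>i\<in>UNIV. (k $ i)\<^sup>2 * (g p b (e i))\<^sup>2)" if b: "b \<in> B" for b
    proof -
      have "(\<Sum>b'\<in>B. (g p (shape p b) b')\<^sup>2) = g p (shape p b) (shape p b)"
        unfolding frame_expansion(2)[OF B st st] by (simp only: power2_eq_square)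
      also have "\<dots> = (\<Sum>i\<in>UNIV. (k $ i)\<^sup>2 * (g p b (e i))\<^sup>2)"
        unfolding e(6)[OF st st] S[OF frame_tangent[OF B b]] by (simp add: power2_eq_square algebra_simps)
      finally show ?thesis .
    qed
    then show ?thesis using sumB[OF B, of "\<lambda>i. (k $ i)\<^sup>2"] by simp
  qed
  define B where "B = (SOME B. orthonormal_frame Sn g p B)"
  have B: "orthonormal_frame Sn g p B" unfolding B_def by (rule someI[of "orthonormal_frame Sn g p", OF e(1)])
  note bT = frame_tangent[OF B]
  have gB: "g p b b' = (if b = b' then 1 else 0)" if "b \<in> B" "b' \<in> B" for b b'
    using B that unfolding orthonormal_frame_def by blast
  have fin: "finite B" using B unfolding orthonormal_frame_def by blast
  have "norm_squared Sn g (second_fundamental_form g \<rho> X) p = (\<Sum>b\<in>B. \<Sum>b'\<in>B. (g p (shape p b) b')\<^sup>2)"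
    unfolding norm_squared_def Let_def B_def[symmetric]
    by (intro sum.cong refl) (simp only: second_fundamental_form_eq[OF bT bT])
  then show "norm_squared Sn g (second_fundamental_form g \<rho> X) p = sq p" using B2[OF B] q by simp
  \<comment> \<open>The size of the unspecified frame is found from the same transition
    coefficients, summed with weight 1.\<close>
  have "real (card B) = (\<Sum>b\<in>B. g p b b)" using gB by simp
  also have "\<dots> = (\<Sum>b\<in>B. \<Sum>i\<in>UNIV. 1 * (g p b (e i))\<^sup>2)"
    by (rule sum.cong[OF refl]) (simp add: e(6)[OF bT bT] power2_eq_square)
  also have "\<dots> = real CARD('n)" unfolding sumB[OF B] by simp
  finally have cB: "real (card B) = real CARD('n)" .
  have "g p (riemann Sn g p b b' b') b = (1 - (if b = b' then 1 else 0)) / \<rho>\<^sup>2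
      - g p (shape p b) b * g p (shape p b') b' + (g p (shape p b) b')\<^sup>2" if "b \<in> B" "b' \<in> B" for b b'
    using that gB by (simp add: gauss_equation[OF bT bT bT bT] shape_sym[OF bT bT, of b' b] power2_eq_square)
  then have "scalar_curvature Sn g p = (\<Sum>b\<in>B. \<Sum>b'\<in>B. (1 - (if b = b' then 1 else 0)) / \<rho>\<^sup>2
      - g p (shape p b) b * g p (shape p b') b' + (g p (shape p b) b')\<^sup>2)"
    unfolding scalar_curvature_def Let_def B_def[symmetric] by simp
  also have "\<dots> = (\<Sum>b\<in>B. \<Sum>b'\<in>B. (1 - (if b = b' then 1 else 0)) / \<rho>\<^sup>2)
      - (\<Sum>b\<in>B. g p (shape p b) b) * (\<Sum>b\<in>B. g p (shape p b) b) + (\<Sum>b\<in>B. \<Sum>b'\<in>B. (g p (shape p b) b')\<^sup>2)"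
    by (simp only: sum.distrib sum_subtractf sum_product)
  also have "(\<Sum>b\<in>B. \<Sum>b'\<in>B. (1 - (if b = b' then 1 else 0 :: real)) / \<rho>\<^sup>2) = real (card B) * (real (card B) - 1) / \<rho>\<^sup>2"
    using fin by (simp add: sum_subtractf algebra_simps flip: sum_divide_distrib)
  finally show "scalar_curvature Sn g p = real CARD('n) * (real CARD('n) - 1) / \<rho>\<^sup>2 - psi p"
    unfolding B1[OF B] B2[OF B] cB psi_def m q by simp
qed

text \<open>On a surface the Gauss equation in a principal frame gives curvature
  \<open>1 / \<rho>\<^sup>2 - k $ a * k $ b\<close>, while \<open>psi p\<close> is twice the product
  of the principal curvatures.\<close>

lemma sectional_bound:
  assumes n: "CARD('n) = 2" and pc: "positive_curvature Sn g" and p: "p \<in> Sn" and k: "principal_curvatures g \<rho> X p k"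
  shows "psi p < 2 / \<rho>\<^sup>2"
proof -
  obtain e where e: "orthonormal_frame Sn g p (range e)" "\<And>i. e i \<in> T p"
    "\<And>i j. g p (e i) (e j) = (if i = j then 1 else 0)" "\<And>i. shape p (e i) = k $ i *\<^sub>R e i"
    using p k by (rule principal_frameE) blast
  obtain a b :: 'n where ab: "UNIV = {a, b}" "a \<noteq> b" using n card_2_iff[of "UNIV :: 'n set"] by auto
  have gab: "g p (e a) (e a) = 1" "g p (e b) (e b) = 1" "g p (e a) (e b) = 0" "g p (e b) (e a) = 0"
    using ab(2) by (simp_all add: e(3))
  have ne: "e a \<noteq> e b" using gab by auto
  have "e a \<notin> span {e b}"
  proof
    assume "e a \<in> span {e b}"
    then obtain c where c: "e a = c *\<^sub>R e b" unfolding span_singleton by blast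
    have "g p (e a) (e a) = c * g p (e b) (e a)" using g_lin(3)[OF e(2)[of b] e(2)[of b] e(2)[of a], of c] c by simp
    then show False using gab by simp
  qed
  moreover have "e b \<noteq> 0"
    using g_lin(3)[OF e(2)[of b] e(2)[of b] e(2)[of b], of 0] gab by auto
  ultimately have "independent {e a, e b}" using ne by (simp add: independent_insert)
  then have "sectional_curvature Sn g p (e a) (e b) > 0"
    using pc p e(2) ne unfolding positive_curvature_def by blast
  moreover have "sectional_curvature Sn g p (e a) (e b) = 1 / \<rho>\<^sup>2 - k $ a * k $ b"
    unfolding sectional_curvature_def gauss_equation[OF e(2) e(2) e(2) e(2)] e(4) g_lin(3)[OF e(2) e(2) e(2)] gab
    by (simp add: mult.commute)
  moreover have "psi p = 2 * (k $ a * k $ b)"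
    unfolding psi_def curvature_traces(1,2)[OF p k] ab(1) using ab(2)
    by (simp add: power2_eq_square algebra_simps)
  ultimately show ?thesis by simp
qed

end

subsection \<open>The cone of admissible curvatures\<close>

text \<open>The square of the sum runs over ordered pairs: the diagonal gives the squares, and each
  two-element set is hit by exactly two off-diagonal pairs.\<close>

lemma P2_eq:
  fixes k :: "real ^ 'a::finite"
  shows "2 * P2 k = (\<Sum>i\<in>UNIV. k $ i)\<^sup>2 - (\<Sum>i\<in>UNIV. (k $ i)\<^sup>2)"
proof -
  define A where "A = {x :: 'a \<times> 'a. fst x \<noteq> snd x}"
  define f where "f = (\<lambda>x :: 'a \<times> 'a. {fst x, snd x})"
  define h where "h = (\<lambda>x. k $ fst x * k $ snd x)"
  have "f ` A \<subseteq> {S. S \<subseteq> UNIV \<and> card S = 2}" by (auto simp: A_def f_def)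
  from sum.group[OF _ _ this, of h]
  have "(\<Sum>S | S \<subseteq> UNIV \<and> card S = 2. \<Sum>x | x \<in> A \<and> f x = S. h x) = sum h A" by simp
  moreover have "(\<Sum>x | x \<in> A \<and> f x = S. h x) = 2 * (\<Prod>i\<in>S. k $ i)" if S: "card S = 2" for S
  proof -
    obtain a b where ab: "S = {a, b}" "a \<noteq> b" using S card_2_iff by metis
    have "{x. x \<in> A \<and> f x = S} = {(a, b), (b, a)}"
      using ab(2) by (auto simp: A_def f_def ab(1) doubleton_eq_iff)
    then show ?thesis using ab by (simp add: h_def mult.commute)
  qed
  ultimately have 1: "sum h A = 2 * P2 k" by (simp add: P2_def sum_distrib_left)
  have "(\<Sum>i\<in>UNIV. k $ i)\<^sup>2 = (\<Sum>x\<in>UNIV \<times> UNIV. h x)"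
    by (simp add: power2_eq_square sum_product sum.cartesian_product h_def case_prod_beta)
  also have "UNIV \<times> UNIV = A \<union> (\<lambda>i. (i, i)) ` UNIV" by (auto simp: A_def)
  also have "(\<Sum>x\<in>\<dots>. h x) = sum h A + (\<Sum>x\<in>(\<lambda>i. (i, i)) ` UNIV. h x)"
    by (rule sum.union_disjoint) (auto simp: A_def)
  also have "(\<Sum>x\<in>(\<lambda>i. (i, i)) ` UNIV. h x) = (\<Sum>i\<in>UNIV. (k $ i)\<^sup>2)"
    by (subst sum.reindex) (auto simp: h_def power2_eq_square inj_on_def)
  finally show ?thesis using 1 by simp
qed

text \<open>Where \<open>P2\<close> is positive, the square of the trace exceeds a sum of squares,
  so the trace has no zero on \<open>Gamma2\<close>. It is positive at the vector of ones, hence on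
  the whole connected set.\<close>

lemma Gamma2_D:
  fixes k :: "real ^ 'n::finite"
  assumes n: "CARD('n) \<ge> 2" and k: "k \<in> Gamma2"
  shows "P2 k > 0" "(\<Sum>i\<in>UNIV. k $ i) > 0"
proof -
  define D where "D = {k :: real ^ 'n. P2 k > 0}"
  define C where "C = {k :: real ^ 'n. \<forall>i. k $ i > 0}"
  define o1 :: "real ^ 'n" where "o1 = (\<chi> i. 1)"
  have CD: "C \<subseteq> D"
  proof
    fix k assume "k \<in> C"
    then have pos: "k $ i > 0" for i by (simp add: C_def)
    \<comment> \<open>At least two indices are needed for the sum in \<open>P2\<close> to be
      nonempty, hence strictly positive.\<close>
    obtain S :: "'n set" where S: "card S = 2" using obtain_subset_with_card_n[OF n] by metis
    have "(\<Sum>S | S \<subseteq> UNIV \<and> card S = 2. \<Prod>i\<in>S. k $ i) > 0"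
      using S by (intro sum_pos) (auto intro!: prod_pos pos)
    then show "k \<in> D" by (simp add: D_def P2_def)
  qed
  have oC: "o1 \<in> C" by (simp add: o1_def C_def)
  have "convex C" unfolding convex_def
  proof (intro ballI allI impI)
    fix x y :: "real ^ 'n" and u v :: real assume xy: "x \<in> C" "y \<in> C" and uv: "0 \<le> u" "0 \<le> v" "u + v = 1"
    have "u * x $ i + v * y $ i > 0" for i
    proof (cases "u = 0")
      case True
      then show ?thesis using uv xy by (simp add: C_def)
    next
      case False
      then have "u * x $ i > 0" "v * y $ i \<ge> 0" using uv xy by (auto simp: C_def less_imp_le)
      then show ?thesis by linarith
    qed
    then show "u *\<^sub>R x + v *\<^sub>R y \<in> C" by (simp add: C_def)
  qed
  note cv = this
  have ex: "connected_component_set D o1 \<in> components D \<and> C \<subseteq> connected_component_set D o1"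
    using oC CD connected_component_maximal[OF oC convex_connected[OF cv] CD] by (auto simp: components_def)
  \<comment> \<open>Uniqueness for the \<open>THE\<close> in \<open>Gamma2\<close>: two components
    sharing the point \<open>o1\<close> coincide.\<close>
  have un: "K = connected_component_set D o1" if "K \<in> components D \<and> C \<subseteq> K" for K
    using that ex oC components_eq[of K D "connected_component_set D o1"] by blast
  have G: "Gamma2 = connected_component_set D o1"
    unfolding Gamma2_def D_def[symmetric] C_def[symmetric]
  proof (rule the_equality)
    show "connected_component_set D o1 \<in> components D \<and> C \<subseteq> connected_component_set D o1" by (rule ex)
  qed (rule un)
  have GD: "Gamma2 \<subseteq> D" unfolding G by (rule connected_component_subset)
  show "P2 k > 0" using GD k by (auto simp: D_def)
  have conn: "connected (Gamma2 :: (real ^ 'n) set)" unfolding G by (rule connected_connected_component)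
  let ?f = "\<lambda>k :: real ^ 'n. \<Sum>i\<in>UNIV. k $ i"
  have o1G: "o1 \<in> Gamma2" using ex oC unfolding G by blast
  have nz: "?f m \<noteq> 0" if "m \<in> Gamma2" for m
  proof
    assume "?f m = 0"
    then have "2 * P2 m = - (\<Sum>i\<in>UNIV. (m $ i)\<^sup>2)" using P2_eq[of m] by simp
    moreover have "(\<Sum>i\<in>UNIV. (m $ i)\<^sup>2) \<ge> 0" by (intro sum_nonneg) auto
    ultimately show False using GD that by (auto simp: D_def)
  qed
  show "?f k > 0"
  proof (rule ccontr)
    assume "\<not> ?f k > 0"
    moreover have "?f o1 > 0" by (simp add: o1_def)
    moreover have "connected (?f ` Gamma2)"
      by (intro connected_continuous_image conn continuous_intros)
    ultimately have "0 \<in> ?f ` Gamma2"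
      using k o1G connectedD_interval[of "?f ` Gamma2" "?f k" "?f o1" 0] by auto
    then show False using nz by auto
  qed
qed

text \<open>
  The double sum is the curvature term that the maximum principle produces. The estimate rests on
  \<open>\<Sum>k\<^sup>3 \<le> r \<Sum>k\<^sup>2\<close> and \<open>r \<le> \<Sum>k\<close>, where \<open>r = sqrt (\<Sum>k\<^sup>2)\<close>.
\<close>

lemma curvature_term_bound:
  fixes k :: "'n::finite \<Rightarrow> real"
  assumes s: "(\<Sum>i\<in>UNIV. k i) > 0" and psi: "psi = (\<Sum>i\<in>UNIV. k i)\<^sup>2 - (\<Sum>i\<in>UNIV. (k i)\<^sup>2)" "psi > 0"
  shows "(\<Sum>i\<in>UNIV. (k i)\<^sup>2) * ((real CARD('n) - 1) * c - psi / 2) - psi * c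
    \<le> (\<Sum>i\<in>UNIV. \<Sum>j\<in>UNIV. (k i - k j)\<^sup>2 * (c - k i * k j)) / 2"
proof -
  define S where "S = (\<Sum>i\<in>UNIV. k i)"
  define q where "q = (\<Sum>i\<in>UNIV. (k i)\<^sup>2)"
  define t where "t = (\<Sum>i\<in>UNIV. (k i)^3)"
  define r where "r = sqrt q"
  have q0: "q \<ge> 0" unfolding q_def by (intro sum_nonneg) auto
  have r: "r \<ge> 0" "r * r = q" using q0 by (auto simp: r_def)
  have kr: "k i \<le> r" for i
  proof -
    have "(k i)\<^sup>2 \<le> q" unfolding q_def by (rule member_le_sum) auto
    then have "\<bar>k i\<bar> \<le> r" unfolding r_def by (metis real_sqrt_abs real_sqrt_le_iff)
    then show ?thesis by simp
  qed
  have "(k i)^3 \<le> r * (k i)\<^sup>2" for i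
    using mult_right_mono[OF kr[of i], of "(k i)\<^sup>2"] by (simp add: power3_eq_cube power2_eq_square)
  then have "t \<le> (\<Sum>i\<in>UNIV. r * (k i)\<^sup>2)" unfolding t_def by (intro sum_mono) simp
  then have t: "t \<le> r * q" by (simp add: q_def sum_distrib_left)
  have Spsi: "S * S - r * r = psi" using psi r by (simp add: S_def q_def power2_eq_square)
  have rS: "r \<le> S"
  proof (rule ccontr)
    assume "\<not> r \<le> S"
    then have "S * S \<le> r * r" using s by (intro mult_mono) (auto simp: S_def)
    then show False using Spsi psi(2) by simp
  qed
  \<comment> \<open>Replacing \<open>r\<close> by the mean of \<open>S\<close> and \<open>r\<close>
    turns the product into half the difference of squares, and
    \<open>S * S - r * r = psi\<close>.\<close>
  have "r * (S - r) \<le> (S + r) / 2 * (S - r)" using rS by (intro mult_right_mono) auto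
  also have "\<dots> = psi / 2" using Spsi by (simp add: algebra_simps)
  finally have "q * (r * (S - r)) \<le> q * (psi / 2)" using q0 by (rule mult_left_mono)
  moreover have "S * t \<le> S * (r * q)" using t s by (intro mult_left_mono) (auto simp: S_def)
  ultimately have main: "S * t - q * q \<le> q * psi / 2" using r(2) by (simp add: algebra_simps)
  have sums: "(\<Sum>i\<in>UNIV. \<Sum>j\<in>(UNIV :: 'n set). c * (k i)\<^sup>2) = c * (real CARD('n) * q)"
    "(\<Sum>i\<in>(UNIV :: 'n set). \<Sum>j\<in>UNIV. c * (k j)\<^sup>2) = c * (real CARD('n) * q)"
    "(\<Sum>i\<in>UNIV. \<Sum>j\<in>UNIV. 2 * c * (k i * k j)) = 2 * c * (S * S)"
    "(\<Sum>i\<in>UNIV. \<Sum>j\<in>UNIV. (k i)^3 * k j) = t * S"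
    "(\<Sum>i\<in>UNIV. \<Sum>j\<in>UNIV. k i * (k j)^3) = S * t"
    "(\<Sum>i\<in>UNIV. \<Sum>j\<in>UNIV. 2 * ((k i)\<^sup>2 * (k j)\<^sup>2)) = 2 * (q * q)"
    by (simp_all add: S_def t_def q_def flip: sum_distrib_left sum_distrib_right)
  have "(\<Sum>i\<in>UNIV. \<Sum>j\<in>UNIV. (k i - k j)\<^sup>2 * (c - k i * k j))
     = (\<Sum>i\<in>UNIV. \<Sum>j\<in>UNIV. c * (k i)\<^sup>2 + c * (k j)\<^sup>2 - 2 * c * (k i * k j) - (k i)^3 * k j - k i * (k j)^3 + 2 * ((k i)\<^sup>2 * (k j)\<^sup>2))"
    by (intro sum.cong refl) (simp add: power2_eq_square power3_eq_cube algebra_simps)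
  also have "\<dots> = c * (real CARD('n) * q) + c * (real CARD('n) * q) - 2 * c * (S * S) - t * S - S * t + 2 * (q * q)"
    by (simp only: sum.distrib sum_subtractf sums)
  also have "S * S = psi + q" using Spsi r(2) by simp
  finally show ?thesis using main unfolding q_def[symmetric]
    by (simp add: algebra_simps diff_divide_distrib add_divide_distrib)
qed

subsection \<open>The second-order identity\<close>

lemma dird2_cong_open:
  assumes "open U" "x \<in> U" "\<And>y. y \<in> U \<Longrightarrow> f y = h y" "smooth_on U h"
  shows "dird f v x = dird h v x" "dird (dird f v) w x = dird (dird h v) w x"
proof -
  have 1: "dird f v y = dird h v y" if "y \<in> U" for y v
    by (rule dird_cong_open(2)[OF assms(1) that assms(3) smooth_onD(1)[OF assms(4) that]])
  then show "dird f v x = dird h v x" using assms(2) by simp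
  show "dird (dird f v) w x = dird (dird h v) w x"
    by (rule dird_cong_open(2)[OF assms(1,2) 1 smooth_onD(1)[OF smooth_onD(2)[OF assms(4)] assms(2)]])
qed

lemma dird_bilinear_smooth:
  assumes B: "bounded_bilinear B" and f: "smooth_on U f" and g: "smooth_on U g" and x: "x \<in> U"
  shows "dird (\<lambda>x. B (f x) (g x)) v x = B (f x) (dird g v x) + B (dird f v x) (g x)"
  by (rule dird_bilinear[OF B smooth_onD(1)[OF f x] smooth_onD(1)[OF g x]])

lemma dird2_bilinear_smooth:
  assumes B: "bounded_bilinear B" and U: "open U" and f: "smooth_on U f" and g: "smooth_on U g" and x: "x \<in> U"
  shows "dird (dird (\<lambda>x. B (f x) (g x)) v) w x = B (f x) (dird (dird g v) w x) + B (dird f w x) (dird g v x)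
    + (B (dird f v x) (dird g w x) + B (dird (dird f v) w x) (g x))"
proof -
  have "dird (dird (\<lambda>x. B (f x) (g x)) v) w x = dird (\<lambda>y. B (f y) (dird g v y) + B (dird f v y) (g y)) w x"
    by (rule dird2_cong_open(1)[OF U x dird_bilinear_smooth[OF B f g]])
      (assumption, intro smooth_on_add smooth_on_bilinear[OF B] U f g smooth_onD(2)[OF f] smooth_onD(2)[OF g])
  also have "\<dots> = dird (\<lambda>y. B (f y) (dird g v y)) w x + dird (\<lambda>y. B (dird f v y) (g y)) w x"
    by (intro dird_add smooth_onD(1)[OF smooth_on_bilinear[OF B U] x] f g smooth_onD(2)[OF f] smooth_onD(2)[OF g])
  finally show ?thesis
    by (simp only: dird_bilinear_smooth[OF B f smooth_onD(2)[OF g] x] dird_bilinear_smooth[OF B smooth_onD(2)[OF f] g x])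
qed

lemma dird2_sum_smooth:
  assumes "open U" "\<And>i. i \<in> I \<Longrightarrow> smooth_on U (f i)" "x \<in> U"
  shows "dird (\<lambda>x. \<Sum>i\<in>I. f i x) v x = (\<Sum>i\<in>I. dird (f i) v x)"
    "dird (dird (\<lambda>x. \<Sum>i\<in>I. f i x) v) w x = (\<Sum>i\<in>I. dird (dird (f i) v) w x)"
proof -
  have 1: "dird (\<lambda>x. \<Sum>i\<in>I. f i x) v y = (\<Sum>i\<in>I. dird (f i) v y)" if "y \<in> U" for v y
    by (rule dird_sum) (rule smooth_onD(1)[OF assms(2) that])
  then show "dird (\<lambda>x. \<Sum>i\<in>I. f i x) v x = (\<Sum>i\<in>I. dird (f i) v x)" using assms(3) .
  have "dird (dird (\<lambda>x. \<Sum>i\<in>I. f i x) v) w x = dird (\<lambda>y. \<Sum>i\<in>I. dird (f i) v y) w x"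
    by (rule dird2_cong_open(1)[OF assms(1,3) 1]) (assumption, intro smooth_on_sum assms(1) smooth_onD(2)[OF assms(2)])
  also have "\<dots> = (\<Sum>i\<in>I. dird (dird (f i) v) w x)"
    by (rule dird_sum) (rule smooth_onD(1)[OF smooth_onD(2)[OF assms(2)] assms(3)])
  finally show "dird (dird (\<lambda>x. \<Sum>i\<in>I. f i x) v) w x = (\<Sum>i\<in>I. dird (dird (f i) v) w x)" .
qed

lemma dird_mink_const:
  assumes U: "open U" and f: "smooth_on U f" and h: "smooth_on U h" and x: "x \<in> U"
    and c: "\<And>y. y \<in> U \<Longrightarrow> mink (f y) (h y) = c"
  shows "mink (f x) (dird h v x) + mink (dird f v x) (h x) = 0"
proof -
  have "dird (\<lambda>y. mink (f y) (h y)) v x = dird (\<lambda>y. c) v x"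
    by (rule dird2_cong_open(1)[OF U x c smooth_on_const])
  then show ?thesis by (simp add: dird_bilinear_smooth[OF bounded_bilinear_mink f h x])
qed

text \<open>The weight changes sign when \<open>i\<close> and \<open>l\<close> are exchanged, so
  only the antisymmetric part of \<open>W\<close> survives, and the diagonal has weight 0.\<close>

lemma antisymmetrized_sum:
  fixes k :: "'n::finite \<Rightarrow> real"
  assumes "\<And>i l. i \<noteq> l \<Longrightarrow> W i l - W l i = (k i - k l) * (c - k i * k l)"
  shows "(\<Sum>l\<in>UNIV. \<Sum>i\<in>UNIV. (k i - k l) * W i l) = (\<Sum>i\<in>UNIV. \<Sum>j\<in>UNIV. (k i - k j)\<^sup>2 * (c - k i * k j)) / 2"
proof -
  have "(\<Sum>l\<in>UNIV. \<Sum>i\<in>UNIV. (k i - k l) * W i l) = (\<Sum>i\<in>UNIV. \<Sum>l\<in>UNIV. (k i - k l) * W i l)"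
    by (rule sum.swap)
  then have "2 * (\<Sum>l\<in>UNIV. \<Sum>i\<in>UNIV. (k i - k l) * W i l)
      = (\<Sum>i\<in>UNIV. \<Sum>l\<in>UNIV. (k i - k l) * W i l + (k l - k i) * W l i)"
    by (simp add: sum.distrib)
  also have "\<dots> = (\<Sum>i\<in>UNIV. \<Sum>l\<in>UNIV. (k i - k l)\<^sup>2 * (c - k i * k l))"
  proof (intro sum.cong refl)
    fix i l
    have "(k i - k l) * W i l + (k l - k i) * W l i = (k i - k l) * (W i l - W l i)" by (simp add: algebra_simps)
    also have "\<dots> = (k i - k l)\<^sup>2 * (c - k i * k l)"
      using assms[of i l] by (cases "i = l") (auto simp: power2_eq_square)
    finally show "(k i - k l) * W i l + (k l - k i) * W l i = (k i - k l)\<^sup>2 * (c - k i * k l)" .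
  qed
  finally show ?thesis by simp
qed

text \<open>
  A contracted Simons identity. In coordinates \<open>\<Phi>\<close> that are normal to first order at \<open>0\<close> and adapted
  to the principal directions, with \<open>S\<close> the matrix of the shape operator, the third and fourth
  derivatives of \<open>\<Phi>\<close> enter \<open>\<partial>\<^sub>l\<^sup>2 S\<^sub>i\<^sub>i\<close> only through terms symmetric in \<open>i\<close> and \<open>l\<close>.
\<close>

lemma contracted_simons:
  fixes \<Phi> N :: "real ^ 'n::finite \<Rightarrow> 'n minkowski" and S :: "'n \<Rightarrow> 'n \<Rightarrow> real ^ 'n \<Rightarrow> real" and k :: "'n \<Rightarrow> real"
  defines "D \<equiv> \<lambda>(i::'n) (f :: real ^ 'n \<Rightarrow> 'n minkowski). dird f (axis i 1)"
    and "d \<equiv> \<lambda>(i::'n) (f :: real ^ 'n \<Rightarrow> real). dird f (axis i 1)"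
  assumes U: "open U" "0 \<in> U" and \<Phi>: "smooth_on U \<Phi>" and N: "smooth_on U N" and S: "\<And>i j. smooth_on U (S i j)"
    and \<Phi>\<Phi>: "\<And>y. y \<in> U \<Longrightarrow> mink (\<Phi> y) (\<Phi> y) = \<rho>\<^sup>2" and NN: "\<And>y. y \<in> U \<Longrightarrow> mink (N y) (N y) = -1"
    and \<Phi>N: "\<And>y. y \<in> U \<Longrightarrow> mink (\<Phi> y) (N y) = 0" and D\<Phi>N: "\<And>y i. y \<in> U \<Longrightarrow> mink (D i \<Phi> y) (N y) = 0"
    and W: "\<And>y i. y \<in> U \<Longrightarrow> D i N y = - (\<Sum>j\<in>UNIV. S i j y *\<^sub>R D j \<Phi> y)"
    and on: "\<And>i j. mink (D i \<Phi> 0) (D j \<Phi> 0) = (if i = j then 1 else 0)"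
    and normal: "\<And>i j l. mink (D j (D i \<Phi>) 0) (D l \<Phi> 0) = 0"
    and S0: "\<And>i j. S i j 0 = (if i = j then k i else 0)"
    and decomp: "\<And>z. (\<And>l. mink z (D l \<Phi> 0) = 0) \<Longrightarrow> z = (mink z (\<Phi> 0) / \<rho>\<^sup>2) *\<^sub>R \<Phi> 0 - mink z (N 0) *\<^sub>R N 0"
    and H_def: "H = (\<lambda>y. \<Sum>i\<in>UNIV. S i i y)"
    and psi_def: "psi = (\<lambda>y. H y * H y - (\<Sum>i\<in>UNIV. \<Sum>j\<in>UNIV. S i j y * S j i y))"
  shows "(\<Sum>l\<in>UNIV. (H 0 - k l) * d l (d l H) 0) = (\<Sum>l\<in>UNIV. d l (d l psi) 0) / 2 - (\<Sum>l\<in>UNIV. (d l H 0)\<^sup>2)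
    + (\<Sum>l\<in>UNIV. \<Sum>i\<in>UNIV. \<Sum>j\<in>UNIV. (d l (S i j) 0)\<^sup>2)
    + (\<Sum>i\<in>UNIV. \<Sum>j\<in>UNIV. (k i - k j)\<^sup>2 * (1 / \<rho>\<^sup>2 - k i * k j)) / 2"
proof -
  note bm = bounded_bilinear_mink[where 'n = 'n]
  note mB = bounded_bilinear.add_left[OF bm] bounded_bilinear.add_right[OF bm] bounded_bilinear.minus_left[OF bm]
    bounded_bilinear.minus_right[OF bm] bounded_bilinear.diff_left[OF bm] bounded_bilinear.diff_right[OF bm]
    bounded_bilinear.scaleR_left[OF bm] bounded_bilinear.scaleR_right[OF bm] bounded_bilinear.sum_left[OF bm]
  have sD: "smooth_on U (D i f)" if "smooth_on U f" for i f unfolding D_def by (rule smooth_onD(2)[OF that])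
  have sd: "smooth_on U (d i f)" if "smooth_on U f" for i f unfolding d_def by (rule smooth_onD(2)[OF that])
  have cD: "D i (D j f) y = D j (D i f) y" if "smooth_on U f" "y \<in> U" for i j f y
    unfolding D_def by (rule dird_commute[OF U(1) that])
  have cD': "D i f y = D i h y" if "\<And>y. y \<in> U \<Longrightarrow> f y = h y" "smooth_on U h" "y \<in> U" for i f h y
    unfolding D_def by (rule dird2_cong_open(1)[OF U(1) that(3,1,2)])
  have cd': "d i f y = d i h y" if "\<And>y. y \<in> U \<Longrightarrow> f y = h y" "smooth_on U h" "y \<in> U" for i f h y
    unfolding d_def by (rule dird2_cong_open(1)[OF U(1) that(3,1,2)])
  have d_diff: "d i (\<lambda>y. f y - h y) y = d i f y - d i h y" if "smooth_on U f" "smooth_on U h" "y \<in> U" for i f h y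
    unfolding d_def by (rule dird_diff[OF smooth_onD(1)[OF that(1,3)] smooth_onD(1)[OF that(2,3)]])
  have const: "mink (f y) (D i h y) + mink (D i f y) (h y) = 0"
    if "smooth_on U f" "smooth_on U h" "\<And>y. y \<in> U \<Longrightarrow> mink (f y) (h y) = c" "y \<in> U" for f h c i y
    unfolding D_def by (rule dird_mink_const[OF U(1) that(1,2,4,3)])
  have m1: "d l (\<lambda>y. mink (f y) (h y)) y = mink (f y) (D l h y) + mink (D l f y) (h y)"
    if "smooth_on U f" "smooth_on U h" "y \<in> U" for f h l y
    unfolding D_def d_def by (rule dird_bilinear_smooth[OF bm that])
  have m2: "d l (d l (\<lambda>y. mink (f y) (h y))) 0 = mink (f 0) (D l (D l h) 0) + 2 * mink (D l f 0) (D l h 0) + mink (D l (D l f) 0) (h 0)"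
    if "smooth_on U f" "smooth_on U h" for f h l
    unfolding D_def d_def using dird2_bilinear_smooth[OF bm U(1) that U(2)] by simp
  have \<Phi>D\<Phi>: "mink (\<Phi> y) (D i \<Phi> y) = 0" if "y \<in> U" for i y
    using const[OF \<Phi> \<Phi> \<Phi>\<Phi> that, of i] by (simp add: mink_commute)
  have \<Phi>DN: "mink (\<Phi> y) (D i N y) = 0" if "y \<in> U" for i y
    using const[OF \<Phi> N \<Phi>N that, of i] D\<Phi>N[OF that] by simp
  have DN0: "D i N 0 = - (k i *\<^sub>R D i \<Phi> 0)" for i
  proof -
    have "(\<Sum>j\<in>UNIV. S i j 0 *\<^sub>R D j \<Phi> 0) = (\<Sum>j\<in>UNIV. if i = j then k i *\<^sub>R D j \<Phi> 0 else 0)"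
      by (intro sum.cong refl) (simp add: S0)
    then show ?thesis using W[OF U(2), of i] by simp
  qed
  have DD\<Phi>N: "mink (D j (D i \<Phi>) 0) (N 0) = (if i = j then k i else 0)" for i j
    using const[OF sD[OF \<Phi>, of i] N D\<Phi>N U(2), of j] by (simp add: DN0 mB on split: if_splits)
  have DD\<Phi>\<Phi>: "mink (D j (D i \<Phi>) 0) (\<Phi> 0) = (if i = j then -1 else 0)" for i j
    using const[OF \<Phi> sD[OF \<Phi>, of i] \<Phi>D\<Phi> U(2), of j] by (auto simp: on mink_commute[of "\<Phi> 0"] split: if_splits)
  \<comment> \<open>By \<open>normal\<close> there is no tangential part, so the second derivatives
    at 0 are purely normal, and they vanish for \<open>i \<noteq> j\<close> because the frame
    diagonalizes both metric and shape operator.\<close>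
  have DD\<Phi>: "D j (D i \<Phi>) 0 = (if i = j then - (1 / \<rho>\<^sup>2) *\<^sub>R \<Phi> 0 - k i *\<^sub>R N 0 else 0)" for i j
    using decomp[of "D j (D i \<Phi>) 0", OF normal] unfolding DD\<Phi>N DD\<Phi>\<Phi> by simp
  \<comment> \<open>\<open>G\<close> is the metric in these coordinates and \<open>h\<close> the
    second fundamental form with lowered indices; \<open>S\<close> is the mixed tensor, and
    \<open>hS\<close> lowers its index.\<close>
  define G where "G = (\<lambda>i j y. mink (D i \<Phi> y) (D j \<Phi> y))"
  define h where "h = (\<lambda>i m y. mink (N y) (D i (D m \<Phi>) y))"
  have sG: "smooth_on U (G i j)" for i j unfolding G_def
    by (rule smooth_on_bilinear[OF bm U(1) sD[OF \<Phi>] sD[OF \<Phi>]])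
  have sh: "smooth_on U (h i j)" for i j unfolding h_def
    by (rule smooth_on_bilinear[OF bm U(1) N sD[OF sD[OF \<Phi>]]])
  have sSG: "smooth_on U (\<lambda>y. S i j y * G j m y)" for i j m
    by (rule smooth_on_bilinear[OF bounded_bilinear_mult U(1) S sG])
  have hS: "h i m y = (\<Sum>j\<in>UNIV. S i j y * G j m y)" if y: "y \<in> U" for i m y
  proof -
    have "h i m y = - mink (D i N y) (D m \<Phi> y)"
      using const[OF N sD[OF \<Phi>, of m] _ y, of 0 i] D\<Phi>N by (simp add: h_def mink_commute)
    then show ?thesis unfolding W[OF y] by (simp add: mB G_def)
  qed
  have dG: "d l (G i j) 0 = 0" for l i j
    unfolding G_def m1[OF sD[OF \<Phi>] sD[OF \<Phi>] U(2)]
    using normal[of l i j] normal[of l j i] mink_commute[of "D i \<Phi> 0"] by simp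
  have G0: "G i j 0 = (if i = j then 1 else 0)" for i j by (simp add: G_def on)
  have dS: "d l (S i m) 0 = d l (h i m) 0" for l i m
  proof -
    have "d l (h i m) 0 = d l (\<lambda>y. \<Sum>j\<in>UNIV. S i j y * G j m y) 0"
      unfolding d_def by (rule dird2_cong_open(1)[OF U hS]) (assumption, intro smooth_on_sum U(1) sSG)
    also have "\<dots> = (\<Sum>j\<in>UNIV. d l (\<lambda>y. S i j y * G j m y) 0)"
      unfolding d_def by (rule dird2_sum_smooth(1)[OF U(1) sSG U(2)])
    also have "\<dots> = (\<Sum>j\<in>UNIV. S i j 0 * d l (G j m) 0 + d l (S i j) 0 * G j m 0)"
      unfolding d_def by (simp only: dird_bilinear_smooth[OF bounded_bilinear_mult S sG U(2)])
    also have "\<dots> = (\<Sum>j\<in>UNIV. if j = m then d l (S i j) 0 else 0)"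
      unfolding dG G0 by (intro sum.cong refl) simp
    finally show ?thesis by simp
  qed
  \<comment> \<open>\<open>S\<close> need not be symmetric away from 0, but \<open>h\<close> is, and
    at 0 the two have the same first derivatives because those of \<open>G\<close> vanish.\<close>
  have dS_sym: "d l (S i m) 0 = d l (S m i) 0" for l i m
  proof -
    have "h i m y = h m i y" if "y \<in> U" for y unfolding h_def cD[OF \<Phi> that, of i m] ..
    then show ?thesis unfolding dS unfolding d_def by (rule dird2_cong_open(1)[OF U _ sh])
  qed
  \<comment> \<open>At second order, lowering the index is no longer free: the second derivative of
    the metric enters, multiplied by \<open>k i\<close>.\<close>
  have ddS: "d l (d l (S i i)) 0 = d l (d l (h i i)) 0 - k i * d l (d l (G i i)) 0" for l i
  proof -
    have "d l (d l (h i i)) 0 = d l (d l (\<lambda>y. \<Sum>j\<in>UNIV. S i j y * G j i y)) 0"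
      unfolding d_def by (rule dird2_cong_open(2)[OF U hS]) (assumption, intro smooth_on_sum U(1) sSG)
    also have "\<dots> = (\<Sum>j\<in>UNIV. d l (d l (\<lambda>y. S i j y * G j i y)) 0)"
      unfolding d_def by (rule dird2_sum_smooth(2)[OF U(1) sSG U(2)])
    also have "\<dots> = (\<Sum>j\<in>UNIV. S i j 0 * d l (d l (G j i)) 0 + d l (S i j) 0 * d l (G j i) 0
        + (d l (S i j) 0 * d l (G j i) 0 + d l (d l (S i j)) 0 * G j i 0))"
      unfolding d_def by (simp only: dird2_bilinear_smooth[OF bounded_bilinear_mult U(1) S sG U(2)])
    also have "\<dots> = (\<Sum>j\<in>UNIV. if j = i then k i * d l (d l (G i i)) 0 + d l (d l (S i i)) 0 else 0)"
      unfolding dG G0 S0 by (intro sum.cong refl) simp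
    finally show ?thesis by simp
  qed
  have DDN: "mink (D l (D l N) 0) (N 0) = - (k l)\<^sup>2" "mink (D l (D l N) 0) (\<Phi> 0) = k l" for l
  proof -
    have NDN: "mink (N y) (D l N y) = 0" if "y \<in> U" for y
      using const[OF N N NN that, of l] by (simp add: mink_commute)
    show "mink (D l (D l N) 0) (N 0) = - (k l)\<^sup>2"
      using const[OF N sD[OF N] NDN U(2), of l] by (simp add: DN0 mB on power2_eq_square mink_commute[of "N 0"])
    show "mink (D l (D l N) 0) (\<Phi> 0) = k l"
      using const[OF \<Phi> sD[OF N] \<Phi>DN U(2), of l] by (simp add: DN0 mB on mink_commute[of "\<Phi> 0"])
  qed
  \<comment> \<open>\<open>t\<close> collects the fourth derivatives and \<open>b\<close> the third
    ones, the only terms not already expressed by \<open>k\<close> and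
    \<open>\<rho>\<close>.\<close>
  define t where "t = (\<lambda>i l. mink (N 0) (D l (D l (D i (D i \<Phi>))) 0))"
  define b where "b = (\<lambda>i l. mink (D l \<Phi> 0) (D l (D i (D i \<Phi>)) 0))"
  have ddh: "d l (d l (h i i)) 0 = t i l - 2 * k l * b i l - k l / \<rho>\<^sup>2 + k i * (k l)\<^sup>2" for i l
  proof -
    have "mink (D l (D l N) 0) (D i (D i \<Phi>) 0) = - k l / \<rho>\<^sup>2 + k i * (k l)\<^sup>2"
      unfolding DD\<Phi> by (simp add: mB DDN)
    then show ?thesis
      unfolding h_def m2[OF N sD[OF sD[OF \<Phi>]]] by (simp add: t_def b_def DN0 mB)
  qed
  \<comment> \<open>Off the diagonal the middle term of the second product rule is the square of
    \<open>D l (D i \<Phi>) 0\<close>, which is 0.\<close>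
  have ddG: "d l (d l (G i i)) 0 = 2 * b l i" if "i \<noteq> l" for i l
  proof -
    have c1: "D l (D i \<Phi>) y = D i (D l \<Phi>) y" if "y \<in> U" for y by (rule cD[OF \<Phi> that])
    have "D l (D l (D i \<Phi>)) 0 = D l (D i (D l \<Phi>)) 0" by (rule cD'[OF c1 sD[OF sD[OF \<Phi>]] U(2)])
    also have "\<dots> = D i (D l (D l \<Phi>)) 0" by (rule cD[OF sD[OF \<Phi>] U(2)])
    finally have c: "D l (D l (D i \<Phi>)) 0 = D i (D l (D l \<Phi>)) 0" .
    have "D l (D i \<Phi>) 0 = 0" unfolding DD\<Phi> using that by simp
    then show ?thesis unfolding G_def m2[OF sD[OF \<Phi>] sD[OF \<Phi>]] c
      by (simp add: b_def mink_commute bounded_bilinear.zero_left[OF bm])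
  qed
  have t_sym: "t i l = t l i" for i l
  proof -
    have c1: "D l (D i (D i \<Phi>)) y = D i (D i (D l \<Phi>)) y" if "y \<in> U" for y
    proof -
      have "D l (D i (D i \<Phi>)) y = D i (D l (D i \<Phi>)) y" by (rule cD[OF sD[OF \<Phi>] that])
      also have "\<dots> = D i (D i (D l \<Phi>)) y" by (rule cD'[OF cD[OF \<Phi>] sD[OF sD[OF \<Phi>]] that])
      finally show ?thesis .
    qed
    have c2: "D l (D i (D l \<Phi>)) y = D i (D l (D l \<Phi>)) y" if "y \<in> U" for y by (rule cD[OF sD[OF \<Phi>] that])
    have "D l (D l (D i (D i \<Phi>))) 0 = D l (D i (D i (D l \<Phi>))) 0"
      by (rule cD'[OF c1 sD[OF sD[OF sD[OF \<Phi>]]] U(2)])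
    also have "\<dots> = D i (D l (D i (D l \<Phi>))) 0" by (rule cD[OF sD[OF sD[OF \<Phi>]] U(2)])
    also have "\<dots> = D i (D i (D l (D l \<Phi>))) 0" by (rule cD'[OF c2 sD[OF sD[OF sD[OF \<Phi>]]] U(2)])
    finally show ?thesis by (simp add: t_def)
  qed
  define w where "w = (\<lambda>i l. d l (d l (S i i)) 0)"
  \<comment> \<open>The third derivatives occur as -2 (k_l b_il + k_i b_li), symmetric in
    \<open>i\<close> and \<open>l\<close>, and so does \<open>t\<close>. Only the explicit terms in
    \<open>k\<close> and \<open>\<rho>\<close> are left in the difference.\<close>
  have w: "w i l - w l i = (k i - k l) * (1 / \<rho>\<^sup>2 - k i * k l)" if "i \<noteq> l" for i l
    unfolding w_def ddS ddh ddG[OF that] ddG[OF not_sym[OF that]] t_sym[of i l]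
    by (simp add: algebra_simps power2_eq_square diff_divide_distrib)
  have sH: "smooth_on U H" unfolding H_def by (intro smooth_on_sum U(1) S)
  have ddH: "d l (d l H) 0 = (\<Sum>i\<in>UNIV. w i l)" for l
    unfolding H_def w_def d_def by (rule dird2_sum_smooth(2)[OF U(1) S U(2)])
  have sSS: "smooth_on U (\<lambda>y. S i j y * S j i y)" for i j
    by (rule smooth_on_bilinear[OF bounded_bilinear_mult U(1) S S])
  have sSS': "smooth_on U (\<lambda>y. \<Sum>j\<in>UNIV. S i j y * S j i y)" for i by (intro smooth_on_sum U(1) sSS)
  have ddSS: "d l (d l (\<lambda>y. \<Sum>i\<in>UNIV. \<Sum>j\<in>UNIV. S i j y * S j i y)) 0
      = 2 * ((\<Sum>i\<in>UNIV. k i * w i l) + (\<Sum>i\<in>UNIV. \<Sum>j\<in>UNIV. (d l (S i j) 0)\<^sup>2))" for l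
  proof -
    have "d l (d l (\<lambda>y. \<Sum>i\<in>UNIV. \<Sum>j\<in>UNIV. S i j y * S j i y)) 0
        = (\<Sum>i\<in>UNIV. \<Sum>j\<in>UNIV. d l (d l (\<lambda>y. S i j y * S j i y)) 0)"
      unfolding d_def by (simp only: dird2_sum_smooth(2)[OF U(1) sSS' U(2)] dird2_sum_smooth(2)[OF U(1) sSS U(2)])
    also have "\<dots> = (\<Sum>i\<in>UNIV. \<Sum>j\<in>UNIV. S i j 0 * d l (d l (S j i)) 0 + d l (S i j) 0 * d l (S j i) 0
        + (d l (S i j) 0 * d l (S j i) 0 + d l (d l (S i j)) 0 * S j i 0))"
      unfolding d_def by (simp only: dird2_bilinear_smooth[OF bounded_bilinear_mult U(1) S S U(2)])
    also have "\<dots> = (\<Sum>i\<in>UNIV. \<Sum>j\<in>UNIV. (if j = i then 2 * (k i * w i l) else 0) + 2 * (d l (S i j) 0)\<^sup>2)"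
      by (intro sum.cong refl) (auto simp: S0 w_def power2_eq_square dS_sym)
    finally show ?thesis by (simp add: sum.distrib sum_distrib_left)
  qed
  have ddpsi: "d l (d l psi) 0 / 2 = H 0 * (\<Sum>i\<in>UNIV. w i l) + (d l H 0)\<^sup>2
      - (\<Sum>i\<in>UNIV. k i * w i l) - (\<Sum>i\<in>UNIV. \<Sum>j\<in>UNIV. (d l (S i j) 0)\<^sup>2)" for l
  proof -
    define f where "f = (\<lambda>y. \<Sum>i\<in>UNIV. \<Sum>j\<in>UNIV. S i j y * S j i y)"
    have psi_f: "psi = (\<lambda>y. H y * H y - f y)" by (simp add: psi_def f_def)
    have sf: "smooth_on U f" unfolding f_def by (intro smooth_on_sum U(1) sSS)
    have sHH: "smooth_on U (\<lambda>y. H y * H y)" by (rule smooth_on_bilinear[OF bounded_bilinear_mult U(1) sH sH])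
    have 1: "d l psi y = d l (\<lambda>y. H y * H y) y - d l f y" if "y \<in> U" for y
      unfolding psi_f by (rule d_diff[OF sHH sf that])
    have "d l (d l psi) 0 = d l (\<lambda>y. d l (\<lambda>y. H y * H y) y - d l f y) 0"
      by (rule cd'[OF 1 smooth_on_diff[OF U(1) sd[OF sHH] sd[OF sf]] U(2)])
    also have "\<dots> = d l (d l (\<lambda>y. H y * H y)) 0 - d l (d l f) 0"
      by (rule d_diff[OF sd[OF sHH] sd[OF sf] U(2)])
    also have "d l (d l (\<lambda>y. H y * H y)) 0 = H 0 * d l (d l H) 0 + d l H 0 * d l H 0 + (d l H 0 * d l H 0 + d l (d l H) 0 * H 0)"
      unfolding d_def by (rule dird2_bilinear_smooth[OF bounded_bilinear_mult U(1) sH sH U(2)])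
    finally show ?thesis
      unfolding f_def ddSS ddH by (simp add: power2_eq_square algebra_simps)
  qed
  have "(\<Sum>l\<in>UNIV. (H 0 - k l) * d l (d l H) 0) - (\<Sum>l\<in>UNIV. d l (d l psi) 0) / 2
      = (\<Sum>l\<in>UNIV. (H 0 - k l) * (\<Sum>i\<in>UNIV. w i l) - d l (d l psi) 0 / 2)"
    unfolding ddH by (simp add: sum_subtractf sum_divide_distrib)
  \<comment> \<open>The terms with the factor \<open>H 0\<close> cancel, which leaves the
    antisymmetric weights \<open>k i - k l\<close>.\<close>
  also have "\<dots> = (\<Sum>l\<in>UNIV. (\<Sum>i\<in>UNIV. (k i - k l) * w i l) - (d l H 0)\<^sup>2 + (\<Sum>i\<in>UNIV. \<Sum>j\<in>UNIV. (d l (S i j) 0)\<^sup>2))"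
    unfolding ddpsi by (intro sum.cong refl) (simp add: left_diff_distrib sum_subtractf sum_distrib_left)
  also have "\<dots> = (\<Sum>l\<in>UNIV. \<Sum>i\<in>UNIV. (k i - k l) * w i l) - (\<Sum>l\<in>UNIV. (d l H 0)\<^sup>2)
      + (\<Sum>l\<in>UNIV. \<Sum>i\<in>UNIV. \<Sum>j\<in>UNIV. (d l (S i j) 0)\<^sup>2)"
    by (simp only: sum.distrib sum_subtractf)
  finally show ?thesis
    using antisymmetrized_sum[where W = w and k = k and c = "1 / \<rho>\<^sup>2", OF w] by linarith
qed

subsection \<open>Adapted coordinates\<close>

text \<open>Were the second derivative positive, the first would be positive just beyond
  \<open>x\<close> along \<open>v\<close>, and the mean value theorem would give a larger value
  there.\<close>

lemma interior_maximum:
  fixes f :: "'a::euclidean_space \<Rightarrow> real"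
  assumes U: "open U" "x \<in> U" and f: "smooth_on U f" and max: "\<And>y. y \<in> U \<Longrightarrow> f y \<le> f x"
  shows "dird f v x = 0" "dird (dird f v) v x \<le> 0"
proof -
  show z: "dird f v x = 0"
    using differential_zero_maxmin[OF U(2,1) smooth_has_derivative[OF f U(2)]] max by (metis (mono_tags))
  have "open ((\<lambda>t :: real. x + t *\<^sub>R v) -` U)" by (intro open_vimage U continuous_intros)
  moreover have "0 \<in> (\<lambda>t :: real. x + t *\<^sub>R v) -` U" using U by simp
  ultimately obtain r where r: "r > 0" "ball 0 r \<subseteq> (\<lambda>t :: real. x + t *\<^sub>R v) -` U"
    using open_contains_ball by blast
  have inU: "x + t *\<^sub>R v \<in> U" if "\<bar>t\<bar> < r" for t using r(2) that by (auto simp: dist_real_def)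
  show "dird (dird f v) v x \<le> 0"
  proof (rule ccontr)
    assume "\<not> ?thesis"
    then have pos: "dird (dird f v) v x > 0" by simp
    have "((\<lambda>t. dird f v (x + t *\<^sub>R v)) has_real_derivative dird (dird f v) v (x + 0 *\<^sub>R v)) (at 0)"
      using smooth_onD(1)[OF smooth_onD(2)[OF f] U(2)] by (intro line_has_real_derivative) simp
    from DERIV_pos_inc_right[OF this] pos obtain d where d: "d > 0" "\<And>h. h > 0 \<Longrightarrow> h < d \<Longrightarrow> dird f v (x + h *\<^sub>R v) > 0"
      using z by auto
    define t where "t = min d r / 2"
    have t: "t > 0" "t < d" "t < r" using d(1) r(1) by (auto simp: t_def)
    have "((\<lambda>t. f (x + t *\<^sub>R v)) has_real_derivative dird f v (x + s *\<^sub>R v)) (at s)" if "0 \<le> s" "s \<le> t" for s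
      using inU[of s] that t by (intro line_has_real_derivative smooth_onD(1)[OF f]) auto
    from MVT2[OF t(1) this] obtain s where s: "0 < s" "s < t" "f (x + t *\<^sub>R v) - f (x + 0 *\<^sub>R v) = (t - 0) * dird f v (x + s *\<^sub>R v)"
      by auto
    have "f (x + t *\<^sub>R v) - f x > 0" using s d(2)[of s] t by simp
    moreover have "f (x + t *\<^sub>R v) \<le> f x" using inU[of t] t by (intro max) auto
    ultimately show False by simp
  qed
qed

lemma tangent_space_open:
  assumes "open U" "y \<in> U"
  shows "v \<in> tangent_space U y"
proof -
  \<comment> \<open>The curve has to remain in \<open>U\<close> for all times, so the straight line
    is replaced by the constant \<open>y\<close> wherever it leaves \<open>U\<close>; near time 0
    nothing changes.\<close>
  define c where "c = (\<lambda>t :: real. if y + t *\<^sub>R v \<in> U then y + t *\<^sub>R v else y)"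
  have 1: "((\<lambda>t :: real. y + t *\<^sub>R v) has_vector_derivative v) (at 0)"
    by (auto intro!: derivative_eq_intros)
  have o: "open ((\<lambda>t :: real. y + t *\<^sub>R v) -` U)" by (intro open_vimage assms continuous_intros)
  have "(c has_vector_derivative v) (at 0)"
    by (rule has_vector_derivative_transform_within_open[OF 1 o]) (use assms(2) in \<open>auto simp: c_def\<close>)
  then show ?thesis unfolding tangent_space_def
    using assms by (intro CollectI exI[of _ c]) (auto simp: c_def)
qed

text \<open>An open set is a submanifold with all vectors tangent, so the chain rule for
  \<open>tderiv\<close> becomes one for ordinary derivatives in coordinates.\<close>

lemma dird_chain_manifold:
  fixes U :: "'a::euclidean_space set" and c :: "'a \<Rightarrow> 'b::euclidean_space" and Z :: "'b \<Rightarrow> 'c::euclidean_space"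
  assumes U: "open U" "y \<in> U" and c: "smooth_on U c" "c ` U \<subseteq> M" and Z: "smooth_map_on M Z"
  shows "dird c v y \<in> tangent_space M (c y)" "dird (\<lambda>y. Z (c y)) v y = tderiv M Z (c y) (dird c v y)"
    "smooth_on U (\<lambda>y. Z (c y))"
proof -
  note v = tangent_space_open[OF U, of v]
  have sc: "smooth_map_on U c" by (rule smooth_map_on_restrict[OF U(1) subset_refl c(1)])
  have tc: "tderiv U c y v = dird c v y" by (rule tderiv_smooth[OF U(1) subset_refl c(1) v])
  show sZ: "smooth_on U (\<lambda>y. Z (c y))" by (rule smooth_map_on_open[OF U(1) smooth_map_on_compose[OF sc c(2) Z]])
  show "dird c v y \<in> tangent_space M (c y)" using tderiv_tangent[OF sc c(2) v] by (simp only: tc)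
  show "dird (\<lambda>y. Z (c y)) v y = tderiv M Z (c y) (dird c v y)"
    using tderiv_chain[OF sc c(2) Z v] tderiv_smooth[OF U(1) subset_refl sZ v] by (simp only: tc)
qed

text \<open>The map \<open>radial\<close> is the identity on the sphere, so tangent vectors are
  preserved, and constant on rays, so the direction \<open>q\<close> is killed.\<close>

lemma dird_radial:
  assumes "q \<in> (Sn :: ('n::finite) euc set)"
  shows "dird radial v q = sph.proj v q"
proof -
  have qq: "q \<bullet> q = 1" using assms by (simp add: Sn_eq)
  have q0: "q \<in> - {0}" using Sn_nonzero[OF assms] by simp
  have dr: "radial differentiable (at q)" by (rule smooth_onD(1)[OF smooth_on_radial q0])
  have t: "sph.proj v q \<in> tangent_space Sn q" by (rule proj_Sn_tangent[OF assms])
  have "tderiv Sn (\<lambda>x. x) q (sph.proj v q) = dird radial (sph.proj v q) q"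
    by (rule tderiv_eq[OF t open_nonzero q0 dr]) (rule radial_id)
  then have 1: "dird radial (sph.proj v q) q = sph.proj v q" by (simp add: tderiv_id[OF t])
  have "((\<lambda>t. radial (q + t *\<^sub>R q)) has_vector_derivative 0) (at 0)"
  proof (rule has_vector_derivative_transform_within_open[OF has_vector_derivative_const, of "{-1<..}"])
    fix t :: real assume "t \<in> {-1<..}"
    then have t: "1 + t > 0" by simp
    have "q + t *\<^sub>R q = (1 + t) *\<^sub>R q" by (simp add: algebra_simps)
    moreover have "sqrt (((1 + t) *\<^sub>R q) \<bullet> ((1 + t) *\<^sub>R q)) = 1 + t" using t qq by simp
    ultimately have "radial (q + t *\<^sub>R q) = q" unfolding radial_def using t by simp
    then show "q = radial (q + t *\<^sub>R q)" by simp
  qed auto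
  moreover have "((\<lambda>t. radial (q + t *\<^sub>R q)) has_vector_derivative dird radial q q) (at 0)"
  proof -
    have "((\<lambda>t :: real. q + t *\<^sub>R q) has_derivative (\<lambda>t. t *\<^sub>R q)) (at 0)"
      by (auto intro!: derivative_eq_intros)
    from has_derivative_compose[OF this, of radial "\<lambda>v. dird radial v q"] dird_has_derivative[OF dr]
    show ?thesis by (simp add: has_vector_derivative_def linear_cmul[OF dird_linear[OF dr]])
  qed
  ultimately have 2: "dird radial q q = 0" by (rule vector_derivative_unique_at[rotated])
  have "v = sph.proj v q + (q \<bullet> v) *\<^sub>R q" by (simp add: sph.proj_def)
  then have "dird radial v q = dird radial (sph.proj v q) q + (q \<bullet> v) *\<^sub>R dird radial q q"
    by (metis linear_add[OF dird_linear[OF dr]] linear_cmul[OF dird_linear[OF dr]])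
  then show ?thesis by (simp add: 1 2)
qed

lemma radial_image: "radial ` (- {0}) \<subseteq> (Sn :: ('n::finite) euc set)"
  by (rule image_subsetI) (simp add: radial_Sn)

definition ext :: "('a::real_inner \<Rightarrow> 'b) \<Rightarrow> 'a \<Rightarrow> 'b" where "ext f x = f (radial x)"

lemma smooth_ext: "smooth_map_on (Sn :: ('n::finite) euc set) f \<Longrightarrow> smooth_on (- {0}) (ext f)"
  unfolding ext_def[abs_def] by (rule smooth_on_radial_ext)

lemma smooth_map_on_ext_dird2:
  assumes "smooth_map_on (Sn :: ('n::finite) euc set) f"
  shows "smooth_map_on Sn (dird (ext f) u)" "smooth_map_on Sn (dird (dird (ext f) u) v)"
  by (rule smooth_map_on_restrict[OF open_nonzero _ smooth_onD(2)[OF smooth_ext[OF assms]]],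
      use Sn_nonzero in blast)
     (rule smooth_map_on_restrict[OF open_nonzero _ smooth_onD(2)[OF smooth_onD(2)[OF smooth_ext[OF assms]]]],
      use Sn_nonzero in blast)

lemma dird2_basis:
  fixes f :: "'a::euclidean_space \<Rightarrow> 'b::real_normed_vector"
  assumes U: "open U" "x \<in> U" and f: "smooth_on U f"
  shows "dird (dird f u) v x = (\<Sum>b\<in>Basis. (u \<bullet> b) *\<^sub>R dird (dird f b) v x)"
proof -
  have s: "smooth_on U (\<lambda>y. (u \<bullet> b) *\<^sub>R dird f b y)" for b
    by (rule smooth_on_bilinear[OF bounded_bilinear_scaleR U(1) smooth_on_const smooth_onD(2)[OF f]])
  have "dird (dird f u) v x = dird (\<lambda>y. \<Sum>b\<in>Basis. (u \<bullet> b) *\<^sub>R dird f b y) v x"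
    by (rule dird2_cong_open(1)[OF U dird_basis[OF smooth_onD(1)[OF f]]]) (assumption, intro smooth_on_sum U(1) s)
  also have "\<dots> = (\<Sum>b\<in>Basis. dird (\<lambda>y. (u \<bullet> b) *\<^sub>R dird f b y) v x)" by (rule dird2_sum_smooth(1)[OF U(1) s U(2)])
  also have "\<dots> = (\<Sum>b\<in>Basis. (u \<bullet> b) *\<^sub>R dird (dird f b) v x)"
    by (simp add: dird_bilinear_smooth[OF bounded_bilinear_scaleR smooth_on_const smooth_onD(2)[OF f] U(2)])
  finally show ?thesis .
qed

context embedding
begin

lemma dird_ext_X: "p \<in> Sn \<Longrightarrow> dird (ext X) v p = J p v"
  using dird_chain_manifold(2)[OF open_nonzero _ smooth_on_radial radial_image X_smooth, of p v] Sn_nonzero[of p]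
  by (simp add: ext_def[abs_def] dird_radial radial_id J_def)

text \<open>The right-hand side mentions only \<open>g\<close>: the tangential part of the second
  derivatives of \<open>ext X\<close> is therefore the same for all isometric embeddings of
  \<open>g\<close>. This makes the coordinates below comparable between embeddings.\<close>

lemma christoffel:
  assumes p: "p \<in> Sn" and v: "v \<in> T p"
  shows "pull p (dird (dird (ext X) u) v p) = levi_civita Sn g (sph.proj v) (sph.proj u) p"
proof -
  have "tderiv Sn (DX (sph.proj u)) p v = dird (dird (ext X) u) v p"
  proof (rule tderiv_eq[OF v open_nonzero])
    show "p \<in> - {0}" using Sn_nonzero[OF p] by simp
    then show "dird (ext X) u differentiable (at p)"
      by (rule smooth_onD(1)[OF smooth_onD(2)[OF smooth_ext[OF X_smooth]]])
  qed (simp add: dird_ext_X J_proj)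
  then show ?thesis
    by (simp add: levi_civita_eq[OF proj_Sn_field proj_Sn_field p] lc_def proj_Sn_id[OF p v])
qed

end

section \<open>Coordinates normal to first order at a point\<close>

locale adapted_frame = embedding g \<rho> X for g :: "('n::finite) euc form2" and \<rho> X +
  fixes p :: "'n euc" and e :: "'n \<Rightarrow> 'n euc" and k :: "'n \<Rightarrow> real"
  assumes p: "p \<in> Sn" and eT: "\<And>i. e i \<in> T p"
    and on: "\<And>i j. g p (e i) (e j) = (if i = j then 1 else 0)"
    and shape_e: "\<And>i. shape p (e i) = k i *\<^sub>R e i"
    and expansion: "\<And>u. u \<in> T p \<Longrightarrow> u = (\<Sum>i\<in>UNIV. g p u (e i) *\<^sub>R e i)"
begin

text \<open>By \<open>christoffel\<close> these are minus the Christoffel symbols of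
  \<open>g\<close> at \<open>p\<close>, contracted with the frame.\<close>

definition w :: "'n \<Rightarrow> 'n \<Rightarrow> 'n euc" where "w i j = - pull p (dird (dird (ext X) (e i)) (e j) p)"

lemma p0: "p \<in> - {0}"
  using Sn_nonzero[OF p] by simp

lemma w_sym: "w i j = w j i"
  unfolding w_def dird_commute[OF open_nonzero smooth_ext[OF X_smooth] p0, of "e i"] ..

text \<open>The quadratic part of \<open>q\<close> cancels the Christoffel symbols of \<open>g\<close> at \<open>p\<close>.\<close>

definition q :: "real ^ 'n \<Rightarrow> 'n euc" where
  "q y = p + (\<Sum>i\<in>UNIV. y $ i *\<^sub>R e i) + (1 / 2) *\<^sub>R (\<Sum>i\<in>UNIV. \<Sum>j\<in>UNIV. (y $ i * y $ j) *\<^sub>R w i j)"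

definition dq :: "'n \<Rightarrow> real ^ 'n \<Rightarrow> 'n euc" where
  "dq i y = e i + (\<Sum>j\<in>UNIV. y $ j *\<^sub>R w i j)"

lemma q_0: "q 0 = p" and dq_0: "dq i 0 = e i"
  by (simp_all add: q_def dq_def)

lemma smooth_nth: "smooth_on U (\<lambda>y :: real ^ 'n. y $ i)"
  by (rule smooth_on_linear[OF bounded_linear_vec_nth])

lemma smooth_q: "open U \<Longrightarrow> smooth_on U q" and smooth_dq: "open U \<Longrightarrow> smooth_on U (dq i)"
  unfolding q_def[abs_def] dq_def[abs_def]
  by (intro smooth_on_add smooth_on_sum smooth_on_bilinear[OF bounded_bilinear_scaleR]
      smooth_on_bilinear[OF bounded_bilinear_mult] smooth_on_const smooth_nth; assumption)+

lemma dird_q: "dird q (axis i 1) y = dq i y"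
proof -
  have n: "((\<lambda>y :: real ^ 'n. y $ i) has_derivative (\<lambda>v. v $ i)) (at y)" for i y
    by (rule bounded_linear_imp_has_derivative[OF bounded_linear_vec_nth])
  have "(q has_derivative (\<lambda>v. 0 + (\<Sum>i\<in>UNIV. v $ i *\<^sub>R e i)
      + (1 / 2) *\<^sub>R (\<Sum>i\<in>UNIV. \<Sum>j\<in>UNIV. (y $ i * v $ j + v $ i * y $ j) *\<^sub>R w i j))) (at y)"
    unfolding q_def[abs_def]
    by (intro has_derivative_add has_derivative_const has_derivative_sum has_derivative_scaleR_left
        has_derivative_scaleR_right has_derivative_mult n)
  from dird_eqI[OF this, of "axis i 1"]
  have "dird q (axis i 1) y = (\<Sum>j\<in>UNIV. (axis i 1 $ j) *\<^sub>R e j)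
      + (1 / 2) *\<^sub>R (\<Sum>l\<in>UNIV. \<Sum>j\<in>UNIV. (y $ l * axis i 1 $ j + axis i 1 $ l * y $ j) *\<^sub>R w l j)" by simp
  also have "(\<Sum>j\<in>UNIV. (axis i 1 $ j) *\<^sub>R e j) = e i"
    by (simp add: axis_def if_distrib[of "\<lambda>x. x *\<^sub>R _"] cong: if_cong)
  also have "(\<Sum>l\<in>UNIV. \<Sum>j\<in>UNIV. (y $ l * axis i 1 $ j + axis i 1 $ l * y $ j) *\<^sub>R w l j)
      = (\<Sum>l\<in>UNIV. \<Sum>j\<in>UNIV. (if j = i then y $ l *\<^sub>R w l i else 0) + (if l = i then y $ j *\<^sub>R w i j else 0))"
    by (intro sum.cong refl) (auto simp: axis_def scaleR_left_distrib)
  also have "\<dots> = (\<Sum>l\<in>UNIV. \<Sum>j\<in>UNIV. if j = i then y $ l *\<^sub>R w l i else 0)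
      + (\<Sum>j\<in>UNIV. \<Sum>l\<in>UNIV. if l = i then y $ j *\<^sub>R w i j else 0)"
    by (subst (2) sum.swap) (simp only: sum.distrib)
  \<comment> \<open>By symmetry of \<open>w\<close> the two sums agree; the factor 1/2 in
    \<open>q\<close> absorbs the doubling.\<close>
  also have "\<dots> = (\<Sum>l\<in>UNIV. y $ l *\<^sub>R w i l) + (\<Sum>j\<in>UNIV. y $ j *\<^sub>R w i j)"
    by (simp add: w_sym[of _ i])
  finally show ?thesis by (simp add: dq_def scaleR_2[symmetric])
qed

lemma dird_dq: "dird (dq i) (axis j 1) y = w i j"
proof -
  have "(dq i has_derivative (\<lambda>v. 0 + (\<Sum>j\<in>UNIV. v $ j *\<^sub>R w i j))) (at y)"
    unfolding dq_def[abs_def]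
    by (intro has_derivative_add has_derivative_const has_derivative_sum has_derivative_scaleR_left
        bounded_linear_imp_has_derivative[OF bounded_linear_vec_nth])
  from dird_eqI[OF this, of "axis j 1"] show ?thesis
    by (simp add: axis_def if_distrib[of "\<lambda>x. x *\<^sub>R _"] cong: if_cong)
qed

definition U where "U = {y. q y \<noteq> 0}"

lemma U: "open U" "0 \<in> U" "q ` U \<subseteq> - {0}"
proof -
  have "open (q -` (- {0}))"
    using continuous_open_preimage[OF smooth_onD(3)[OF smooth_q[OF open_UNIV]] open_UNIV open_nonzero] by simp
  then show "open U" by (simp add: U_def vimage_def Compl_eq)
qed (use p0 in \<open>auto simp: U_def q_0\<close>)

text \<open>The quadratic part of \<open>q\<close> adds the derivative of \<open>F\<close> along
  \<open>w i j\<close>. For \<open>ext X\<close> this removes the tangential part of the second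
  derivative; for \<open>ext psi\<close> it gives the covariant Hessian.\<close>

lemma dird2_q:
  fixes F :: "'n euc \<Rightarrow> 'b::real_normed_vector"
  assumes F: "smooth_on (- {0}) F"
  shows "dird (\<lambda>y. F (q y)) (axis i 1) 0 = dird F (e i) p"
    "dird (dird (\<lambda>y. F (q y)) (axis i 1)) (axis j 1) 0 = dird (dird F (e i)) (e j) p + dird F (w i j) p"
proof -
  have qU: "q y \<in> - {0}" if "y \<in> U" for y using that by (auto simp: U_def)
  have dFq: "dird (\<lambda>y. G (q y)) (axis j 1) y = dird G (dq j y) (q y)"
    if G: "smooth_on (- {0}) G" and y: "y \<in> U" for G :: "'n euc \<Rightarrow> 'b" and y j
    using dird_compose[OF smooth_onD(1)[OF G qU[OF y]] smooth_onD(1)[OF smooth_q[OF U(1)] y]] by (simp only: dird_q)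
  show "dird (\<lambda>y. F (q y)) (axis i 1) 0 = dird F (e i) p"
    unfolding dFq[OF F U(2)] q_0 dq_0 ..
  have s1: "smooth_on U (\<lambda>y. dq i y \<bullet> b)" for b
    by (rule smooth_on_linear_compose[OF U(1) bounded_linear_inner_left smooth_dq[OF U(1)]])
  have s2: "smooth_on U (\<lambda>y. dird F b (q y))" for b
    by (rule smooth_on_compose[OF U(1) smooth_q[OF U(1)] U(3) smooth_onD(2)[OF F]])
  have s: "smooth_on U (\<lambda>y. (dq i y \<bullet> b) *\<^sub>R dird F b (q y))" for b
    by (rule smooth_on_bilinear[OF bounded_bilinear_scaleR U(1) s1 s2])
  have eq: "dird (\<lambda>y. F (q y)) (axis i 1) y = (\<Sum>b\<in>Basis. (dq i y \<bullet> b) *\<^sub>R dird F b (q y))" if "y \<in> U" for y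
    unfolding dFq[OF F that] by (rule dird_basis[OF smooth_onD(1)[OF F qU[OF that]]])
  have "dird (dird (\<lambda>y. F (q y)) (axis i 1)) (axis j 1) 0 = dird (\<lambda>y. \<Sum>b\<in>Basis. (dq i y \<bullet> b) *\<^sub>R dird F b (q y)) (axis j 1) 0"
    by (rule dird2_cong_open(1)[OF U(1,2) eq]) (assumption, intro smooth_on_sum U(1) s)
  also have "\<dots> = (\<Sum>b\<in>Basis. dird (\<lambda>y. (dq i y \<bullet> b) *\<^sub>R dird F b (q y)) (axis j 1) 0)"
    by (rule dird2_sum_smooth(1)[OF U(1) s U(2)])
  also have "\<dots> = (\<Sum>b\<in>Basis. (e i \<bullet> b) *\<^sub>R dird (dird F b) (e j) p + (w i j \<bullet> b) *\<^sub>R dird F b p)"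
    by (simp only: dird_bilinear_smooth[OF bounded_bilinear_scaleR s1 s2 U(2)] dFq[OF smooth_onD(2)[OF F] U(2)]
        dird_linear_compose[OF bounded_linear_inner_left smooth_onD(1)[OF smooth_dq[OF U(1)] U(2)]] dird_dq q_0 dq_0)
  also have "\<dots> = dird (dird F (e i)) (e j) p + dird F (w i j) p"
    unfolding sum.distrib dird2_basis[OF open_nonzero p0 F, of "e i"] dird_basis[OF smooth_onD(1)[OF F p0], of "w i j"] ..
  finally show "dird (dird (\<lambda>y. F (q y)) (axis i 1)) (axis j 1) 0 = dird (dird F (e i)) (e j) p + dird F (w i j) p" .
qed

text \<open>\<open>q\<close> is polynomial but leaves the sphere, so it is retracted. Since
  \<open>ext f (q y) = f (\<gamma> y)\<close>, derivatives along \<gamma> can be computed with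
  \<open>q\<close>.\<close>

definition \<gamma> where "\<gamma> y = radial (q y)"

lemma smooth_\<gamma>: "smooth_on U \<gamma>"
  unfolding \<gamma>_def[abs_def] by (rule smooth_on_compose[OF U(1) smooth_q[OF U(1)] U(3) smooth_on_radial])

lemma \<gamma>_Sn: "\<gamma> ` U \<subseteq> Sn"
  by (rule image_subsetI) (simp add: \<gamma>_def radial_Sn U_def)

lemma \<gamma>_0: "\<gamma> 0 = p"
  by (simp add: \<gamma>_def q_0 radial_id[OF p])

lemmas chain = dird_chain_manifold[OF U(1) _ smooth_\<gamma> \<gamma>_Sn]

definition c where "c i y = dird \<gamma> (axis i 1) y"

lemma c_T: "y \<in> U \<Longrightarrow> c i y \<in> T (\<gamma> y)"
  unfolding c_def by (rule chain(1)[OF _ smooth_map_on_id])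

lemma smooth_c: "smooth_on U (c i)"
  unfolding c_def[abs_def] by (rule smooth_onD(2)[OF smooth_\<gamma>])

lemma c_0: "c i 0 = e i"
  using dird2_q(1)[OF smooth_on_radial, of i] dird_radial[OF p] proj_Sn_id[OF p eT]
  by (simp add: c_def \<gamma>_def[abs_def])

text \<open>The coordinate vectors \<open>c i\<close>, completed by the radial vector
  \<open>\<gamma> y\<close> to an endomorphism of the ambient space; its inverse reads off
  coordinates smoothly in \<open>y\<close>.\<close>

definition C :: "real ^ 'n \<Rightarrow> 'n euc \<Rightarrow> 'n euc" where
  "C y v = (\<Sum>i\<in>UNIV. fst v $ i *\<^sub>R c i y) + snd v *\<^sub>R \<gamma> y"

lemma linear_C: "linear (C y)"
  by (rule linearI) (simp_all add: C_def scaleR_left_distrib sum.distrib scaleR_sum_right scaleR_right_distrib)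

lemma smooth_C: "smooth_on U (\<lambda>y. C y v)"
  unfolding C_def
  by (intro smooth_on_add U(1) smooth_on_sum smooth_on_bilinear[OF bounded_bilinear_scaleR] smooth_on_const smooth_c smooth_\<gamma>)

lemma frame_orthogonal:
  assumes "(\<Sum>i\<in>UNIV. a i *\<^sub>R e i) + s *\<^sub>R p = 0"
  shows "s = 0" "a i = 0"
proof -
  have pe: "e i \<bullet> p = 0" "p \<bullet> e i = 0" for i using eT[of i] by (simp_all add: tangent_space_Sn[OF p] inner_commute)
  have "((\<Sum>i\<in>UNIV. a i *\<^sub>R e i) + s *\<^sub>R p) \<bullet> p = s"
    using p by (simp add: inner_simps inner_sum_left pe Sn_eq)
  then show s: "s = 0" using assms by simp
  have "0 = mink (J p (\<Sum>j\<in>UNIV. a j *\<^sub>R e j)) (J p (e i))"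
    using assms s linear_0[OF linear_J[OF p]] by (simp add: dS.B_simps)
  also have "\<dots> = (\<Sum>j\<in>UNIV. a j * g p (e j) (e i))"
    by (simp add: linear_sum[OF linear_J[OF p]] linear_cmul[OF linear_J[OF p]]
        bounded_bilinear.sum_left[OF bounded_bilinear_mink] dS.B_simps J_J[OF eT eT])
  also have "\<dots> = a i" by (simp add: on if_distrib[of "(*) _"] cong: if_cong)
  finally show "a i = 0" by simp
qed

lemma inj_C_0: "inj (C 0)"
proof (rule linear_injective_0[OF linear_C, THEN iffD2], intro allI impI)
  fix v assume "C 0 v = 0"
  then have "(\<Sum>i\<in>UNIV. fst v $ i *\<^sub>R e i) + snd v *\<^sub>R p = 0" by (simp add: C_def c_0 \<gamma>_0)
  from frame_orthogonal[OF this] show "v = 0" by (simp add: prod_eq_iff vec_eq_iff)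
qed

end

subsection \<open>The estimate at a maximum of the mean curvature\<close>

lemma trace_commute:
  fixes f h :: "'a::euclidean_space \<Rightarrow> 'a"
  assumes "linear f" "linear h"
  shows "(\<Sum>b\<in>Basis. f (h b) \<bullet> b) = (\<Sum>b\<in>Basis. h (f b) \<bullet> b)"
proof -
  have *: "(\<Sum>b\<in>Basis. f (h b) \<bullet> b) = (\<Sum>b\<in>Basis. \<Sum>c\<in>Basis. (h b \<bullet> c) * (f c \<bullet> b))"
    if "linear f" for f h :: "'a \<Rightarrow> 'a"
  proof (rule sum.cong[OF refl])
    fix b :: 'a
    show "f (h b) \<bullet> b = (\<Sum>c\<in>Basis. (h b \<bullet> c) * (f c \<bullet> b))"
      unfolding linear_basis_expansion[OF that, of "h b"] by (simp add: inner_sum_left)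
  qed
  show ?thesis unfolding *[OF assms(1)] *[OF assms(2)] by (subst sum.swap) (simp add: mult.commute)
qed

lemma sum_Basis_euc:
  fixes f :: "('n::finite) euc \<Rightarrow> real"
  shows "sum f Basis = (\<Sum>i\<in>UNIV. f (axis i 1, 0)) + f (0, 1)"
proof -
  have 1: "(Basis :: (real ^ 'n) set) = (\<lambda>i. axis i 1) ` UNIV" by (auto simp: Basis_vec_def)
  have i1: "inj (\<lambda>i :: 'n. axis i (1 :: real))" by (rule injI) (simp add: axis_eq_axis)
  have 2: "(Basis :: 'n euc set) = (\<lambda>u. (u, 0)) ` Basis \<union> {(0, 1)}" by (auto simp: Basis_prod_def)
  have "sum f Basis = sum f ((\<lambda>u. (u, 0)) ` Basis) + sum f {(0, 1)}"
    unfolding 2 by (rule sum.union_disjoint) auto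
  also have "sum f ((\<lambda>u. (u, 0)) ` Basis) = (\<Sum>u\<in>Basis. f (u, 0))"
    by (subst sum.reindex) (auto simp: inj_on_def)
  also have "\<dots> = (\<Sum>i\<in>UNIV. f (axis i 1, 0))" unfolding 1 by (subst sum.reindex[OF i1]) simp
  finally show ?thesis by simp
qed

context adapted_frame
begin

lemma smooth_shape_c: "smooth_on U (\<lambda>y. shape (\<gamma> y) (c i y))"
proof (rule smooth_on_cong)
  have "smooth_on U (\<lambda>y. shape (\<gamma> y) b)" for b
    by (rule chain(3)[OF U(2) smooth_shape[OF smooth_map_on_const]])
  then show "smooth_on U (\<lambda>y. \<Sum>b\<in>Basis. (c i y \<bullet> b) *\<^sub>R shape (\<gamma> y) b)"
    by (intro smooth_on_sum U(1) smooth_on_bilinear[OF bounded_bilinear_scaleR]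
        smooth_on_linear_compose[OF _ bounded_linear_inner_left] smooth_c)
  show "shape (\<gamma> y) (c i y) = (\<Sum>b\<in>Basis. (c i y \<bullet> b) *\<^sub>R shape (\<gamma> y) b)" if "y \<in> U" for y
    using \<gamma>_Sn that by (intro linear_basis_expansion linear_shape) auto
qed (rule U(1))

lemma dird_X_\<gamma>: "y \<in> U \<Longrightarrow> dird (\<lambda>y. X (\<gamma> y)) (axis i 1) y = J (\<gamma> y) (c i y)"
  using chain(2)[OF _ X_smooth, of y "axis i 1"] J_dX[OF c_T, of y i] by (simp add: c_def)

lemma dird_nu_\<gamma>: "y \<in> U \<Longrightarrow> dird (\<lambda>y. nu (\<gamma> y)) (axis i 1) y = - J (\<gamma> y) (shape (\<gamma> y) (c i y))"
  using chain(2)[OF _ smooth_nu, of y "axis i 1"] weingarten[OF c_T, of y i] by (simp add: c_def)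

text \<open>The correction \<open>w i j\<close> was chosen to cancel the tangential part, and
  pairing with \<open>J p v\<close> detects nothing else.\<close>

lemma normal_coordinates: "mink (dird (dird (\<lambda>y. X (\<gamma> y)) (axis i 1)) (axis j 1) 0) (J p v) = 0"
proof -
  have "dird (dird (\<lambda>y. X (\<gamma> y)) (axis i 1)) (axis j 1) 0
      = dird (dird (ext X) (e i)) (e j) p + J p (w i j)"
    using dird2_q(2)[OF smooth_ext[OF X_smooth], of i j] dird_ext_X[OF p, of "w i j"]
    by (simp add: ext_def \<gamma>_def)
  then show ?thesis
    by (simp add: w_def dS.B_simps linear_neg[OF linear_J[OF p]] J_pull[OF p])
qed

lemma decomposition_frame:
  assumes "\<And>l. mink z (J p (e l)) = 0"
  shows "z = (mink z (X p) / \<rho>\<^sup>2) *\<^sub>R X p - mink z (nu p) *\<^sub>R nu p"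
proof -
  have T0: "0 \<in> T p" by (rule subspace_0[OF subspace_tangent_Sn[OF p]])
  have "pull p z = 0"
  proof (rule pull_unique[OF T0])
    fix v assume v: "v \<in> T p"
    have "mink z (J p v) = mink z (J p (\<Sum>i\<in>UNIV. g p v (e i) *\<^sub>R e i))"
      using expansion[OF v] by (rule arg_cong)
    also have "\<dots> = (\<Sum>i\<in>UNIV. g p v (e i) * mink z (J p (e i)))"
      by (simp add: linear_sum[OF linear_J[OF p]] linear_cmul[OF linear_J[OF p]]
          bounded_bilinear.sum_right[OF bounded_bilinear_mink] dS.B_simps)
    finally show "g p 0 v = mink z (J p v)"
      unfolding J_J[OF T0 v, symmetric] by (simp add: assms linear_0[OF linear_J[OF p]] dS.B_simps)
  qed
  then show ?thesis using decomposition[OF p, of z] by (simp add: linear_0[OF linear_J[OF p]])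
qed

text \<open>The sum on the right is the Laplacian of \<open>psi\<close> at \<open>p\<close>, the
  trace of its covariant Hessian in the principal frame. The left factor is what the curvature term
  leaves for the squared norm.\<close>

lemma maximum_estimate:
  assumes max: "\<And>x. x \<in> Sn \<Longrightarrow> mean x \<le> mean p"
    and k: "mean p = (\<Sum>i\<in>UNIV. k i)" "sq p = (\<Sum>i\<in>UNIV. (k i)\<^sup>2)" and pos: "mean p > 0" "psi p > 0"
  shows "sq p * ((real CARD('n) - 1) / \<rho>\<^sup>2 - psi p / 2)
    \<le> psi p / \<rho>\<^sup>2 - (\<Sum>l\<in>UNIV. dird (dird (ext psi) (e l)) (e l) p + dird (ext psi) (w l l) p) / 2"
proof -
  \<comment> \<open>The lower bound for \<open>C\<close> at 0 persists on \<open>V\<close>, so the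
    vectors \<open>c i y\<close> stay a frame there.\<close>
  obtain r V where V: "r > 0" "open V" "0 \<in> V" "V \<subseteq> U" "\<And>y v. y \<in> V \<Longrightarrow> r * norm v \<le> norm (C y v)"
    using linear_lower_bound_nearby[of U 0 C, OF U(1,2) linear_C inj_C_0 smooth_onD(3)[OF smooth_C]] by metis
  have VU: "y \<in> U" if "y \<in> V" for y using that V(4) by blast
  have \<gamma>S: "\<gamma> y \<in> Sn" if "y \<in> V" for y using \<gamma>_Sn VU[OF that] by blast
  have inj: "inj (C y)" if y: "y \<in> V" for y
  proof (rule linear_injective_0[OF linear_C, THEN iffD2], intro allI impI)
    fix v assume "C y v = 0"
    then have "r * norm v \<le> 0" using V(5)[OF y, of v] by simp
    then show "v = 0" using V(1) by (simp add: mult_le_0_iff)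
  qed
  have Cinv: "C y (inv (C y) u) = u" "inv (C y) (C y u) = u" if "y \<in> V" for y u
    using surj_f_inv_f[OF linear_inj_surj[OF linear_C inj[OF that]]] inv_f_f[OF inj[OF that]] by auto
  have linv: "linear (inv (C y))" if "y \<in> V" for y by (rule inj_linear_imp_inv_linear[OF linear_C inj[OF that]])
  have sV: "smooth_on V f" if "smooth_on U f" for f :: "real ^ 'n \<Rightarrow> 'x::real_normed_vector"
    by (rule smooth_on_subset[OF that V(4)])
  \<comment> \<open>The coordinates of the shape operator on \<open>c i y\<close> in the moving
    frame; the last one turns out to be 0 because the value is tangential.\<close>
  define Z where "Z = (\<lambda>i y. inv (C y) (shape (\<gamma> y) (c i y)))"
  have sZ: "smooth_on V (Z i)" for i unfolding Z_def
    by (rule smooth_on_solve[OF V(2) linear_C inj sV[OF smooth_C] sV[OF smooth_shape_c]])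
  define S where "S = (\<lambda>i j y. fst (Z i y) $ j)"
  have sS: "smooth_on V (S i j)" for i j unfolding S_def
    by (rule smooth_on_linear_compose[OF V(2) bounded_linear_compose[OF bounded_linear_vec_nth bounded_linear_fst] sZ])
  have Z: "Z i y = (\<Sum>j\<in>UNIV. S i j y *\<^sub>R (axis j 1, 0))" and shape_c: "shape (\<gamma> y) (c i y) = (\<Sum>j\<in>UNIV. S i j y *\<^sub>R c j y)"
    if y: "y \<in> V" for i y
  proof -
    have CZ: "C y (Z i y) = shape (\<gamma> y) (c i y)" unfolding Z_def by (rule Cinv(1)[OF y])
    have "\<gamma> y \<bullet> c j y = 0" for j using c_T[OF VU[OF y]] by (simp add: tangent_space_Sn[OF \<gamma>S[OF y]])
    moreover have "\<gamma> y \<bullet> \<gamma> y = 1" using \<gamma>S[OF y] by (simp add: Sn_eq)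
    ultimately have "\<gamma> y \<bullet> C y (Z i y) = snd (Z i y)" by (simp add: C_def inner_simps inner_sum_right)
    moreover have "\<gamma> y \<bullet> C y (Z i y) = 0"
      unfolding CZ using shape_tangent[OF \<gamma>S[OF y]] by (simp add: tangent_space_Sn[OF \<gamma>S[OF y]])
    ultimately have snd: "snd (Z i y) = 0" by simp
    show "shape (\<gamma> y) (c i y) = (\<Sum>j\<in>UNIV. S i j y *\<^sub>R c j y)"
      unfolding CZ[symmetric] C_def by (simp add: snd S_def)
    show "Z i y = (\<Sum>j\<in>UNIV. S i j y *\<^sub>R (axis j 1, 0))"
      unfolding S_def prod_eq_iff fst_sum snd_sum
      using snd basis_expansion[of "fst (Z i y)"] by (simp add: scalar_mult_eq_scaleR)
  qed
  have C_axis: "C y (axis i 1, 0) = c i y" "C y (0, 1) = \<gamma> y" for i y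
    by (simp_all add: C_def axis_def if_distrib[of "\<lambda>x. x *\<^sub>R _"] cong: if_cong)
  have mean_S: "mean (\<gamma> y) = (\<Sum>i\<in>UNIV. S i i y)"
    and sq_S: "sq (\<gamma> y) = (\<Sum>i\<in>UNIV. \<Sum>j\<in>UNIV. S i j y * S j i y)" if y: "y \<in> V" for y
  proof -
    note ls = linear_shape[OF \<gamma>S[OF y]]
    have lFC: "linear (\<lambda>v. F (C y v))" if "linear F" for F :: "'n euc \<Rightarrow> 'n euc"
      using linear_compose[OF linear_C that] by (simp add: o_def)
    \<comment> \<open>Conjugation by \<open>C y\<close> leaves the trace unchanged, which expresses
      the ambient traces in \<open>mean\<close> and \<open>sq\<close> through the coordinate matrix
      \<open>S\<close>.\<close>
    have tr: "(\<Sum>b\<in>Basis. F b \<bullet> b) = (\<Sum>i\<in>UNIV. inv (C y) (F (c i y)) \<bullet> (axis i 1, 0)) + inv (C y) (F (\<gamma> y)) \<bullet> (0, 1)"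
      if F: "linear F" for F
    proof -
      have "(\<Sum>b\<in>Basis. F b \<bullet> b) = (\<Sum>b\<in>Basis. F (C y (inv (C y) b)) \<bullet> b)" by (simp only: Cinv(1)[OF y])
      also have "\<dots> = (\<Sum>b\<in>Basis. inv (C y) (F (C y b)) \<bullet> b)" by (rule trace_commute[OF lFC[OF F] linv[OF y]])
      finally show ?thesis unfolding sum_Basis_euc C_axis .
    qed
    have inner_axis: "u \<bullet> (axis i 1, 0) = fst u $ i" for u :: "'n euc" and i
      by (simp add: inner_prod_def inner_axis)
    have s0: "shape (\<gamma> y) (\<gamma> y) = 0" by (rule shape_self[OF \<gamma>S[OF y]])
    show "mean (\<gamma> y) = (\<Sum>i\<in>UNIV. S i i y)"
      unfolding mean_def tr[OF ls] s0 linear_0[OF linv[OF y]] inner_axis by (simp add: S_def Z_def)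
    have l2: "linear (\<lambda>u. shape (\<gamma> y) (shape (\<gamma> y) u))" using linear_compose[OF ls ls] by (simp add: o_def)
    have "inv (C y) (shape (\<gamma> y) (shape (\<gamma> y) (c i y))) = (\<Sum>j\<in>UNIV. S i j y *\<^sub>R Z j y)" for i
      unfolding shape_c[OF y, of i] linear_sum[OF ls] linear_cmul[OF ls] linear_sum[OF linv[OF y]] linear_cmul[OF linv[OF y]] Z_def ..
    then have "inv (C y) (shape (\<gamma> y) (shape (\<gamma> y) (c i y))) \<bullet> (axis i 1, 0) = (\<Sum>j\<in>UNIV. S i j y * S j i y)" for i
      unfolding inner_axis by (simp add: fst_sum S_def)
    then show "sq (\<gamma> y) = (\<Sum>i\<in>UNIV. \<Sum>j\<in>UNIV. S i j y * S j i y)"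
      unfolding sq_def tr[OF l2] s0 linear_0[OF ls] linear_0[OF linv[OF y]] by simp
  qed
  define H where "H = (\<lambda>y. \<Sum>i\<in>UNIV. S i i y)"
  define P where "P = (\<lambda>y. H y * H y - (\<Sum>i\<in>UNIV. \<Sum>j\<in>UNIV. S i j y * S j i y))"
  have DX\<gamma>: "dird (\<lambda>y. X (\<gamma> y)) (axis i 1) y = J (\<gamma> y) (c i y)" if "y \<in> V" for i y
    by (rule dird_X_\<gamma>[OF VU[OF that]])
  have DX0: "dird (\<lambda>y. X (\<gamma> y)) (axis i 1) 0 = J p (e i)" for i
    unfolding DX\<gamma>[OF V(3)] \<gamma>_0 c_0 ..
  have simons: "(\<Sum>l\<in>UNIV. (H 0 - k l) * dird (dird H (axis l 1)) (axis l 1) 0)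
    = (\<Sum>l\<in>UNIV. dird (dird P (axis l 1)) (axis l 1) 0) / 2 - (\<Sum>l\<in>UNIV. (dird H (axis l 1) 0)\<^sup>2)
    + (\<Sum>l\<in>UNIV. \<Sum>i\<in>UNIV. \<Sum>j\<in>UNIV. (dird (S i j) (axis l 1) 0)\<^sup>2)
    + (\<Sum>i\<in>UNIV. \<Sum>j\<in>UNIV. (k i - k j)\<^sup>2 * (1 / \<rho>\<^sup>2 - k i * k j)) / 2"
  proof (rule contracted_simons[of V "\<lambda>y. X (\<gamma> y)" "\<lambda>y. nu (\<gamma> y)" S, OF V(2,3) _ _ sS])
    show "smooth_on V (\<lambda>y. X (\<gamma> y))" "smooth_on V (\<lambda>y. nu (\<gamma> y))"
      by (intro sV chain(3)[OF U(2)] X_smooth smooth_nu)+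
    show "mink (X (\<gamma> y)) (X (\<gamma> y)) = \<rho>\<^sup>2" "mink (nu (\<gamma> y)) (nu (\<gamma> y)) = -1" "mink (X (\<gamma> y)) (nu (\<gamma> y)) = 0"
      "mink (dird (\<lambda>y. X (\<gamma> y)) (axis i 1) y) (nu (\<gamma> y)) = 0" if "y \<in> V" for y i
      using \<gamma>S[OF that] by (simp_all add: X_X nu_nu nu_X DX\<gamma>[OF that] nu_J)
    show "dird (\<lambda>y. nu (\<gamma> y)) (axis i 1) y = - (\<Sum>j\<in>UNIV. S i j y *\<^sub>R dird (\<lambda>y. X (\<gamma> y)) (axis j 1) y)"
      if "y \<in> V" for y i
      unfolding DX\<gamma>[OF that] dird_nu_\<gamma>[OF VU[OF that]] shape_c[OF that]
        linear_sum[OF linear_J[OF \<gamma>S[OF that]]] linear_cmul[OF linear_J[OF \<gamma>S[OF that]]] ..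
    show "mink (dird (\<lambda>y. X (\<gamma> y)) (axis i 1) 0) (dird (\<lambda>y. X (\<gamma> y)) (axis j 1) 0) = (if i = j then 1 else 0)" for i j
      unfolding DX0 J_J[OF eT eT] by (rule on)
    show "mink (dird (dird (\<lambda>y. X (\<gamma> y)) (axis i 1)) (axis j 1) 0) (dird (\<lambda>y. X (\<gamma> y)) (axis l 1) 0) = 0" for i j l
      unfolding DX0 by (rule normal_coordinates)
    show "S i j 0 = (if i = j then k i else 0)" for i j
    proof -
      have "shape (\<gamma> 0) (c i 0) = C 0 (k i *\<^sub>R axis i 1, 0)"
        using linear_cmul[OF linear_C, of 0 "k i" "(axis i 1, 0)"] C_axis(1)[of 0 i]
        by (simp add: \<gamma>_0 c_0 shape_e)
      then show ?thesis unfolding S_def Z_def using Cinv(2)[OF V(3)] by (simp add: axis_def)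
    qed
    show "z = (mink z (X (\<gamma> 0)) / \<rho>\<^sup>2) *\<^sub>R X (\<gamma> 0) - mink z (nu (\<gamma> 0)) *\<^sub>R nu (\<gamma> 0)"
      if "\<And>l. mink z (dird (\<lambda>y. X (\<gamma> y)) (axis l 1) 0) = 0" for z
      using decomposition_frame[of z] that unfolding DX0 \<gamma>_0 by simp
  qed (simp_all add: H_def P_def)
  have H_mean: "H y = mean (\<gamma> y)" if "y \<in> V" for y using mean_S[OF that] by (simp add: H_def)
  have P_psi: "P y = ext psi (q y)" if "y \<in> V" for y
    using H_mean[OF that] sq_S[OF that] by (simp add: P_def ext_def \<gamma>_def[symmetric] psi_def)
  have s_mean: "smooth_on V (\<lambda>y. mean (\<gamma> y))" by (rule sV[OF chain(3)[OF U(2) smooth_mean]])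
  have s_psi: "smooth_on V (\<lambda>y. ext psi (q y))"
    by (rule sV[OF smooth_on_compose[OF U(1) smooth_q[OF U(1)] U(3) smooth_ext[OF smooth_psi]]])
  have mx: "mean (\<gamma> y) \<le> mean (\<gamma> 0)" if "y \<in> V" for y using max[OF \<gamma>S[OF that]] by (simp add: \<gamma>_0)
  have H1: "dird H (axis l 1) 0 = 0" and H2: "dird (dird H (axis l 1)) (axis l 1) 0 \<le> 0" for l
    using interior_maximum[OF V(2,3) s_mean mx, of "axis l 1"]
      dird2_cong_open(1)[OF V(2,3) H_mean s_mean, of "axis l 1"]
      dird2_cong_open(2)[OF V(2,3) H_mean s_mean, of "axis l 1" "axis l 1"] by simp_all
  have P2: "dird (dird P (axis l 1)) (axis l 1) 0 = dird (dird (ext psi) (e l)) (e l) p + dird (ext psi) (w l l) p" for l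
    using dird2_cong_open(2)[OF V(2,3) P_psi s_psi, of "axis l 1" "axis l 1"]
      dird2_q(2)[OF smooth_ext[OF smooth_psi], of l l] by simp
  have H0: "H 0 = mean p" using H_mean[OF V(3)] by (simp add: \<gamma>_0)
  \<comment> \<open>Positivity of \<open>psi p\<close> gives
    \<open>(k l)\<^sup>2 \<le> sq p \<le> (mean p)\<^sup>2\<close>; together with
    \<open>mean p > 0\<close> it makes the coefficients of the second derivatives of
    \<open>H\<close> nonnegative.\<close>
  have "k l \<le> mean p" for l
  proof -
    have "(k l)\<^sup>2 \<le> sq p" unfolding k(2) by (rule member_le_sum) auto
    also have "\<dots> \<le> (mean p)\<^sup>2" using pos(2) by (simp add: psi_def power2_eq_square)
    finally show ?thesis using pos(1) by (metis abs_le_square_iff abs_of_pos abs_ge_self order_trans)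
  qed
  then have "(\<Sum>l\<in>UNIV. (H 0 - k l) * dird (dird H (axis l 1)) (axis l 1) 0) \<le> 0"
    using H2 H0 by (intro sum_nonpos mult_nonneg_nonpos) auto
  moreover have "(\<Sum>l\<in>UNIV. \<Sum>i\<in>UNIV. \<Sum>j\<in>UNIV. (dird (S i j) (axis l 1) 0)\<^sup>2) \<ge> 0"
    by (intro sum_nonneg) auto
  moreover have "sq p * ((real CARD('n) - 1) / \<rho>\<^sup>2 - psi p / 2) - psi p / \<rho>\<^sup>2
      \<le> (\<Sum>i\<in>UNIV. \<Sum>j\<in>UNIV. (k i - k j)\<^sup>2 * (1 / \<rho>\<^sup>2 - k i * k j)) / 2"
    using curvature_term_bound[of k "psi p" "1 / \<rho>\<^sup>2"] pos
    by (simp add: k psi_def power2_eq_square)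
  moreover have "(\<Sum>l\<in>UNIV. (dird H (axis l 1) 0)\<^sup>2) = 0" by (simp add: H1)
  ultimately show ?thesis using simons unfolding P2 by linarith
qed

end

subsection \<open>Uniform bounds\<close>

lemma bounded_on_Sn:
  fixes f :: "('n::finite) euc \<Rightarrow> real"
  assumes "smooth_map_on Sn f"
  obtains K where "K \<ge> 0" "\<And>p. p \<in> Sn \<Longrightarrow> \<bar>f p\<bar> \<le> K"
proof -
  have "bounded (f ` Sn)"
    by (intro compact_imp_bounded compact_continuous_image smooth_map_on_continuous assms) (simp add: Sn_def)
  then obtain K where K: "\<And>y. y \<in> f ` Sn \<Longrightarrow> norm y \<le> K" unfolding bounded_iff by blast
  show ?thesis by (rule that[of "max K 0"]) (use K in \<open>auto simp: le_max_iff_disj\<close>)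
qed

lemma compact_Sn: "compact (Sn :: ('n::finite) euc set)"
  by (simp add: Sn_def)

lemma Sn_nonempty: "(Sn :: ('n::finite) euc set) \<noteq> {}"
proof -
  have "(0, 1) \<in> (Sn :: 'n euc set)" by (simp add: Sn_eq inner_prod_def)
  then show ?thesis by blast
qed

lemma dird2_basis2:
  fixes f :: "'a::euclidean_space \<Rightarrow> 'b::real_normed_vector"
  assumes U: "open U" "x \<in> U" and f: "smooth_on U f"
  shows "dird (dird f u) u x = (\<Sum>b\<in>Basis. \<Sum>c\<in>Basis. ((u \<bullet> b) * (u \<bullet> c)) *\<^sub>R dird (dird f b) c x)"
  unfolding dird2_basis[OF assms, of u]
proof (rule sum.cong[OF refl])
  fix b :: 'a
  show "(u \<bullet> b) *\<^sub>R dird (dird f b) u x = (\<Sum>c\<in>Basis. ((u \<bullet> b) * (u \<bullet> c)) *\<^sub>R dird (dird f b) c x)"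
    by (subst dird_basis[OF smooth_onD(1)[OF smooth_onD(2)[OF f] U(2)], of _ u]) (simp add: scaleR_sum_right)
qed

lemma abs_quadratic_form_le:
  fixes u :: "'a::euclidean_space"
  assumes "\<And>b c. b \<in> Basis \<Longrightarrow> c \<in> Basis \<Longrightarrow> \<bar>B b c\<bar> \<le> K b c"
  shows "\<bar>\<Sum>b\<in>Basis. \<Sum>c\<in>Basis. (u \<bullet> b) * (u \<bullet> c) * B b c\<bar> \<le> (\<Sum>b\<in>Basis. \<Sum>c\<in>Basis. K b c) * (norm u)\<^sup>2"
proof -
  have "\<bar>(u \<bullet> b) * (u \<bullet> c) * B b c\<bar> \<le> K b c * (norm u)\<^sup>2" if "b \<in> Basis" "c \<in> Basis" for b c
  proof -
    have "\<bar>u \<bullet> b\<bar> * \<bar>u \<bullet> c\<bar> * \<bar>B b c\<bar> \<le> (norm u * norm u) * K b c"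
      using that by (intro mult_mono assms Basis_le_norm) auto
    then show ?thesis by (simp add: abs_mult power2_eq_square mult.commute)
  qed
  then have "(\<Sum>b\<in>Basis. \<Sum>c\<in>Basis. \<bar>(u \<bullet> b) * (u \<bullet> c) * B b c\<bar>) \<le> (\<Sum>b\<in>Basis. \<Sum>c\<in>Basis. K b c * (norm u)\<^sup>2)"
    by (intro sum_mono)
  moreover have "\<bar>\<Sum>b\<in>Basis. \<Sum>c\<in>Basis. (u \<bullet> b) * (u \<bullet> c) * B b c\<bar> \<le> (\<Sum>b\<in>Basis. \<Sum>c\<in>Basis. \<bar>(u \<bullet> b) * (u \<bullet> c) * B b c\<bar>)"
    by (rule order_trans[OF sum_abs sum_mono[OF sum_abs]])
  ultimately show ?thesis by (simp add: sum_distrib_right)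
qed

context embedding
begin

text \<open>Principal frames vary with the embedding, but they are \<open>g\<close>-orthonormal.
  This bound limits their Euclidean length uniformly.\<close>

lemma metric_lower_bound:
  obtains c where "c > 0" "\<And>p u. u \<in> T p \<Longrightarrow> c * (norm u)\<^sup>2 \<le> g p u u"
proof -
  \<comment> \<open>Smoothness of \<open>gram\<close> is known for fixed arguments only; the
    expansion over \<open>Basis\<close> makes the form jointly continuous in the point and the
    vector.\<close>
  define f where "f = (\<lambda>z :: 'n euc \<times> 'n euc. \<Sum>b\<in>Basis. (snd z \<bullet> b) * (\<Sum>d\<in>Basis. (snd z \<bullet> d) * (gram (fst z) b \<bullet> d)))"
  have f: "f (p, u) = gram p u \<bullet> u" if "p \<in> Sn" for p u
  proof -
    have "gram p u \<bullet> u = (\<Sum>b\<in>Basis. (u \<bullet> b) *\<^sub>R gram p b) \<bullet> u"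
      using linear_basis_expansion[OF linear_gram[OF that], of u] by (rule arg_cong)
    also have "\<dots> = (\<Sum>b\<in>Basis. (u \<bullet> b) * (gram p b \<bullet> u))" by (simp add: inner_sum_left)
    also have "\<dots> = f (p, u)" unfolding f_def
      by (intro sum.cong refl) (simp add: euclidean_inner[of _ u] mult.commute)
    finally show ?thesis by simp
  qed
  have "smooth_map_on Sn (\<lambda>p. gram p b \<bullet> d)" for b d
    by (rule smooth_map_on_linear_compose[OF bounded_linear_inner_left smooth_gram])
  then have cg: "continuous_on Sn (\<lambda>p. gram p b \<bullet> d)" for b d by (rule smooth_map_on_continuous)
  have cgz: "continuous_on (Sn \<times> sphere 0 1) (\<lambda>z. gram (fst z) b \<bullet> d)" for b d
    by (rule continuous_on_compose2[OF cg continuous_on_fst[OF continuous_on_id]]) auto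
  have cs: "continuous_on (Sn \<times> sphere 0 1) (\<lambda>z :: 'n euc \<times> 'n euc. snd z \<bullet> b)" for b
    by (intro continuous_intros)
  have cf: "continuous_on (Sn \<times> sphere 0 1) f" unfolding f_def by (intro continuous_on_sum continuous_on_mult cs cgz)
  have "Sn \<times> sphere 0 1 \<noteq> ({} :: ('n euc \<times> 'n euc) set)" using Sn_nonempty by (auto simp: Sn_def)
  then obtain z where z: "z \<in> Sn \<times> sphere 0 1" "\<And>y. y \<in> Sn \<times> sphere 0 1 \<Longrightarrow> f z \<le> f y"
    using continuous_attains_inf[OF compact_Times[OF compact_Sn compact_sphere] _ cf] by blast
  obtain p0 u0 where pu: "z = (p0, u0)" "p0 \<in> Sn" "norm u0 = 1" using z(1) by auto
  have "f z > 0"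
  proof -
    have nn: "f z = mink (J p0 u0) (J p0 u0) + (p0 \<bullet> u0) * (p0 \<bullet> u0)"
      unfolding pu(1) f[OF pu(2)] by (rule gram_inner[OF pu(2)])
    have "f z \<noteq> 0"
    proof
      assume "f z = 0"
      then have "mink (J p0 u0) (J p0 u0) = 0" "p0 \<bullet> u0 = 0"
        using nn J_nonneg[OF pu(2), of u0] by (auto simp: add_nonneg_eq_0_iff)
      then have "u0 = 0" using J_zero[OF pu(2), of u0] by (simp add: sph.proj_def)
      then show False using pu(3) by simp
    qed
    moreover have "f z \<ge> 0" unfolding nn using J_nonneg[OF pu(2), of u0] by simp
    ultimately show ?thesis by simp
  qed
  moreover have "f z * (norm u)\<^sup>2 \<le> g p u u" if u: "u \<in> T p" for p u
  proof (cases "u = 0")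
    case True
    then show ?thesis using g_lin(3)[OF u u u, of 0] by simp
  next
    case False
    have p: "p \<in> Sn" by (rule tangent_space_memD[OF u])
    have s: "inverse (norm u) *\<^sub>R u \<in> T p" by (rule subspace_scale[OF subspace_tangent_Sn[OF p] u])
    have "f z \<le> f (p, inverse (norm u) *\<^sub>R u)" using p False by (intro z(2)) simp
    also have "\<dots> = g p (inverse (norm u) *\<^sub>R u) (inverse (norm u) *\<^sub>R u)"
      unfolding f[OF p] gram_inner[OF p] J_J[OF s s] using s by (simp add: tangent_space_Sn[OF p])
    also have "\<dots> = inverse (norm u) * (inverse (norm u) * g p u u)"
      unfolding g_lin(3)[OF u u s] g_sym[OF u s] g_lin(3)[OF u u u] ..
    finally have "f z * (norm u)\<^sup>2 \<le> inverse (norm u) * (inverse (norm u) * g p u u) * (norm u)\<^sup>2"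
      by (rule mult_right_mono) simp
    also have "\<dots> = g p u u" using False by (simp add: power2_eq_square field_simps)
    finally show ?thesis .
  qed
  ultimately show ?thesis by (rule that)
qed

text \<open>The expression is the covariant Hessian of \<open>psi\<close> for tangent
  \<open>u\<close>. It is quadratic in \<open>u\<close> with coefficients smooth on the compact
  sphere, hence bounded uniformly.\<close>

lemma hessian_bound:
  obtains K where "K \<ge> 0"
    "\<And>p u. p \<in> Sn \<Longrightarrow> \<bar>dird (dird (ext psi) u) u p - dird (ext psi) (pull p (dird (dird (ext X) u) u p)) p\<bar> \<le> K * (norm u)\<^sup>2"
proof -
  define B where "B = (\<lambda>b c p. dird (dird (ext psi) b) c p - dird (ext psi) (pull p (dird (dird (ext X) b) c p)) p)"
  have sB: "smooth_map_on Sn (B b c)" for b c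
  proof (rule smooth_map_on_cong)
    show "smooth_map_on Sn (\<lambda>p. dird (dird (ext psi) b) c p
        - (\<Sum>d\<in>Basis. (pull p (dird (dird (ext X) b) c p) \<bullet> d) *\<^sub>R dird (ext psi) d p))"
      by (intro smooth_map_on_diff smooth_map_on_sum smooth_map_on_scaleR smooth_map_on_ext_dird2 smooth_psi X_smooth
          smooth_map_on_linear_compose[OF bounded_linear_inner_left] smooth_pull)
    show "B b c p = dird (dird (ext psi) b) c p
        - (\<Sum>d\<in>Basis. (pull p (dird (dird (ext X) b) c p) \<bullet> d) *\<^sub>R dird (ext psi) d p)" if "p \<in> Sn" for p
      unfolding B_def dird_basis[OF smooth_onD(1)[OF smooth_ext[OF smooth_psi]], of p "pull p (dird (dird (ext X) b) c p)"]
      using Sn_nonzero[OF that] by (subst dird_basis[OF smooth_onD(1)[OF smooth_ext[OF smooth_psi]]]) auto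
  qed
  have "\<exists>K. K \<ge> 0 \<and> (\<forall>p\<in>Sn. \<bar>B b c p\<bar> \<le> K)" for b c
    using bounded_on_Sn[OF sB] by metis
  then obtain K where K: "\<And>b c. K b c \<ge> 0" "\<And>b c p. p \<in> Sn \<Longrightarrow> \<bar>B b c p\<bar> \<le> K b c" by metis
  show ?thesis
  proof (rule that[of "\<Sum>b\<in>Basis. \<Sum>c\<in>Basis. K b c"])
    show "(\<Sum>b\<in>Basis. \<Sum>c\<in>Basis. K b c) \<ge> 0" by (intro sum_nonneg K)
    fix p u :: "'n euc" assume p: "p \<in> Sn"
    have p0: "p \<in> - {0}" using Sn_nonzero[OF p] by simp
    note L = dird_linear[OF smooth_onD(1)[OF smooth_ext[OF smooth_psi] p0]]
    have "dird (dird (ext psi) u) u p - dird (ext psi) (pull p (dird (dird (ext X) u) u p)) p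
      = (\<Sum>b\<in>Basis. \<Sum>c\<in>Basis. (u \<bullet> b) * (u \<bullet> c) * B b c p)"
      unfolding dird2_basis2[OF open_nonzero p0 smooth_ext[OF smooth_psi], of u]
        dird2_basis2[OF open_nonzero p0 smooth_ext[OF X_smooth], of u]
        linear_sum[OF linear_pull[OF p]] linear_cmul[OF linear_pull[OF p]] linear_sum[OF L] linear_cmul[OF L]
      by (simp add: B_def sum_subtractf right_diff_distrib)
    then show "\<bar>dird (dird (ext psi) u) u p - dird (ext psi) (pull p (dird (dird (ext X) u) u p)) p\<bar>
        \<le> (\<Sum>b\<in>Basis. \<Sum>c\<in>Basis. K b c) * (norm u)\<^sup>2"
      using abs_quadratic_form_le[of "\<lambda>b c. B b c p" K u] K(2)[OF p] by simp
  qed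
qed

lemma admissibleD:
  assumes n: "CARD('n) \<ge> 2" and adm: "admissible g \<rho> X" and p: "p \<in> Sn"
  obtains k where "principal_curvatures g \<rho> X p k" "mean p > 0" "psi p > 0" "sq p \<ge> 0"
proof -
  obtain k where k: "principal_curvatures g \<rho> X p k" "k \<in> Gamma2"
    using adm p unfolding admissible_def by blast
  note t = curvature_traces(1,2)[OF p k(1)]
  have "mean p > 0" unfolding t using Gamma2_D(2)[OF n k(2)] .
  moreover have "psi p > 0" unfolding psi_def t using Gamma2_D(1)[OF n k(2)] P2_eq[of k] by (simp add: power2_eq_square)
  moreover have "sq p \<ge> 0" unfolding t by (intro sum_nonneg) auto
  ultimately show ?thesis using that k(1) by blast
qed

text \<open>\<open>X\<close> serves as a reference: all constants are extracted from it before the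
  competing embedding \<open>X'\<close> is introduced, and the quantities of \<open>X'\<close>
  entering the estimate are then rewritten through those of \<open>X\<close>.\<close>

lemma uniform_estimate:
  assumes n: "CARD('n) \<ge> 2" and adm: "admissible g \<rho> X"
    and bound: "\<And>p. p \<in> Sn \<Longrightarrow> psi p < 2 * (real CARD('n) - 1) / \<rho>\<^sup>2"
  shows "\<exists>C>0. \<forall>X'. isometric_embedding g \<rho> X' \<and> admissible g \<rho> X' \<longrightarrow>
    (\<forall>p\<in>Sn. norm_squared Sn g (second_fundamental_form g \<rho> X') p \<le> C)"
proof -
  obtain c where c: "c > 0" "\<And>p u. u \<in> T p \<Longrightarrow> c * (norm u)\<^sup>2 \<le> g p u u" using metric_lower_bound by blast
  obtain K where K: "K \<ge> 0" "\<And>p u. p \<in> Sn \<Longrightarrow>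
      \<bar>dird (dird (ext psi) u) u p - dird (ext psi) (pull p (dird (dird (ext X) u) u p)) p\<bar> \<le> K * (norm u)\<^sup>2"
    using hessian_bound by blast
  obtain M where M: "M \<ge> 0" "\<And>p. p \<in> Sn \<Longrightarrow> \<bar>psi p\<bar> \<le> M" using bounded_on_Sn[OF smooth_psi] by blast
  define a where "a = (\<lambda>p. (real CARD('n) - 1) / \<rho>\<^sup>2 - psi p / 2)"
  have "continuous_on Sn a" unfolding a_def
    by (intro continuous_intros smooth_map_on_continuous[OF smooth_psi]) auto
  then obtain z where z: "z \<in> Sn" "\<And>p. p \<in> Sn \<Longrightarrow> a z \<le> a p"
    using continuous_attains_inf[OF compact_Sn Sn_nonempty] by blast
  have az: "a z > 0" using bound[OF z(1)] unfolding a_def times_divide_eq_right[symmetric] by linarith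
  define R where "R = real CARD('n) * (K / c)"
  have R: "R \<ge> 0" using K(1) c(1) by (simp add: R_def)
  \<comment> \<open>\<open>M\<close> bounds \<open>psi\<close>, and each of the n second derivatives
    in the Laplacian is at least \<open>- (K / c)\<close>; dividing by the minimum
    \<open>a z\<close> of the factor of the squared norm gives \<open>Q\<close>.\<close>
  define Q where "Q = (M / \<rho>\<^sup>2 + R / 2) / a z"
  have Q0: "Q \<ge> 0" unfolding Q_def using M(1) R az rho by (intro divide_nonneg_pos add_nonneg_nonneg) auto
  have main: "norm_squared Sn g (second_fundamental_form g \<rho> X') x \<le> Q + M"
    if X': "isometric_embedding g \<rho> X'" and adm': "admissible g \<rho> X'" and x: "x \<in> Sn" for X' x
  proof -
    interpret E: embedding g \<rho> X' by unfold_locales (rule rho g X')+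
    \<comment> \<open>By the traced Gauss equation both sides are determined by the scalar curvature
      of \<open>g\<close>.\<close>
    have psi_eq: "E.psi y = psi y" if y: "y \<in> Sn" for y
    proof -
      obtain k where k: "principal_curvatures g \<rho> X y k" using admissibleD[OF n adm y] by blast
      obtain k' where k': "principal_curvatures g \<rho> X' y k'" using E.admissibleD[OF n adm' y] by blast
      show ?thesis using curvature_traces(4)[OF y k] E.curvature_traces(4)[OF y k'] by linarith
    qed
    obtain p where p: "p \<in> Sn" and max: "\<And>y. y \<in> Sn \<Longrightarrow> E.mean y \<le> E.mean p"
      using continuous_attains_sup[OF compact_Sn Sn_nonempty smooth_map_on_continuous[OF E.smooth_mean]] by blast
    obtain k where k: "principal_curvatures g \<rho> X' p k" "E.mean p > 0" "E.psi p > 0" "E.sq p \<ge> 0"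
      using E.admissibleD[OF n adm' p] by blast
    obtain e where e: "orthonormal_frame Sn g p (range e)" "\<And>i. e i \<in> T p"
      "\<And>i j. g p (e i) (e j) = (if i = j then 1 else 0)" "\<And>i. E.shape p (e i) = k $ i *\<^sub>R e i"
      "\<And>u. u \<in> T p \<Longrightarrow> u = (\<Sum>i\<in>UNIV. g p u (e i) *\<^sub>R e i)"
      using p k(1) by (rule E.principal_frameE) blast
    interpret A: adapted_frame g \<rho> X' p e "\<lambda>i. k $ i"
      by unfold_locales (rule p, rule e(2), rule e(3), rule e(4), rule e(5))
    have p0: "p \<in> - {0}" using Sn_nonzero[OF p] by simp
    have ext_eq: "ext E.psi y = ext psi y" if "y \<in> - {0}" for y
      using that psi_eq[OF radial_Sn, of y] by (simp add: ext_def)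
    have d1: "dird (ext E.psi) v p = dird (ext psi) v p" for v
      by (rule dird2_cong_open(1)[OF open_nonzero p0 ext_eq smooth_ext[OF smooth_psi]])
    have d2: "dird (dird (ext E.psi) v) v p = dird (dird (ext psi) v) v p" for v
      by (rule dird2_cong_open(2)[OF open_nonzero p0 ext_eq smooth_ext[OF smooth_psi]])
    \<comment> \<open>The quadratic part of the coordinates for \<open>X'\<close> is that of the
      reference embedding, since both are given by the Levi-Civita connection of
      \<open>g\<close>.\<close>
    have w: "A.w l l = - pull p (dird (dird (ext X) (e l)) (e l) p)" for l
      unfolding A.w_def E.christoffel[OF p e(2)] christoffel[OF p e(2)] ..
    have L: "- (K / c) \<le> dird (dird (ext E.psi) (e l)) (e l) p + dird (ext E.psi) (A.w l l) p" for l
    proof -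
      have "c * (norm (e l))\<^sup>2 \<le> 1" using c(2)[OF e(2), of l] e(3)[of l l] by simp
      then have "(norm (e l))\<^sup>2 \<le> 1 / c" using c(1) by (simp add: field_simps)
      then have "K * (norm (e l))\<^sup>2 \<le> K / c" using mult_left_mono[OF _ K(1)] by fastforce
      moreover have "dird (ext psi) (A.w l l) p = - dird (ext psi) (pull p (dird (dird (ext X) (e l)) (e l) p)) p"
        unfolding w by (rule linear_neg[OF dird_linear[OF smooth_onD(1)[OF smooth_ext[OF smooth_psi] p0]]])
      ultimately show ?thesis using K(2)[OF p, of "e l"] unfolding d1 d2 by linarith
    qed
    have "(\<Sum>l\<in>(UNIV :: 'n set). - (K / c)) \<le> (\<Sum>l\<in>UNIV. dird (dird (ext E.psi) (e l)) (e l) p + dird (ext E.psi) (A.w l l) p)"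
      by (rule sum_mono) (rule L)
    then have h: "- R \<le> (\<Sum>l\<in>UNIV. dird (dird (ext E.psi) (e l)) (e l) p + dird (ext E.psi) (A.w l l) p)"
      by (simp add: R_def)
    have "E.sq p * a z \<le> E.sq p * a p" using z(2)[OF p] k(4) by (rule mult_left_mono)
    also have "\<dots> \<le> E.psi p / \<rho>\<^sup>2 - (\<Sum>l\<in>UNIV. dird (dird (ext E.psi) (e l)) (e l) p + dird (ext E.psi) (A.w l l) p) / 2"
      using A.maximum_estimate[OF max E.curvature_traces(1,2)[OF p k(1)] k(2,3)] by (simp add: a_def psi_eq[OF p])
    also have "\<dots> \<le> M / \<rho>\<^sup>2 + R / 2"
    proof -
      have "E.psi p / \<rho>\<^sup>2 \<le> M / \<rho>\<^sup>2" using M(2)[OF p] psi_eq[OF p] by (intro divide_right_mono) auto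
      then show ?thesis using h by linarith
    qed
    finally have sq: "E.sq p \<le> Q" unfolding Q_def using az by (simp add: pos_le_divide_eq)
    \<comment> \<open>The maximum was that of the mean curvature, not of the squared norm: at any
      \<open>x\<close> the squared norm is below the squared mean curvature, which is largest at
      \<open>p\<close> and there equals \<open>sq p + psi p\<close>.\<close>
    obtain k' where k': "principal_curvatures g \<rho> X' x k'" "E.mean x > 0" "E.psi x > 0" "E.sq x \<ge> 0"
      using E.admissibleD[OF n adm' x] by blast
    have "norm_squared Sn g (second_fundamental_form g \<rho> X') x = E.sq x" by (rule E.curvature_traces(3)[OF x k'(1)])
    also have "\<dots> \<le> E.mean x * E.mean x" using k'(3) by (simp add: E.psi_def)
    also have "\<dots> \<le> E.mean p * E.mean p" using max[OF x] k'(2) by (intro mult_mono) auto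
    also have "\<dots> = E.sq p + E.psi p" by (simp add: E.psi_def)
    also have "\<dots> \<le> Q + M" using sq M(2)[OF p] psi_eq[OF p] by simp
    finally show ?thesis .
  qed
  show ?thesis
  proof (intro exI[of _ "Q + M + 1"] conjI allI impI ballI)
    show "Q + M + 1 > 0" using Q0 M(1) by simp
    fix X' and x :: "'n euc" assume "isometric_embedding g \<rho> X' \<and> admissible g \<rho> X'" "x \<in> Sn"
    then show "norm_squared Sn g (second_fundamental_form g \<rho> X') x \<le> Q + M + 1" using main[of X' x] by simp
  qed
qed

end

lemma curvature_estimate:
  fixes g :: "('n::finite) euc form2"
  assumes n: "CARD('n) \<ge> 2" and g: "riemannian_metric Sn g" and rho: "\<rho> > 0"
    and bound: "\<And>X p k. embedding g \<rho> X \<Longrightarrow> p \<in> Sn \<Longrightarrow> principal_curvatures g \<rho> X p k \<Longrightarrow>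
      embedding.psi \<rho> X p < 2 * (real CARD('n) - 1) / \<rho>\<^sup>2"
  shows "\<exists>C>0. \<forall>X. isometric_embedding g \<rho> X \<and> admissible g \<rho> X \<longrightarrow>
    (\<forall>p\<in>Sn. norm_squared Sn g (second_fundamental_form g \<rho> X) p \<le> C)"
proof (cases "\<exists>X. isometric_embedding g \<rho> X \<and> admissible g \<rho> X")
  case True
  then obtain X where iso: "isometric_embedding g \<rho> X" and adm: "admissible g \<rho> X" by blast
  interpret embedding g \<rho> X by unfold_locales (rule rho g iso)+
  show ?thesis
  proof (rule uniform_estimate[OF n adm])
    fix p :: "'n euc" assume p: "p \<in> Sn"
    obtain k where "principal_curvatures g \<rho> X p k" using admissibleD[OF n adm p] by blast
    then show "psi p < 2 * (real CARD('n) - 1) / \<rho>\<^sup>2" by (rule bound[OF embedding_axioms p])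
  qed
next
  case False
  \<comment> \<open>Without an admissible embedding there is no reference, but then any constant
    satisfies the claim.\<close>
  then show ?thesis by (intro exI[of _ 1]) auto
qed

theorem theorem1:
  shows "(\<forall>g :: 2 euc form2.
            riemannian_metric Sn g \<and> positive_curvature Sn g \<longrightarrow>
            (\<exists>\<rho>\<^sub>0>0. \<forall>\<rho>. 0 < \<rho> \<and> \<rho> < \<rho>\<^sub>0 \<longrightarrow>
               (\<exists>C>0. \<forall>X. isometric_embedding g \<rho> X \<and> admissible g \<rho> X \<longrightarrow>
                  (\<forall>p\<in>Sn. norm_squared Sn g (second_fundamental_form g \<rho> X) p \<le> C))))
       \<and> (\<forall>(g :: ('n::finite) euc form2) \<rho>::real.
            CARD('n) \<ge> 2 \<and> \<rho> > 0 \<and> riemannian_metric Sn g \<and>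
            (\<forall>p\<in>Sn. real CARD('n) * (real CARD('n) - 2) / \<rho>\<^sup>2 < scalar_curvature Sn g p \<and>
                    scalar_curvature Sn g p < real CARD('n) * (real CARD('n) - 1) / \<rho>\<^sup>2) \<longrightarrow>
            (\<exists>C. \<forall>X. isometric_embedding g \<rho> X \<and> admissible g \<rho> X \<longrightarrow>
               (\<forall>p\<in>Sn. norm_squared Sn g (second_fundamental_form g \<rho> X) p \<le> C)))"
proof (intro conjI allI impI)
  fix g :: "2 euc form2"
  assume g: "riemannian_metric Sn g \<and> positive_curvature Sn g"
  show "\<exists>\<rho>\<^sub>0>0. \<forall>\<rho>. 0 < \<rho> \<and> \<rho> < \<rho>\<^sub>0 \<longrightarrow>
      (\<exists>C>0. \<forall>X. isometric_embedding g \<rho> X \<and> admissible g \<rho> X \<longrightarrow>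
        (\<forall>p\<in>Sn. norm_squared Sn g (second_fundamental_form g \<rho> X) p \<le> C))"
  \<comment> \<open>Any positive threshold would serve as the witness, since the estimate below
    holds for each positive \<rho>.\<close>
  proof (rule exI[of _ 1], intro conjI allI impI)
    fix \<rho> :: real assume rho: "0 < \<rho> \<and> \<rho> < 1"
    show "\<exists>C>0. \<forall>X. isometric_embedding g \<rho> X \<and> admissible g \<rho> X \<longrightarrow>
        (\<forall>p\<in>Sn. norm_squared Sn g (second_fundamental_form g \<rho> X) p \<le> C)"
    proof (rule curvature_estimate)
      fix X p k assume e: "embedding g \<rho> X" and p: "p \<in> Sn" and k: "principal_curvatures g \<rho> X p k"
      have "embedding.psi \<rho> X p < 2 / \<rho>\<^sup>2"
        by (rule embedding.sectional_bound[OF e _ conjunct2[OF g] p k]) simp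
      then show "embedding.psi \<rho> X p < 2 * (real CARD(2) - 1) / \<rho>\<^sup>2" by simp
    next
      show "CARD(2) \<ge> 2" by simp
      show "riemannian_metric Sn g" "\<rho> > 0" using g rho by simp_all
    qed
  qed simp
next
  fix g :: "'n euc form2" and \<rho> :: real
  assume A: "CARD('n) \<ge> 2 \<and> \<rho> > 0 \<and> riemannian_metric Sn g \<and>
      (\<forall>p\<in>Sn. real CARD('n) * (real CARD('n) - 2) / \<rho>\<^sup>2 < scalar_curvature Sn g p \<and>
        scalar_curvature Sn g p < real CARD('n) * (real CARD('n) - 1) / \<rho>\<^sup>2)"
  have "\<exists>C>0. \<forall>X. isometric_embedding g \<rho> X \<and> admissible g \<rho> X \<longrightarrow>
      (\<forall>p\<in>Sn. norm_squared Sn g (second_fundamental_form g \<rho> X) p \<le> C)"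
  proof (rule curvature_estimate)
    fix X p k assume e: "embedding g \<rho> X" and p: "p \<in> Sn" and k: "principal_curvatures g \<rho> X p k"
    have "embedding.psi \<rho> X p < real CARD('n) * (real CARD('n) - 1) / \<rho>\<^sup>2 - real CARD('n) * (real CARD('n) - 2) / \<rho>\<^sup>2"
      using embedding.curvature_traces(4)[OF e p k] A p by (smt (verit))
    also have "\<dots> = real CARD('n) / \<rho>\<^sup>2" by (simp add: algebra_simps flip: diff_divide_distrib)
    \<comment> \<open>The inequality n \<le> 2 (n - 1) is the same as n \<ge> 2.\<close>
    also have "\<dots> \<le> 2 * (real CARD('n) - 1) / \<rho>\<^sup>2" using A by (intro divide_right_mono) auto
    finally show "embedding.psi \<rho> X p < 2 * (real CARD('n) - 1) / \<rho>\<^sup>2" .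
  qed (use A in auto)
  then show "\<exists>C. \<forall>X. isometric_embedding g \<rho> X \<and> admissible g \<rho> X \<longrightarrow>
      (\<forall>p\<in>Sn. norm_squared Sn g (second_fundamental_form g \<rho> X) p \<le> C)" by blast
qed

end
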